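(* Let $\mathfrak g$ be a complex semisimple Lie algebra, $\lambda\in\mathfrak g^*$ semisimple, $\mathfrak h$ a Cartan subalgebra of $\mathfrak g$ containing $\lambda^\sharp$, and fix an invariant ordering of the root system $\Delta$. If $\lambda\in\tilde\Lambda$, then the Shapovalov pairing $$\langle\cdot,\cdot\rangle^\sim_\lambda\colon \mathcal U(\tilde{\mathfrak n}^+)\times\mathcal U(\tilde{\mathfrak n}^-)\to\mathbb C$$ is non-degenerate, and its canonical element $F_\lambda\in\mathcal U(\tilde{\mathfrak n}^+)\,\hat\otimes\,\mathcal U(\tilde{\mathfrak n}^-)$ is given by $$F_\lambda=\sum_{w\in\tilde W}p_\lambda^w(\alpha_w)^{-1}\,\tilde\pi_\lambda^+(X_w)\otimes\tilde\pi_\lambda^-(Y_w).$$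
   Context: Notation. $B$ is the Killing form of $\mathfrak g$; for $\xi\in\mathfrak g^*$, $\xi^\sharp\in\mathfrak g$ is defined by $B(\xi^\sharp,\cdot)=\xi$. $\lambda\in\mathfrak g^*$ is semisimple if $\mathrm{ad}_{\lambda^\sharp}$ is diagonalizable. $\Delta$ is the root system of $(\mathfrak g,\mathfrak h)$ with root spaces $\mathfrak g^\alpha$; $\mathfrak h^*\subseteq\mathfrak g^*$ by extending by $0$ on root spaces (so $\lambda\in\mathfrak h^*$), and $(\alpha,\beta):=B(\alpha^\sharp,\beta^\sharp)$ for $\alpha,\beta\in\mathfrak h^*$. $\mathfrak g_\lambda:=\{X\in\mathfrak g:\lambda([X,Y])=0\ \forall Y\in\mathfrak g\}$. An ordering of $\Delta$ is a subset $\Delta^+\subseteq\Delta$ such that $\Delta$ is the disjoint union of $\Delta^+$ and $\Delta^-:=-\Delta^+$, and a sum of positive roots which is a root is positive. Put $\Delta'=\{\alpha\in\Delta:(\alpha,\lambda)=0\}$, $\hat\Delta=\Delta\setminus\Delta'$, $\hat\Delta^\pm=\hat\Delta\cap\Delta^\pm$. The ordering is invariant if $\alpha\in\hat\Delta^+$, $\beta\in\Delta'$, $\alpha+\beta\in\Delta$ imply $\alpha+\beta\in\hat\Delta^+$. Then $\tilde{\mathfrak n}^\pm:=\bigoplus_{\alpha\in\hat\Delta^\pm}\mathfrak g^\alpha$ and $\tilde{\mathfrak b}^\pm:=\mathfrak g_\lambda\oplus\tilde{\mathfrak n}^\pm$ are Lie subalgebras, and $\mathfrak g=\tilde{\mathfrak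 n}^+\oplus\mathfrak g_\lambda\oplus\tilde{\mathfrak n}^-$ as vector spaces. Projections. $\lambda$ restricts to a Lie algebra character of $\mathfrak g_\lambda$; let $\chi_{\pm\lambda}\colon\mathcal U(\mathfrak g_\lambda)\to\mathbb C$ be the algebra homomorphisms extending $\pm\lambda|_{\mathfrak g_\lambda}$, and $\varepsilon$ the counit. By Poincaré–Birkhoff–Witt, define linear maps $\tilde\pi_\lambda^\pm\colon\mathcal U\mathfrak g\to\mathcal U(\tilde{\mathfrak n}^\pm)$ by $\tilde\pi_\lambda^-(vhu)=\chi_\lambda(h)\varepsilon(u)\,v$ and $\tilde\pi_\lambda^+(uhv)=\chi_{-\lambda}(h)\varepsilon(v)\,u$ for $u\in\mathcal U(\tilde{\mathfrak n}^+)$, $h\in\mathcal U(\mathfrak g_\lambda)$, $v\in\mathcal U(\tilde{\mathfrak n}^-)$. Pairing. Let $\tilde{\mathbb C}^+_\lambda$ be the left $\mathcal U(\tilde{\mathfrak b}^+)$-module $\mathbb C$ on which $\mathfrak g_\lambda$ acts by $\lambda$ and $\tilde{\mathfrak n}^+$ by $0$, and $\tilde{\mathbb C}^*_\lambda$ the right $\mathcal U(\tilde{\mathfrak b}^-)$-module $\mathbb C$ on which $\mathfrak g_\lambda$ acts by $\lambda$ and $\tilde{\mathfrak n}^-$ by $0$. With $S$ the antipode of $\mathcal U\mathfrak g$, the Shapovalov pairing is $$\langle u,v\rangle^\sim_\lambda:=1\otimes S(u)v\otimes1\in\tilde{\mathbb C}^*_\lambda\otimes_{\mathcal U(\tilde{\mathfrak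 b}^-)}\mathcal U\mathfrak g\otimes_{\mathcal U(\tilde{\mathfrak b}^+)}\tilde{\mathbb C}^+_\lambda\cong\mathbb C .$$ $\mathcal U\mathfrak g$ is graded by the root lattice $\mathbb Z\Delta$ ($\mathfrak g^\alpha$ in degree $\alpha$, $\mathfrak h$ in degree $0$), and $\hat\otimes$ denotes the completion of the tensor product with respect to this grading. If the pairing is non-degenerate, one can choose bases $\{u_i\}$ of $\mathcal U(\tilde{\mathfrak n}^+)$ and $\{v_j\}$ of $\mathcal U(\tilde{\mathfrak n}^-)$ of homogeneous elements with $\langle u_i,v_j\rangle^\sim_\lambda=\delta_{ij}$; the canonical element is $F_\lambda:=\sum_iu_i\otimes v_i$ (independent of choices). Coefficients. $\rho=\frac12\sum_{\alpha\in\Delta^+}\alpha$ and $p_\lambda(\mu):=\frac12(\mu,\mu)-(\rho,\mu)-(\lambda,\mu)$ for $\mu\in\mathfrak h^*$. $\mathbb N_0\hat\Delta^+$ is the set of non-negative integral linear combinations of elements of $\hat\Delta^+$. $\tilde\Lambda:=\{\lambda\in\mathfrak h^*:p_\lambda(\mu)\neq0\ \forall\mu\in\mathbb N_0\hat\Delta^+\setminus\{0\}\}$. Let $\alpha_1,\dots,\alpha_k$ be the positive roots, and choose $X_i\in\mathfrak g^{\alpha_i}$, $Y_i\in\mathfrak g^{-\alpha_i}$ with $B(X_i,Y_i)=1$. For a word $w=(w_1,\dots,w_{|w|})$ with letters in $\{1,\dots,k\}$ (including the empty word) put $X_w=X_{w_1}\cdots X_{w_{|w|}}$, $Y_w=Y_{w_1}\cdots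 Y_{w_{|w|}}$ (equal to $1$ for the empty word), $\alpha_w=\alpha_{w_1}+\dots+\alpha_{w_{|w|}}$, $w_{i\dots j}=(w_i,\dots,w_j)$ (empty if $j<i$), and $p_\lambda^w(\mu):=\prod_{i=0}^{|w|-1}p_\lambda(\mu-\alpha_{w_{1\dots i}})$; thus $p^w_\lambda(\alpha_w)=\prod_{i=1}^{|w|}p_\lambda(\alpha_{w_{i\dots|w|}})$. $\tilde W$ is the set of words $w$ with $\alpha_{w_{i\dots|w|}}\in\mathbb N_0\hat\Delta^+$ for all $i=1,\dots,|w|$. *)

theory Defs
  imports Complex_Main "HOL-Library.Poly_Mapping" "HOL-Library.Function_Algebras"
begin

section \<open>Complex vector spaces\<close>

class complex_vspace = ab_group_add +
  fixes cscale :: "complex \<Rightarrow> 'a \<Rightarrow> 'a"  (infixr \<open>*\<^sub>C\<close> 75)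
  assumes cscale_add_right: "a *\<^sub>C (x + y) = a *\<^sub>C x + a *\<^sub>C y"
    and cscale_add_left: "(a + b) *\<^sub>C x = a *\<^sub>C x + b *\<^sub>C x"
    and cscale_cscale: "a *\<^sub>C b *\<^sub>C x = (a * b) *\<^sub>C x"
    and cscale_one: "1 *\<^sub>C x = x"

global_interpretation cvs: vector_space "cscale :: complex \<Rightarrow> 'a \<Rightarrow> 'a::complex_vspace"
  by unfold_locales (simp_all add: cscale_add_right cscale_add_left cscale_cscale cscale_one)

abbreviation clinear :: "('a::complex_vspace \<Rightarrow> 'b::complex_vspace) \<Rightarrow> bool"
  where "clinear \<equiv> Vector_Spaces.linear cscale cscale"

instantiation complex :: complex_vspace
begin
definition cscale_complex :: "complex \<Rightarrow> complex \<Rightarrow> complex"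
  where "cscale_complex c z = c * z"
instance by standard (simp_all add: cscale_complex_def algebra_simps)
end

instantiation poly_mapping :: (type, complex_vspace) complex_vspace
begin
definition cscale_poly_mapping :: "complex \<Rightarrow> ('a \<Rightarrow>\<^sub>0 'b) \<Rightarrow> ('a \<Rightarrow>\<^sub>0 'b)"
  where "cscale_poly_mapping c = Poly_Mapping.map (cscale c)"
instance
proof
  have [simp]: "Poly_Mapping.lookup (c *\<^sub>C p) k = c *\<^sub>C Poly_Mapping.lookup p k"
    for c and p :: "'a \<Rightarrow>\<^sub>0 'b" and k
    by (cases "Poly_Mapping.lookup p k = 0")
       (simp_all add: cscale_poly_mapping_def Poly_Mapping.map.rep_eq)
  show "a *\<^sub>C (x + y) = a *\<^sub>C x + a *\<^sub>C y" "(a + b) *\<^sub>C x = a *\<^sub>C x + b *\<^sub>C x"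
    "a *\<^sub>C b *\<^sub>C x = (a * b) *\<^sub>C x" "1 *\<^sub>C x = x" for a b and x y :: "'a \<Rightarrow>\<^sub>0 'b"
    by (rule poly_mapping_eqI,
        simp add: lookup_add cscale_add_right cscale_add_left cscale_cscale cscale_one)+
qed
end

text \<open>The value does not depend on the basis chosen by \<open>extend_basis\<close>.\<close>

definition ctrace :: "('a::complex_vspace \<Rightarrow> 'a) \<Rightarrow> complex" where
  "ctrace f = (let B = cvs.extend_basis {} in \<Sum>b\<in>B. cvs.representation B (f b) b)"

definition diagonalizable :: "('a::complex_vspace \<Rightarrow> 'a) \<Rightarrow> bool" where
  "diagonalizable f \<longleftrightarrow>
     (\<exists>B. cvs.independent B \<and> cvs.span B = UNIV \<and> (\<forall>b\<in>B. \<exists>c. f b = c *\<^sub>C b))"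


section \<open>Tensor products over the complex numbers\<close>

definition ctensor_relations ::
    "(('a::complex_vspace \<times> 'b::complex_vspace) \<Rightarrow>\<^sub>0 complex) set" where
  "ctensor_relations =
     {Poly_Mapping.single (a + a', b) 1 - Poly_Mapping.single (a, b) 1 - Poly_Mapping.single (a', b) 1
        | a a' b. True} \<union>
     {Poly_Mapping.single (a, b + b') 1 - Poly_Mapping.single (a, b) 1 - Poly_Mapping.single (a, b') 1
        | a b b'. True} \<union>
     {Poly_Mapping.single (c *\<^sub>C a, b) 1 - Poly_Mapping.single (a, b) c | a b c. True} \<union>
     {Poly_Mapping.single (a, c *\<^sub>C b) 1 - Poly_Mapping.single (a, b) c | a b c. True}"

lemma equivp_mod_span: "equivp (\<lambda>p q :: 'a::complex_vspace. p - q \<in> cvs.span R)"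
proof (rule equivpI)
  show "reflp (\<lambda>p q. p - q \<in> cvs.span R)"
    by (simp add: reflp_def cvs.span_zero)
  show "symp (\<lambda>p q. p - q \<in> cvs.span R)"
    by (rule sympI) (use cvs.span_neg in fastforce)
  show "transp (\<lambda>p q. p - q \<in> cvs.span R)"
  proof (rule transpI)
    fix p q r :: 'a assume "p - q \<in> cvs.span R" "q - r \<in> cvs.span R"
    then have "(p - q) + (q - r) \<in> cvs.span R" by (rule cvs.span_add)
    then show "p - r \<in> cvs.span R" by simp
  qed
qed

quotient_type (overloaded) ('a, 'b) ctensor =
    "(('a::complex_vspace \<times> 'b::complex_vspace) \<Rightarrow>\<^sub>0 complex)" /
    "\<lambda>p q. p - q \<in> cvs.span ctensor_relations"
  by (rule equivp_mod_span)

instantiation ctensor :: (complex_vspace, complex_vspace) complex_vspace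
begin
lift_definition zero_ctensor :: "('a, 'b) ctensor" is 0 .
lift_definition plus_ctensor :: "('a, 'b) ctensor \<Rightarrow> ('a, 'b) ctensor \<Rightarrow> ('a, 'b) ctensor" is "(+)"
  by (drule (1) cvs.span_add) (simp add: algebra_simps)
lift_definition uminus_ctensor :: "('a, 'b) ctensor \<Rightarrow> ('a, 'b) ctensor" is uminus
  by (drule cvs.span_neg) simp
lift_definition minus_ctensor :: "('a, 'b) ctensor \<Rightarrow> ('a, 'b) ctensor \<Rightarrow> ('a, 'b) ctensor" is "(-)"
  by (drule (1) cvs.span_diff) (simp add: algebra_simps)
lift_definition cscale_ctensor :: "complex \<Rightarrow> ('a, 'b) ctensor \<Rightarrow> ('a, 'b) ctensor" is cscale
  by (drule cvs.span_scale) (simp add: cvs.scale_right_diff_distrib)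
instance
  by standard (transfer; simp add: cvs.span_zero algebra_simps cscale_cscale cscale_one)+
end

lift_definition ctensor_pure ::
    "'a::complex_vspace \<Rightarrow> 'b::complex_vspace \<Rightarrow> ('a, 'b) ctensor"  (infixl \<open>\<otimes>\<^sub>C\<close> 72)
  is "\<lambda>a b. Poly_Mapping.single (a, b) 1" .


section \<open>Complex Lie algebras\<close>

class complex_lie_algebra = complex_vspace +
  fixes lie :: "'a \<Rightarrow> 'a \<Rightarrow> 'a"
  assumes lie_add_left: "lie (x + y) z = lie x z + lie y z"
    and lie_add_right: "lie x (y + z) = lie x y + lie x z"
    and lie_cscale_left: "lie (c *\<^sub>C x) y = c *\<^sub>C lie x y"
    and lie_cscale_right: "lie x (c *\<^sub>C y) = c *\<^sub>C lie x y"
    and lie_self: "lie x x = 0"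
    and jacobi: "lie x (lie y z) + lie y (lie z x) + lie z (lie x y) = 0"

definition lie_subalgebra :: "'g::complex_lie_algebra set \<Rightarrow> bool" where
  "lie_subalgebra L \<longleftrightarrow> cvs.subspace L \<and> (\<forall>x\<in>L. \<forall>y\<in>L. lie x y \<in> L)"

definition lie_ideal :: "'g::complex_lie_algebra set \<Rightarrow> bool" where
  "lie_ideal I \<longleftrightarrow> cvs.subspace I \<and> (\<forall>x. \<forall>y\<in>I. lie x y \<in> I)"

definition derived_algebra :: "'g::complex_lie_algebra set \<Rightarrow> 'g set" where
  "derived_algebra L = cvs.span {lie x y | x y. x \<in> L \<and> y \<in> L}"

definition solvable_lie :: "'g::complex_lie_algebra set \<Rightarrow> bool" where
  "solvable_lie L \<longleftrightarrow> (\<exists>n. (derived_algebra ^^ n) L = {0})"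

definition semisimple_lie_algebra :: "'g::complex_lie_algebra itself \<Rightarrow> bool" where
  "semisimple_lie_algebra _ \<longleftrightarrow>
     (\<exists>B :: 'g set. finite B \<and> cvs.span B = UNIV) \<and>
     (\<forall>I :: 'g set. lie_ideal I \<and> solvable_lie I \<longrightarrow> I = {0})"

definition killing :: "'g::complex_lie_algebra \<Rightarrow> 'g \<Rightarrow> complex" where
  "killing x y = ctrace (lie x \<circ> lie y)"

definition sharp :: "('g::complex_lie_algebra \<Rightarrow> complex) \<Rightarrow> 'g" where
  "sharp \<xi> = (THE x. \<forall>y. killing x y = \<xi> y)"

definition semisimple_functional :: "('g::complex_lie_algebra \<Rightarrow> complex) \<Rightarrow> bool" where
  "semisimple_functional \<xi> \<longleftrightarrow> clinear \<xi> \<and> diagonalizable (lie (sharp \<xi>))"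

text \<open>
  Cartan subalgebras in the sense used for semisimple Lie algebras: maximal abelian subalgebras
  all of whose elements are ad-diagonalizable.
\<close>

definition abelian_subalgebra :: "'g::complex_lie_algebra set \<Rightarrow> bool" where
  "abelian_subalgebra L \<longleftrightarrow> lie_subalgebra L \<and> (\<forall>x\<in>L. \<forall>y\<in>L. lie x y = 0)"

definition cartan_subalgebra :: "'g::complex_lie_algebra set \<Rightarrow> bool" where
  "cartan_subalgebra h \<longleftrightarrow>
     abelian_subalgebra h \<and> (\<forall>L. abelian_subalgebra L \<and> h \<subseteq> L \<longrightarrow> L = h) \<and>
     (\<forall>x\<in>h. diagonalizable (lie x))"

definition root_space :: "'g::complex_lie_algebra set \<Rightarrow> ('g \<Rightarrow> complex) \<Rightarrow> 'g set" where
  "root_space h \<alpha> = {x. \<forall>H\<in>h. lie H x = \<alpha> H *\<^sub>C x}"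

text \<open>
  Weights are functionals on the whole Lie algebra: \<open>h_dual h\<close> is the dual of \<open>h\<close>, extended by
  0 on every \<open>root_space h \<alpha>\<close> with \<open>\<alpha>\<close> not vanishing on \<open>h\<close>.
\<close>

definition h_dual :: "'g::complex_lie_algebra set \<Rightarrow> ('g \<Rightarrow> complex) set" where
  "h_dual h = {\<xi>. clinear \<xi> \<and>
     (\<forall>\<alpha>. (\<exists>H\<in>h. \<alpha> H \<noteq> 0) \<longrightarrow> (\<forall>x\<in>root_space h \<alpha>. \<xi> x = 0))}"

definition roots :: "'g::complex_lie_algebra set \<Rightarrow> ('g \<Rightarrow> complex) set" where
  "roots h = {\<alpha> \<in> h_dual h. \<alpha> \<noteq> 0 \<and> root_space h \<alpha> \<noteq> {0}}"

definition dform :: "('g::complex_lie_algebra \<Rightarrow> complex) \<Rightarrow> ('g \<Rightarrow> complex) \<Rightarrow> complex" where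
  "dform \<alpha> \<beta> = killing (sharp \<alpha>) (sharp \<beta>)"

definition stabilizer :: "('g::complex_lie_algebra \<Rightarrow> complex) \<Rightarrow> 'g set" where
  "stabilizer lam = {x. \<forall>y. lam (lie x y) = 0}"


section \<open>Orderings and triangular decompositions\<close>

definition root_ordering :: "'g::complex_lie_algebra set \<Rightarrow> ('g \<Rightarrow> complex) set \<Rightarrow> bool" where
  "root_ordering h Pos \<longleftrightarrow>
     roots h = Pos \<union> uminus ` Pos \<and> Pos \<inter> uminus ` Pos = {} \<and>
     (\<forall>\<beta>s. set \<beta>s \<subseteq> Pos \<and> sum_list \<beta>s \<in> roots h \<longrightarrow> sum_list \<beta>s \<in> Pos)"

definition roots_orth ::
    "'g::complex_lie_algebra set \<Rightarrow> ('g \<Rightarrow> complex) \<Rightarrow> ('g \<Rightarrow> complex) set" where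
  "roots_orth h lam = {\<alpha> \<in> roots h. dform \<alpha> lam = 0}"

definition roots_hat ::
    "'g::complex_lie_algebra set \<Rightarrow> ('g \<Rightarrow> complex) \<Rightarrow> ('g \<Rightarrow> complex) set" where
  "roots_hat h lam = roots h - roots_orth h lam"

definition invariant_ordering ::
    "'g::complex_lie_algebra set \<Rightarrow> ('g \<Rightarrow> complex) \<Rightarrow> ('g \<Rightarrow> complex) set \<Rightarrow> bool" where
  "invariant_ordering h lam Pos \<longleftrightarrow>
     root_ordering h Pos \<and>
     (\<forall>\<alpha> \<in> roots_hat h lam \<inter> Pos. \<forall>\<beta> \<in> roots_orth h lam.
        \<alpha> + \<beta> \<in> roots h \<longrightarrow> \<alpha> + \<beta> \<in> roots_hat h lam \<inter> Pos)"

definition root_nilpotent :: "'g::complex_lie_algebra set \<Rightarrow> ('g \<Rightarrow> complex) set \<Rightarrow> 'g set" where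
  "root_nilpotent h R = cvs.span (\<Union>\<alpha>\<in>R. root_space h \<alpha>)"

definition n_plus ::
    "'g::complex_lie_algebra set \<Rightarrow> ('g \<Rightarrow> complex) \<Rightarrow> ('g \<Rightarrow> complex) set \<Rightarrow> 'g set" where
  "n_plus h lam Pos = root_nilpotent h (roots_hat h lam \<inter> Pos)"

definition n_minus ::
    "'g::complex_lie_algebra set \<Rightarrow> ('g \<Rightarrow> complex) \<Rightarrow> ('g \<Rightarrow> complex) set \<Rightarrow> 'g set" where
  "n_minus h lam Pos = root_nilpotent h (roots_hat h lam \<inter> uminus ` Pos)"

definition b_plus ::
    "'g::complex_lie_algebra set \<Rightarrow> ('g \<Rightarrow> complex) \<Rightarrow> ('g \<Rightarrow> complex) set \<Rightarrow> 'g set" where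
  "b_plus h lam Pos = {x + y | x y. x \<in> stabilizer lam \<and> y \<in> n_plus h lam Pos}"

definition b_minus ::
    "'g::complex_lie_algebra set \<Rightarrow> ('g \<Rightarrow> complex) \<Rightarrow> ('g \<Rightarrow> complex) set \<Rightarrow> 'g set" where
  "b_minus h lam Pos = {x + y | x y. x \<in> stabilizer lam \<and> y \<in> n_minus h lam Pos}"


section \<open>The universal enveloping algebra\<close>

text \<open>
  Finitely supported functions on words, with convolution, form the free associative algebra on
  the underlying set of the Lie algebra.  The first two families of relations turn it into the tensor
  algebra, the third one into the universal enveloping algebra.
\<close>

datatype 'a free_monoid = FM "'a list"

instantiation free_monoid :: (type) monoid_add
begin
definition zero_free_monoid :: "'a free_monoid" where "0 = FM []"
fun plus_free_monoid :: "'a free_monoid \<Rightarrow> 'a free_monoid \<Rightarrow> 'a free_monoid"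
  where "FM xs + FM ys = FM (xs @ ys)"
instance
proof
  fix a b c :: "'a free_monoid"
  show "a + b + c = a + (b + c)" by (cases a; cases b; cases c) simp
  show "0 + a = a" "a + 0 = a" by (cases a; simp add: zero_free_monoid_def)+
qed
end

type_synonym 'g free_algebra = "'g free_monoid \<Rightarrow>\<^sub>0 complex"

definition fa_gen :: "'g \<Rightarrow> 'g free_algebra" where
  "fa_gen x = Poly_Mapping.single (FM [x]) 1"

inductive_set uea_ideal :: "('g::complex_lie_algebra) free_algebra set" where
  add_rel: "fa_gen (x + y) - fa_gen x - fa_gen y \<in> uea_ideal"
| scale_rel: "fa_gen (c *\<^sub>C x) - c *\<^sub>C fa_gen x \<in> uea_ideal"
| lie_rel: "fa_gen x * fa_gen y - fa_gen y * fa_gen x - fa_gen (lie x y) \<in> uea_ideal"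
| zero: "0 \<in> uea_ideal"
| add: "p \<in> uea_ideal \<Longrightarrow> q \<in> uea_ideal \<Longrightarrow> p + q \<in> uea_ideal"
| mult_left: "p \<in> uea_ideal \<Longrightarrow> q * p \<in> uea_ideal"
| mult_right: "p \<in> uea_ideal \<Longrightarrow> p * q \<in> uea_ideal"

lemma uea_ideal_minus: "p \<in> uea_ideal \<Longrightarrow> - p \<in> uea_ideal"
  using uea_ideal.mult_left[of p "- 1"] by simp

lemma uea_ideal_cscale: "p \<in> uea_ideal \<Longrightarrow> c *\<^sub>C p \<in> uea_ideal"
proof -
  have "(*\<^sub>C) c = (*) c" by (simp add: fun_eq_iff cscale_complex_def)
  then have "c *\<^sub>C p = Poly_Mapping.single 0 c * p"
    by (simp add: cscale_poly_mapping_def mult_map_scale_conv_mult)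
  then show "p \<in> uea_ideal \<Longrightarrow> c *\<^sub>C p \<in> uea_ideal"
    by (simp add: uea_ideal.mult_left)
qed

lemma lookup_mult_FM_Nil:
  "Poly_Mapping.lookup (p * q) (FM []) =
     Poly_Mapping.lookup p (FM []) * Poly_Mapping.lookup q (FM [])"
  for p q :: "'g free_algebra"
proof -
  have eq: "FM [] = k + l \<longleftrightarrow> k = FM [] \<and> l = FM []" for k l :: "'g free_monoid"
    by (cases k; cases l) auto
  have "(\<Sum>l. Poly_Mapping.lookup q l when FM [] = k + l) =
      (Poly_Mapping.lookup q (FM []) when k = FM [])" for k
    by (cases "k = FM []") (simp_all add: eq)
  then show ?thesis
    by (simp add: lookup_mult mult_when)
qed

lemma uea_ideal_augmentation: "p \<in> uea_ideal \<Longrightarrow> Poly_Mapping.lookup p (FM []) = 0"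
  by (induction rule: uea_ideal.induct)
     (simp_all add: fa_gen_def lookup_add lookup_minus lookup_mult_FM_Nil lookup_single
        cscale_poly_mapping_def Poly_Mapping.map.rep_eq)

lemma one_notin_uea_ideal: "1 \<notin> uea_ideal"
  using uea_ideal_augmentation[of 1] by (auto simp: lookup_one zero_free_monoid_def)

lemma equivp_mod_uea_ideal:
  "equivp (\<lambda>p q :: ('g::complex_lie_algebra) free_algebra. p - q \<in> uea_ideal)"
proof (rule equivpI)
  show "reflp (\<lambda>p q :: 'g free_algebra. p - q \<in> uea_ideal)"
    by (simp add: reflp_def uea_ideal.zero)
  show "symp (\<lambda>p q :: 'g free_algebra. p - q \<in> uea_ideal)"
    by (rule sympI) (use uea_ideal_minus in fastforce)
  show "transp (\<lambda>p q :: 'g free_algebra. p - q \<in> uea_ideal)"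
  proof (rule transpI)
    fix p q r :: "'g free_algebra" assume "p - q \<in> uea_ideal" "q - r \<in> uea_ideal"
    then have "(p - q) + (q - r) \<in> uea_ideal" by (rule uea_ideal.add)
    then show "p - r \<in> uea_ideal" by simp
  qed
qed

quotient_type (overloaded) 'g uea = "('g::complex_lie_algebra) free_algebra" / "\<lambda>p q. p - q \<in> uea_ideal"
  by (rule equivp_mod_uea_ideal)

instantiation uea :: (complex_lie_algebra) "{ring_1, complex_vspace}"
begin
lift_definition zero_uea :: "'a uea" is 0 .
lift_definition one_uea :: "'a uea" is 1 .
lift_definition plus_uea :: "'a uea \<Rightarrow> 'a uea \<Rightarrow> 'a uea" is "(+)"
  by (drule (1) uea_ideal.add) (simp add: algebra_simps)
lift_definition uminus_uea :: "'a uea \<Rightarrow> 'a uea" is uminus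
  by (drule uea_ideal_minus) simp
lift_definition minus_uea :: "'a uea \<Rightarrow> 'a uea \<Rightarrow> 'a uea" is "(-)"
proof -
  fix p p' q q' :: "'a free_algebra"
  assume "p - p' \<in> uea_ideal" "q - q' \<in> uea_ideal"
  then have "(p - p') + - (q - q') \<in> uea_ideal"
    by (intro uea_ideal.add uea_ideal_minus)
  then show "p - q - (p' - q') \<in> uea_ideal"
    by (simp add: algebra_simps)
qed
lift_definition times_uea :: "'a uea \<Rightarrow> 'a uea \<Rightarrow> 'a uea" is "(*)"
proof -
  fix p p' q q' :: "'a free_algebra"
  assume "p - p' \<in> uea_ideal" "q - q' \<in> uea_ideal"
  then have "(p - p') * q + p' * (q - q') \<in> uea_ideal"
    by (intro uea_ideal.add uea_ideal.mult_left uea_ideal.mult_right)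
  then show "p * q - p' * q' \<in> uea_ideal"
    by (simp add: algebra_simps)
qed
lift_definition cscale_uea :: "complex \<Rightarrow> 'a uea \<Rightarrow> 'a uea" is cscale
  by (drule uea_ideal_cscale) (simp add: cvs.scale_right_diff_distrib)
instance
proof
  show "(0 :: 'a uea) \<noteq> 1"
    by transfer (use uea_ideal_minus one_notin_uea_ideal in fastforce)
qed (transfer; simp add: uea_ideal.zero algebra_simps cscale_cscale cscale_one)+
end

lift_definition uea_inj :: "'g::complex_lie_algebra \<Rightarrow> 'g uea" is fa_gen .

text \<open>
  For a Lie subalgebra \<open>L\<close>, \<open>U L\<close> is the subalgebra of the enveloping algebra generated by \<open>L\<close>,
  which is the enveloping algebra of \<open>L\<close> by the Poincare-Birkhoff-Witt theorem.
\<close>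

definition U :: "'g::complex_lie_algebra set \<Rightarrow> 'g uea set" where
  "U L = cvs.span {prod_list (map uea_inj xs) | xs. set xs \<subseteq> L}"

text \<open>Algebra homomorphisms from \<open>U L\<close> to the complex numbers, set to 0 outside \<open>U L\<close>.\<close>

definition U_character :: "'g::complex_lie_algebra set \<Rightarrow> ('g uea \<Rightarrow> complex) \<Rightarrow> bool" where
  "U_character L \<chi> \<longleftrightarrow>
     \<chi> 1 = 1 \<and>
     (\<forall>x\<in>U L. \<forall>y\<in>U L. \<chi> (x + y) = \<chi> x + \<chi> y \<and> \<chi> (x * y) = \<chi> x * \<chi> y) \<and>
     (\<forall>c. \<forall>x\<in>U L. \<chi> (c *\<^sub>C x) = c * \<chi> x) \<and>
     (\<forall>x. x \<notin> U L \<longrightarrow> \<chi> x = 0)"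

definition extend_character ::
    "'g::complex_lie_algebra set \<Rightarrow> ('g \<Rightarrow> complex) \<Rightarrow> 'g uea \<Rightarrow> complex" where
  "extend_character L \<phi> = (THE \<chi>. U_character L \<chi> \<and> (\<forall>x\<in>L. \<chi> (uea_inj x) = \<phi> x))"

definition counit :: "'g::complex_lie_algebra uea \<Rightarrow> complex" where
  "counit = extend_character UNIV (\<lambda>_. 0)"

definition antipode :: "'g::complex_lie_algebra uea \<Rightarrow> 'g uea" where
  "antipode = (THE S. clinear S \<and> S 1 = 1 \<and> (\<forall>x y. S (x * y) = S y * S x) \<and>
     (\<forall>x. S (uea_inj x) = - uea_inj x))"


section \<open>Projections and the Shapovalov pairing\<close>

definition pi_minus :: "'g::complex_lie_algebra set \<Rightarrow> ('g \<Rightarrow> complex) \<Rightarrow> ('g \<Rightarrow> complex) set \<Rightarrow>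
    'g uea \<Rightarrow> 'g uea" where
  "pi_minus h lam Pos = (THE f. clinear f \<and>
     (\<forall>v \<in> U (n_minus h lam Pos). \<forall>x \<in> U (stabilizer lam). \<forall>u \<in> U (n_plus h lam Pos).
        f (v * x * u) = (extend_character (stabilizer lam) lam x * counit u) *\<^sub>C v))"

definition pi_plus :: "'g::complex_lie_algebra set \<Rightarrow> ('g \<Rightarrow> complex) \<Rightarrow> ('g \<Rightarrow> complex) set \<Rightarrow>
    'g uea \<Rightarrow> 'g uea" where
  "pi_plus h lam Pos = (THE f. clinear f \<and>
     (\<forall>v \<in> U (n_minus h lam Pos). \<forall>x \<in> U (stabilizer lam). \<forall>u \<in> U (n_plus h lam Pos).
        f (u * x * v) = (extend_character (stabilizer lam) (- lam) x * counit v) *\<^sub>C u))"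

text \<open>
  A one-dimensional module over \<open>U L\<close> (left or right) is given by the character through which \<open>U L\<close>
  acts on the complex numbers.
\<close>

definition chi_b_plus :: "'g::complex_lie_algebra set \<Rightarrow> ('g \<Rightarrow> complex) \<Rightarrow> ('g \<Rightarrow> complex) set \<Rightarrow>
    'g uea \<Rightarrow> complex" where
  "chi_b_plus h lam Pos = (THE \<chi>. U_character (b_plus h lam Pos) \<chi> \<and>
     (\<forall>x \<in> stabilizer lam. \<chi> (uea_inj x) = lam x) \<and>
     (\<forall>x \<in> n_plus h lam Pos. \<chi> (uea_inj x) = 0))"

definition chi_b_minus :: "'g::complex_lie_algebra set \<Rightarrow> ('g \<Rightarrow> complex) \<Rightarrow> ('g \<Rightarrow> complex) set \<Rightarrow>
    'g uea \<Rightarrow> complex" where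
  "chi_b_minus h lam Pos = (THE \<chi>. U_character (b_minus h lam Pos) \<chi> \<and>
     (\<forall>x \<in> stabilizer lam. \<chi> (uea_inj x) = lam x) \<and>
     (\<forall>x \<in> n_minus h lam Pos. \<chi> (uea_inj x) = 0))"

text \<open>
  Relations of the tensor product of the right \<open>A\<close>-module of complex numbers (\<open>A\<close> acting through
  \<open>\<chi>\<close>), the algebra itself, and the left \<open>B\<close>-module of complex numbers (\<open>B\<close> acting through \<open>\<psi>\<close>),
  over \<open>A\<close> and \<open>B\<close>: multilinearity and balancedness.
\<close>

definition bimodule_tensor_relations ::
    "'g::complex_lie_algebra uea set \<Rightarrow> ('g uea \<Rightarrow> complex) \<Rightarrow> 'g uea set \<Rightarrow> ('g uea \<Rightarrow> complex) \<Rightarrow>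
     ((complex \<times> 'g uea \<times> complex) \<Rightarrow>\<^sub>0 complex) set" where
  "bimodule_tensor_relations A \<chi> B \<psi> =
     (let e = (\<lambda>a x b. Poly_Mapping.single (a, x, b) (1 :: complex)) in
      {e (a + a') x b - e a x b - e a' x b | a a' x b. True} \<union>
      {e a (x + x') b - e a x b - e a x' b | a x x' b. True} \<union>
      {e a x (b + b') - e a x b - e a x b' | a x b b'. True} \<union>
      {e (c * a) x b - c *\<^sub>C e a x b | a x b c. True} \<union>
      {e a (c *\<^sub>C x) b - c *\<^sub>C e a x b | a x b c. True} \<union>
      {e a x (c * b) - c *\<^sub>C e a x b | a x b c. True} \<union>
      {e (a * \<chi> r) x b - e a (r * x) b | a r x b. r \<in> A} \<union>
      {e a (x * s) b - e a x (\<psi> s * b) | a x s b. s \<in> B})"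

text \<open>
  The isomorphism of the tensor product with the complex numbers sends \<open>1 \<otimes> 1 \<otimes> 1\<close> to 1.
\<close>

definition shapovalov :: "'g::complex_lie_algebra set \<Rightarrow> ('g \<Rightarrow> complex) \<Rightarrow> ('g \<Rightarrow> complex) set \<Rightarrow>
    'g uea \<Rightarrow> 'g uea \<Rightarrow> complex" where
  "shapovalov h lam Pos u v = (THE c.
     Poly_Mapping.single (1, antipode u * v, 1) 1 - c *\<^sub>C Poly_Mapping.single (1, 1, 1) 1
       \<in> cvs.span (bimodule_tensor_relations
            (U (b_minus h lam Pos)) (chi_b_minus h lam Pos)
            (U (b_plus h lam Pos)) (chi_b_plus h lam Pos)))"

definition nondegenerate_pairing ::
    "'a::zero set \<Rightarrow> 'b::zero set \<Rightarrow> ('a \<Rightarrow> 'b \<Rightarrow> complex) \<Rightarrow> bool" where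
  "nondegenerate_pairing A B P \<longleftrightarrow>
     (\<forall>u\<in>A. (\<forall>v\<in>B. P u v = 0) \<longrightarrow> u = 0) \<and> (\<forall>v\<in>B. (\<forall>u\<in>A. P u v = 0) \<longrightarrow> v = 0)"


section \<open>The grading and the completed tensor product\<close>

definition uea_degree ::
    "'g::complex_lie_algebra set \<Rightarrow> ('g \<Rightarrow> complex) \<Rightarrow> 'g uea set" where
  "uea_degree h \<mu> = cvs.span {prod_list (map uea_inj xs) | xs \<beta>s.
     list_all2 (\<lambda>x \<beta>. (\<beta> \<in> roots h \<and> x \<in> root_space h \<beta>) \<or> (\<beta> = 0 \<and> x \<in> h)) xs \<beta>s \<and>
     sum_list \<beta>s = \<mu>}"

definition homogeneous :: "'g::complex_lie_algebra set \<Rightarrow> 'g uea \<Rightarrow> bool" where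
  "homogeneous h x \<longleftrightarrow> (\<exists>\<mu>. x \<in> uea_degree h \<mu>)"

definition uea_component ::
    "'g::complex_lie_algebra set \<Rightarrow> 'g uea \<Rightarrow> ('g \<Rightarrow> complex) \<Rightarrow> 'g uea" where
  "uea_component h x = (THE f. finite {\<mu>. f \<mu> \<noteq> 0} \<and> (\<forall>\<mu>. f \<mu> \<in> uea_degree h \<mu>) \<and>
     x = (\<Sum>\<mu> | f \<mu> \<noteq> 0. f \<mu>))"

definition tensor_component ::
    "'g::complex_lie_algebra set \<Rightarrow> ('g \<Rightarrow> complex) \<Rightarrow> ('g \<Rightarrow> complex) \<Rightarrow>
     ('g uea, 'g uea) ctensor \<Rightarrow> ('g uea, 'g uea) ctensor" where
  "tensor_component h \<mu> \<nu> = (THE T. clinear T \<and>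
     (\<forall>a b. T (a \<otimes>\<^sub>C b) = uea_component h a \<mu> \<otimes>\<^sub>C uea_component h b \<nu>))"

text \<open>
  An element of the completed tensor product of two graded subspaces \<open>A\<close>, \<open>B\<close> is an arbitrary family
  of elements of the tensor products of the homogeneous components of \<open>A\<close> and \<open>B\<close>.  A family of
  elements of the algebraic tensor product is summable in the completion if in every bidegree all but
  finitely many of its components vanish.
\<close>

type_synonym 'g completed_tensor =
  "('g \<Rightarrow> complex) \<Rightarrow> ('g \<Rightarrow> complex) \<Rightarrow> ('g uea, 'g uea) ctensor"

definition completed_tensor_product ::
    "'g::complex_lie_algebra set \<Rightarrow> 'g uea set \<Rightarrow> 'g uea set \<Rightarrow> 'g completed_tensor set" where
  "completed_tensor_product h A B = {F. \<forall>\<mu> \<nu>. F \<mu> \<nu> \<in>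
     cvs.span {a \<otimes>\<^sub>C b | a b. a \<in> A \<inter> uea_degree h \<mu> \<and> b \<in> B \<inter> uea_degree h \<nu>}}"

definition has_completed_sum ::
    "'g::complex_lie_algebra set \<Rightarrow> ('i \<Rightarrow> ('g uea, 'g uea) ctensor) \<Rightarrow> 'i set \<Rightarrow>
     'g completed_tensor \<Rightarrow> bool" where
  "has_completed_sum h t I F \<longleftrightarrow> (\<forall>\<mu> \<nu>.
     finite {i \<in> I. tensor_component h \<mu> \<nu> (t i) \<noteq> 0} \<and>
     F \<mu> \<nu> = (\<Sum>i | i \<in> I \<and> tensor_component h \<mu> \<nu> (t i) \<noteq> 0. tensor_component h \<mu> \<nu> (t i)))"

definition homogeneous_basis ::
    "'g::complex_lie_algebra set \<Rightarrow> 'g uea set \<Rightarrow> 'i set \<Rightarrow> ('i \<Rightarrow> 'g uea) \<Rightarrow> bool" where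
  "homogeneous_basis h A I u \<longleftrightarrow>
     inj_on u I \<and> cvs.independent (u ` I) \<and> cvs.span (u ` I) = A \<and> (\<forall>i\<in>I. homogeneous h (u i))"

text \<open>
  It is no restriction to take the index set of the dual bases among the sets of elements of the
  enveloping algebra, as a basis can be indexed by its own elements.
\<close>

definition is_canonical_element :: "'g::complex_lie_algebra set \<Rightarrow> ('g \<Rightarrow> complex) \<Rightarrow>
    ('g \<Rightarrow> complex) set \<Rightarrow> 'g completed_tensor \<Rightarrow> bool" where
  "is_canonical_element h lam Pos F \<longleftrightarrow>
     (\<exists>(I :: 'g uea set) u v.
        homogeneous_basis h (U (n_plus h lam Pos)) I u \<and>
        homogeneous_basis h (U (n_minus h lam Pos)) I v \<and>
        (\<forall>i\<in>I. \<forall>j\<in>I. shapovalov h lam Pos (u i) (v j) = (if i = j then 1 else 0)) \<and>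
        has_completed_sum h (\<lambda>i. u i \<otimes>\<^sub>C v i) I F)"

definition canonical_element :: "'g::complex_lie_algebra set \<Rightarrow> ('g \<Rightarrow> complex) \<Rightarrow>
    ('g \<Rightarrow> complex) set \<Rightarrow> 'g completed_tensor" where
  "canonical_element h lam Pos = (THE F. is_canonical_element h lam Pos F)"


section \<open>Coefficients\<close>

definition rho :: "('g \<Rightarrow> complex) set \<Rightarrow> 'g::complex_lie_algebra \<Rightarrow> complex" where
  "rho Pos = (\<lambda>x. 1 / 2 * (\<Sum>\<alpha>\<in>Pos. \<alpha> x))"

definition p_coeff :: "('g::complex_lie_algebra \<Rightarrow> complex) set \<Rightarrow> ('g \<Rightarrow> complex) \<Rightarrow>
    ('g \<Rightarrow> complex) \<Rightarrow> complex" where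
  "p_coeff Pos lam \<mu> = 1 / 2 * dform \<mu> \<mu> - dform (rho Pos) \<mu> - dform lam \<mu>"

definition nat_cone :: "('g \<Rightarrow> complex) set \<Rightarrow> ('g \<Rightarrow> complex) set" where
  "nat_cone R = {(\<lambda>x. \<Sum>\<alpha>\<in>R. of_nat (n \<alpha>) * \<alpha> x) | n :: ('g \<Rightarrow> complex) \<Rightarrow> nat. True}"

definition Lambda_tilde ::
    "'g::complex_lie_algebra set \<Rightarrow> ('g \<Rightarrow> complex) set \<Rightarrow> ('g \<Rightarrow> complex) set" where
  "Lambda_tilde h Pos = {lam \<in> h_dual h.
     \<forall>\<mu> \<in> nat_cone (roots_hat h lam \<inter> Pos) - {0}. p_coeff Pos lam \<mu> \<noteq> 0}"

text \<open>
  Words are lists of letters \<open>i\<close>, standing for the roots \<open>al i\<close>; \<open>take i w\<close> consists of the first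
  \<open>i\<close> letters, and \<open>drop (i - 1) w\<close> of the letters from the \<open>i\<close>-th one onwards.
\<close>

definition word_product :: "(nat \<Rightarrow> 'g::complex_lie_algebra) \<Rightarrow> nat list \<Rightarrow> 'g uea" where
  "word_product X w = prod_list (map (\<lambda>i. uea_inj (X i)) w)"

definition word_weight :: "(nat \<Rightarrow> 'g \<Rightarrow> complex) \<Rightarrow> nat list \<Rightarrow> 'g \<Rightarrow> complex" where
  "word_weight al w = sum_list (map al w)"

definition p_word :: "('g::complex_lie_algebra \<Rightarrow> complex) set \<Rightarrow> ('g \<Rightarrow> complex) \<Rightarrow>
    (nat \<Rightarrow> 'g \<Rightarrow> complex) \<Rightarrow> nat list \<Rightarrow> ('g \<Rightarrow> complex) \<Rightarrow> complex" where
  "p_word Pos lam al w \<mu> = (\<Prod>i<length w. p_coeff Pos lam (\<mu> - word_weight al (take i w)))"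

definition W_tilde :: "'g::complex_lie_algebra set \<Rightarrow> ('g \<Rightarrow> complex) \<Rightarrow> ('g \<Rightarrow> complex) set \<Rightarrow>
    nat \<Rightarrow> (nat \<Rightarrow> 'g \<Rightarrow> complex) \<Rightarrow> nat list set" where
  "W_tilde h lam Pos k al = {w. set w \<subseteq> {1..k} \<and>
     (\<forall>i\<in>{1..length w}. word_weight al (drop (i - 1) w) \<in> nat_cone (roots_hat h lam \<inter> Pos))}"

end

(*
  The Casimir element acts by a scalar on the generalized Verma module U(n-); comparing its values
  on a vector v of weight lam - mu and on the highest weight vector gives
  p_lam(mu) v = - sum_i Y_i X_i v.  As p_lam does not vanish on the weights that occur, iterating this
  identity writes v as the sum over the words w of
  p_lam^w(mu)^(-1) <pi+(X_w), v> pi-(Y_w).  Exchanging n+ and n- and replacing lam by -lam gives the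
  analogous expansion on U(n+).  Both together yield the non-degeneracy of the pairing, and
  expanding the canonical element of a pair of dual bases gives the formula.
*)
theory Submission
  imports Defs
begin

section \<open>Linear algebra\<close>

text \<open>Semisimplicity is given through solvable ideals, so non-degeneracy of the Killing form
  has to be won first: at a bracket of opposite root vectors of weight \<alpha> all weights are real
  multiples of \<alpha>, hence such a bracket is isotropic only if it is 0, and Engel's theorem then
  disposes of the radical. The scalar \<open>p_coeff\<close> is half a difference of Casimir
  eigenvalues, which is the origin of its 1/2 and of \<rho>. The Casimir element sums over all
  positive roots, also those orthogonal to lam, so words use all letters; the restriction to
  \<open>W_tilde\<close> comes from the weights, since outside the cone the weight spaces of U(n-)
  vanish. The iteration stops because only finitely many words have a given weight. An ordering is
  merely closed under sums that are roots and supplies no height function, so this finiteness is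
  extracted from Dickson's lemma. Both expansions refer to the same pairing because the antipode
  carries the functional \<open>phi\<close> of lam and Pos to that of -lam and -Pos. Projections and
  pairing are made explicit by a generalized Verma module built directly on U(n-).\<close>

lemma clinearI:
  assumes "\<And>x y. f (x + y) = f x + f y" "\<And>c x. f (c *\<^sub>C x) = c *\<^sub>C f x"
  shows "clinear f"
  by (simp add: Vector_Spaces.linear_def cvs.vector_space_axioms module_hom_def module_hom_axioms_def
      cvs.module_axioms assms)

lemma
  assumes "clinear f"
  shows clinear_add: "f (x + y) = f x + f y" and clinear_scale: "f (c *\<^sub>C x) = c *\<^sub>C f x"
    and clinear_zero: "f 0 = 0" and clinear_minus: "f (- x) = - f x"
    and clinear_diff: "f (x - y) = f x - f y"
    and clinear_sum: "f (\<Sum>i\<in>I. g i) = (\<Sum>i\<in>I. f (g i))"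
proof -
  interpret module_hom cscale cscale f
    using assms by (simp add: Vector_Spaces.linear_def)
  show "f (x + y) = f x + f y" "f (c *\<^sub>C x) = c *\<^sub>C f x" "f 0 = 0" "f (- x) = - f x"
    "f (x - y) = f x - f y" "f (\<Sum>i\<in>I. g i) = (\<Sum>i\<in>I. f (g i))"
    by (rule add scale zero neg diff sum)+
qed

lemma cscale_complex [simp]: "c *\<^sub>C (z::complex) = c * z"
  by (simp add: cscale_complex_def)

lemma clinear_eq_on_span:
  assumes "clinear f" "clinear g" "\<And>x. x \<in> S \<Longrightarrow> f x = g x" "x \<in> cvs.span S"
  shows "f x = g x"
  using assms(4)
  by (induction rule: cvs.span_induct_alt)
    (simp_all add: assms clinear_add clinear_scale clinear_zero)

lemma clinear_span_subset:
  assumes "clinear f" "\<And>x. x \<in> S \<Longrightarrow> f x \<in> T" "cvs.subspace T" "x \<in> cvs.span S"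
  shows "f x \<in> T"
  using assms(4)
  by (induction rule: cvs.span_induct_alt)
    (use assms in \<open>auto simp: clinear_add clinear_scale clinear_zero cvs.subspace_0
      intro: cvs.subspace_add cvs.subspace_scale\<close>)

lemma clinear_compose: "clinear f \<Longrightarrow> clinear g \<Longrightarrow> clinear (\<lambda>x. f (g x))"
  by (rule clinearI) (simp_all add: clinear_add clinear_scale)

text \<open>\<open>T j - wt k j\<close> annihilates \<open>x k\<close> and rescales every other
  term, so the induction hypothesis applies to the rescaled family. The index j is chosen for one
  given i, whose factor is then nonzero; the factors of other terms may vanish.\<close>

lemma common_eigenvectors_zero:
  assumes "finite I"
    and lin: "\<And>j. j \<in> J \<Longrightarrow> clinear (T j)"
    and eig: "\<And>i j. i \<in> I \<Longrightarrow> j \<in> J \<Longrightarrow> T j (x i) = wt i j *\<^sub>C x i"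
    and dist: "\<And>i i'. i \<in> I \<Longrightarrow> i' \<in> I \<Longrightarrow> i \<noteq> i' \<Longrightarrow> \<exists>j\<in>J. wt i j \<noteq> wt i' j"
    and sum: "(\<Sum>i\<in>I. x i) = 0"
  shows "\<forall>i\<in>I. x i = 0"
  using assms(1) eig dist sum
proof (induction I arbitrary: x rule: finite_induct)
  case (insert k F)
  have *: "x i = 0" if i: "i \<in> F" for i
  proof -
    from i insert have "i \<noteq> k" by auto
    then obtain j where j: "j \<in> J" "wt i j \<noteq> wt k j"
      using insert.prems(2) i by blast
    let ?y = "\<lambda>i. (wt i j - wt k j) *\<^sub>C x i"
    have "(\<Sum>i\<in>F. ?y i) = (\<Sum>i\<in>insert k F. T j (x i) - wt k j *\<^sub>C x i)"
      using insert.hyps insert.prems(1) j by (simp add: cvs.scale_left_diff_distrib)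
    also have "\<dots> = T j (\<Sum>i\<in>insert k F. x i) - wt k j *\<^sub>C (\<Sum>i\<in>insert k F. x i)"
      by (simp only: clinear_sum[OF lin[OF j(1)]] sum_subtractf cvs.scale_sum_right)
    also have "\<dots> = 0"
      using insert.prems(3) clinear_zero[OF lin[OF j(1)]] by simp
    finally have s: "(\<Sum>i\<in>F. ?y i) = 0" .
    have "\<forall>i\<in>F. ?y i = 0"
      by (rule insert.IH[OF _ _ s])
        (use insert.prems in \<open>auto simp: clinear_scale[OF lin] cscale_cscale mult.commute\<close>)
    then have "?y i = 0" using i by blast
    with j show ?thesis by simp
  qed
  then have "x k = 0" using insert.prems(3) insert.hyps by simp
  with * show ?case by simp
qed simp

lemma span_UN_subspace:
  assumes "\<And>i. i \<in> I \<Longrightarrow> cvs.subspace (S i)" "x \<in> cvs.span (\<Union>i\<in>I. S i)"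
  shows "\<exists>F y. finite F \<and> F \<subseteq> I \<and> (\<forall>i\<in>F. y i \<in> S i) \<and> x = (\<Sum>i\<in>F. y i)"
  using assms(2)
proof (induction rule: cvs.span_induct_alt)
  case base
  show ?case by (rule exI[of _ "{}"]) simp
next
  case (step c s x)
  then obtain j where j: "j \<in> I" "s \<in> S j" by blast
  from step obtain F y where F: "finite F" "F \<subseteq> I" "\<forall>i\<in>F. y i \<in> S i" "x = (\<Sum>i\<in>F. y i)"
    by blast
  \<comment> \<open>The new vector is added to the component j, which is created if j is not yet in
    F.\<close>
  let ?y = "\<lambda>i. (if i \<in> F then y i else 0) + (if i = j then c *\<^sub>C s else 0)"
  have "(\<Sum>i\<in>insert j F. ?y i) = (\<Sum>i\<in>insert j F. if i \<in> F then y i else 0) + c *\<^sub>C s"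
    using F(1) by (simp add: sum.distrib sum.delta)
  also have "(\<Sum>i\<in>insert j F. if i \<in> F then y i else 0) = x"
    unfolding F(4) by (rule sum.mono_neutral_cong_right) (use F in auto)
  finally have "c *\<^sub>C s + x = (\<Sum>i\<in>insert j F. ?y i)" by (simp add: add.commute)
  moreover have "?y i \<in> S i" if "i \<in> insert j F" for i
    using that F j assms(1)
    by (auto intro!: cvs.subspace_add cvs.subspace_scale cvs.subspace_0)
  ultimately show ?case
    using F j by (intro exI[of _ "insert j F"] exI[of _ ?y]) blast
qed

text \<open>Subtracting the eigenvalues w from those of the components gives a vanishing sum, so
  every nonzero component already has the eigenvalues w, and distinctness leaves room for one only.
  In this way statements about weight vectors are reduced to statements about words in root
  vectors.\<close>

lemma eigenvector_in_graded_span: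
  assumes lin: "\<And>j. j \<in> J \<Longrightarrow> clinear (T j)"
    and sub: "\<And>i. i \<in> I \<Longrightarrow> cvs.subspace (S i)"
    and eig: "\<And>i j y. i \<in> I \<Longrightarrow> j \<in> J \<Longrightarrow> y \<in> S i \<Longrightarrow> T j y = wt i j *\<^sub>C y"
    and dist: "\<And>i i'. i \<in> I \<Longrightarrow> i' \<in> I \<Longrightarrow> i \<noteq> i' \<Longrightarrow> \<exists>j\<in>J. wt i j \<noteq> wt i' j"
    and x: "x \<in> cvs.span (\<Union>i\<in>I. S i)" "\<And>j. j \<in> J \<Longrightarrow> T j x = w j *\<^sub>C x"
  shows "x = 0 \<or> (\<exists>i\<in>I. x \<in> S i \<and> (\<forall>j\<in>J. wt i j = w j))"
proof -
  obtain F y where F: "finite F" "F \<subseteq> I" "\<forall>i\<in>F. y i \<in> S i" "x = (\<Sum>i\<in>F. y i)"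
    using span_UN_subspace[OF sub x(1)] by blast
  have wt: "wt i j = w j" if "i \<in> F" "y i \<noteq> 0" "j \<in> J" for i j
  proof -
    have "(\<Sum>i\<in>F. (wt i j - w j) *\<^sub>C y i) = (\<Sum>i\<in>F. T j (y i) - w j *\<^sub>C y i)"
      using F eig \<open>j \<in> J\<close> by (intro sum.cong) (auto simp: cvs.scale_left_diff_distrib)
    also have "\<dots> = T j x - w j *\<^sub>C x"
      by (simp only: F(4) clinear_sum[OF lin[OF \<open>j \<in> J\<close>]] sum_subtractf cvs.scale_sum_right)
    finally have "(\<Sum>i\<in>F. (wt i j - w j) *\<^sub>C y i) = 0" using x(2)[OF \<open>j \<in> J\<close>] by simp
    then have "\<forall>i\<in>F. (wt i j - w j) *\<^sub>C y i = 0"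
      using F lin eig dist
      by (intro common_eigenvectors_zero[of F J T _ wt])
        (auto simp: clinear_scale[OF lin] cscale_cscale mult.commute subset_iff)
    then have "(wt i j - w j) *\<^sub>C y i = 0" using that by blast
    with that show ?thesis by simp
  qed
  show ?thesis
  proof (cases "\<exists>i\<in>F. y i \<noteq> 0")
    case True
    then obtain i where i: "i \<in> F" "y i \<noteq> 0" by blast
    have "y i' = 0" if "i' \<in> F - {i}" for i'
      using dist[of i i'] wt[of i] wt[of i'] i that F(2) by (metis DiffE singletonI subsetD)
    then have "x = y i"
      using F(1,4) i by (simp add: sum.remove)
    then show ?thesis using F i wt by blast
  qed (simp add: F(4))
qed

section \<open>Traces\<close>

lemma representation_clinear:
  assumes "cvs.independent E" "cvs.span E = UNIV"
  shows "clinear (\<lambda>x. cvs.representation E x b)"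
  using assms by (intro clinearI) (simp_all add: cvs.representation_add cvs.representation_scale)

lemma representation_image:
  assumes "cvs.independent E" "cvs.span E = UNIV" "finite E" "clinear F"
  shows "cvs.representation E (F x) c =
    (\<Sum>b\<in>E. cvs.representation E x b * cvs.representation E (F b) c)"
proof -
  note lin = representation_clinear[OF assms(1,2)]
  have "x = (\<Sum>b\<in>E. cvs.representation E x b *\<^sub>C b)"
    using cvs.sum_representation_eq[of E x E] assms by simp
  then have "F x = (\<Sum>b\<in>E. cvs.representation E x b *\<^sub>C F b)"
    by (metis (no_types, lifting) clinear_scale[OF assms(4)] clinear_sum[OF assms(4)] sum.cong)
  then show ?thesis
    using lin by (simp add: clinear_sum[OF lin] clinear_scale[OF lin])
qed

lemma representation_outside:
  assumes "cvs.independent E" "C \<subseteq> E" "x \<in> cvs.span C" "b \<notin> C"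
  shows "cvs.representation E x b = 0"
  using cvs.representation_extend[OF assms(1,3,2)] cvs.representation_ne_zero[of C x b] assms(4)
  by auto

text \<open>The trace of the block of F on the span of C, a part of the basis E. Coordinates remain
  those of E, so that C can vary over root strings while the basis is fixed.\<close>

definition btrace :: "'a::complex_vspace set \<Rightarrow> 'a set \<Rightarrow> ('a \<Rightarrow> 'a) \<Rightarrow> complex" where
  "btrace E C F = (\<Sum>b\<in>C. cvs.representation E (F b) b)"

text \<open>Stability of the span of C lets the intermediate index run over C alone; the resulting
  double sum is symmetric in F and G.\<close>

lemma btrace_commute:
  assumes E: "cvs.independent E" "cvs.span E = UNIV" "finite E" and C: "C \<subseteq> E"
    and "clinear F" "clinear G"
    and "\<And>b. b \<in> C \<Longrightarrow> F b \<in> cvs.span C" "\<And>b. b \<in> C \<Longrightarrow> G b \<in> cvs.span C"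
  shows "btrace E C (\<lambda>x. F (G x)) = btrace E C (\<lambda>x. G (F x))"
proof -
  let ?r = "cvs.representation E"
  have *: "?r (P (Q b)) b = (\<Sum>c\<in>C. ?r (Q b) c * ?r (P c) b)"
    if "clinear P" "\<And>b. b \<in> C \<Longrightarrow> Q b \<in> cvs.span C" "b \<in> C" for P Q b
    apply (subst representation_image[OF E that(1)])
    using representation_outside[OF E(1) C that(2)[OF that(3)]] E(3) C
    by (intro sum.mono_neutral_right) auto
  have "btrace E C (\<lambda>x. F (G x)) = (\<Sum>b\<in>C. \<Sum>c\<in>C. ?r (G b) c * ?r (F c) b)"
    unfolding btrace_def by (intro sum.cong refl *) (use assms in auto)
  also have "\<dots> = (\<Sum>c\<in>C. \<Sum>b\<in>C. ?r (F c) b * ?r (G b) c)"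
    by (subst sum.swap) (simp add: mult.commute)
  also have "\<dots> = btrace E C (\<lambda>x. G (F x))"
    unfolding btrace_def by (intro sum.cong refl *[symmetric]) (use assms in auto)
  finally show ?thesis .
qed

text \<open>Expanding b in E' and \<open>F c\<close> in E turns both traces into the same double
  sum.\<close>

lemma btrace_basis_change:
  assumes E: "cvs.independent E" "cvs.span E = UNIV" "finite E"
    and E': "cvs.independent E'" "cvs.span E' = UNIV" "finite E'" and F: "clinear F"
  shows "btrace E E F = btrace E' E' F"
proof -
  have id: "clinear (\<lambda>x. x)" by (rule clinearI) simp_all
  have "btrace E E F = (\<Sum>b\<in>E. \<Sum>c\<in>E'. cvs.representation E' b c * cvs.representation E (F c) b)"
  proof -
    have "cvs.representation E (F b) b =
        (\<Sum>c\<in>E'. cvs.representation E' b c * cvs.representation E (F c) b)" for b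
    proof -
      have "b = (\<Sum>c\<in>E'. cvs.representation E' b c *\<^sub>C c)"
        using cvs.sum_representation_eq[of E' b E'] E' by simp
      then have "F b = (\<Sum>c\<in>E'. cvs.representation E' b c *\<^sub>C F c)"
        by (metis (no_types, lifting) clinear_scale[OF F] clinear_sum[OF F] sum.cong)
      then show ?thesis
        by (simp add: clinear_sum[OF representation_clinear[OF E(1,2)]]
            clinear_scale[OF representation_clinear[OF E(1,2)]])
    qed
    then show ?thesis by (simp add: btrace_def)
  qed
  also have "\<dots> = (\<Sum>c\<in>E'. \<Sum>b\<in>E. cvs.representation E (F c) b * cvs.representation E' b c)"
    by (subst sum.swap) (simp add: mult.commute)
  also have "\<dots> = btrace E' E' F"
  proof -
    have "cvs.representation E' (F c) c =
        (\<Sum>b\<in>E. cvs.representation E (F c) b * cvs.representation E' b c)" for c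
    proof -
      have "F c = (\<Sum>b\<in>E. cvs.representation E (F c) b *\<^sub>C b)"
        using cvs.sum_representation_eq[of E "F c" E] E by simp
      then have "cvs.representation E' (F c) c =
          cvs.representation E' (\<Sum>b\<in>E. cvs.representation E (F c) b *\<^sub>C b) c" by simp
      then show ?thesis
        by (simp add: clinear_sum[OF representation_clinear[OF E'(1,2)]]
            clinear_scale[OF representation_clinear[OF E'(1,2)]])
    qed
    then show ?thesis by (simp add: btrace_def)
  qed
  finally show ?thesis .
qed

text \<open>\<open>ctrace\<close> uses whatever basis \<open>extend_basis\<close> picks; after this
  lemma the Killing form can be computed in a basis of weight vectors.\<close>

lemma ctrace_btrace:
  fixes F :: "'a::complex_vspace \<Rightarrow> 'a"
  assumes E: "cvs.independent E" "cvs.span E = UNIV" "finite E" and F: "clinear F"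
  shows "ctrace F = btrace E E F"
proof -
  let ?B = "cvs.extend_basis {} :: 'a set"
  have B: "cvs.independent ?B" "cvs.span ?B = UNIV"
    by (simp_all add: cvs.independent_extend_basis cvs.span_extend_basis cvs.independent_empty)
  have "finite ?B"
    using cvs.independent_span_bound[OF E(3) B(1)] E(2) by simp
  then have "btrace ?B ?B F = btrace E E F"
    by (intro btrace_basis_change B E F)
  then show ?thesis by (simp add: ctrace_def btrace_def)
qed

section \<open>Complex Lie algebras\<close>

lemma clinear_lie: "clinear (lie x)"
  by (rule clinearI) (simp_all add: lie_add_right lie_cscale_right)

lemma clinear_lie_left: "clinear (\<lambda>x. lie x y)"
  by (rule clinearI) (simp_all add: lie_add_left lie_cscale_left)

lemmas lie_linear_simps =
  lie_add_left lie_add_right lie_cscale_left lie_cscale_right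
  clinear_zero[OF clinear_lie] clinear_zero[OF clinear_lie_left]
  clinear_minus[OF clinear_lie] clinear_minus[OF clinear_lie_left]
  clinear_diff[OF clinear_lie] clinear_diff[OF clinear_lie_left]

lemma lie_antisym: "lie x y = - lie y x"
proof -
  have "lie (x + y) (x + y) = 0" by (rule lie_self)
  then have "lie x y + lie y x = 0"
    unfolding lie_add_left lie_add_right by (simp add: lie_self add.commute)
  then show ?thesis by (simp add: eq_neg_iff_add_eq_0)
qed

lemma lie_derivation: "lie x (lie y z) = lie (lie x y) z + lie y (lie x z)"
  using jacobi[of x y z] lie_antisym[of z "lie x y"] lie_antisym[of z x]
  by (simp add: lie_linear_simps algebra_simps)

lemma lie_ideal_lie_left: "lie_ideal I \<Longrightarrow> y \<in> I \<Longrightarrow> lie y x \<in> I"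
  using lie_antisym[of y x] by (auto simp: lie_ideal_def cvs.subspace_neg)

lemma subspace_root_space: "cvs.subspace (root_space h \<gamma>)"
  by (rule cvs.subspaceI)
    (auto simp: root_space_def lie_linear_simps cvs.scale_right_distrib cscale_cscale mult.commute)

lemma lie_root_space:
  "x \<in> root_space h \<alpha> \<Longrightarrow> y \<in> root_space h \<beta> \<Longrightarrow> lie x y \<in> root_space h (\<alpha> + \<beta>)"
  by (auto simp: root_space_def lie_derivation[of _ x y] lie_linear_simps cvs.scale_left_distrib)

lemma span_insertE:
  assumes "u \<in> cvs.span (insert x A)" "cvs.subspace A"
  obtains c a where "a \<in> A" "u = c *\<^sub>C x + a"
  using assms unfolding cvs.span_breakdown_eq
  by (metis add.commute cvs.span_eq_iff diff_add_cancel)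

lemma UNIV_span_induct:
  assumes "cvs.span S = UNIV" "cvs.subspace {x. P x}" "\<And>x. x \<in> S \<Longrightarrow> P x"
  shows "P x"
  using cvs.span_induct[of x S P] assms by auto

section \<open>Root decomposition\<close>

locale cartan_semisimple =
  fixes h :: "'g::complex_lie_algebra set"
  assumes semisimple: "semisimple_lie_algebra TYPE('g)" and cartan: "cartan_subalgebra h"
begin

abbreviation "rs \<equiv> root_space h"

lemma subspace_h: "cvs.subspace h" and h_abelian: "x \<in> h \<Longrightarrow> y \<in> h \<Longrightarrow> lie x y = 0"
  and h_maximal: "abelian_subalgebra L \<Longrightarrow> h \<subseteq> L \<Longrightarrow> L = h"
  and h_diagonalizable: "x \<in> h \<Longrightarrow> diagonalizable (lie x)"
  using cartan by (auto simp: cartan_subalgebra_def abelian_subalgebra_def lie_subalgebra_def)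

lemma finite_spanning: "\<exists>B :: 'g set. finite B \<and> cvs.span B = UNIV"
  using semisimple by (simp add: semisimple_lie_algebra_def)

lemma independent_finite: "cvs.independent (E :: 'g set) \<Longrightarrow> finite E"
  using finite_spanning cvs.independent_span_bound by (metis subset_UNIV)

text \<open>An abelian ideal is solvable in one step. Besides finite dimension, this is the form in
  which semisimplicity enters the proof.\<close>

lemma abelian_ideal_zero:
  assumes "lie_ideal (I :: 'g set)" "\<And>x y. x \<in> I \<Longrightarrow> y \<in> I \<Longrightarrow> lie x y = 0" "x \<in> I"
  shows "x = 0"
proof -
  have "0 \<in> I" using assms(1) by (simp add: lie_ideal_def cvs.subspace_0)
  then have "{lie x y |x y. x \<in> I \<and> y \<in> I} = {0}" using assms(2) by force
  then have "derived_algebra I = {0}"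
    by (simp add: derived_algebra_def)
  then have "(derived_algebra ^^ 1) I = {0}" by simp
  then have "solvable_lie I" unfolding solvable_lie_def by blast
  then show ?thesis using assms semisimple unfolding semisimple_lie_algebra_def by blast
qed

lemma central_zero: "(\<And>y. lie (x::'g) y = 0) \<Longrightarrow> x = 0"
proof (rule abelian_ideal_zero[of "{x. \<forall>y. lie x y = 0}"])
  have "lie x y \<in> {x. \<forall>y. lie x y = 0}" if "y \<in> {x. \<forall>y. lie x y = 0}" for x y :: 'g
    using that lie_antisym[of x y] by (simp add: lie_linear_simps)
  then show "lie_ideal {x::'g. \<forall>y. lie x y = 0}"
    by (auto simp: lie_ideal_def lie_linear_simps intro!: cvs.subspaceI)
qed auto

section \<open>Simultaneous diagonalization of \<open>h\<close>\<close>

lemma simultaneous_eigenvectors: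
  "finite A \<Longrightarrow> A \<subseteq> h \<Longrightarrow> cvs.span {x. \<forall>H\<in>A. \<exists>c. lie H x = c *\<^sub>C x} = UNIV"
proof (induction A rule: finite_induct)
  case (insert H A)
  let ?S = "\<lambda>A. {x. \<forall>H\<in>A. \<exists>c. lie H x = c *\<^sub>C x}"
  have "x \<in> cvs.span (?S (insert H A))" if x: "x \<in> ?S A" for x
  proof -
    define T where "T = (\<lambda>d. {y. lie H y = d *\<^sub>C y})"
    have subT: "cvs.subspace (T d)" for d
      by (rule cvs.subspaceI)
        (auto simp: T_def lie_linear_simps cvs.scale_right_distrib cscale_cscale mult.commute)
    obtain B where B: "cvs.span B = UNIV" "\<forall>b\<in>B. \<exists>c. lie H b = c *\<^sub>C b"
      using h_diagonalizable[of H] insert.prems unfolding diagonalizable_def by blast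
    then have "B \<subseteq> (\<Union>d\<in>UNIV. T d)" by (auto simp: T_def)
    then have "x \<in> cvs.span (\<Union>d\<in>UNIV. T d)"
      using cvs.span_mono[of B "\<Union>d\<in>UNIV. T d"] B(1) by auto
    from span_UN_subspace[OF subT this]
    obtain F y where F: "finite F" "\<forall>d\<in>F. y d \<in> T d" "x = (\<Sum>d\<in>F. y d)"
      by blast
    \<comment> \<open>The defects \<open>?z d\<close> sum to 0 and, as G commutes with H, are
      eigenvectors of \<open>lie H\<close> for the distinct values d; hence each of them
      vanishes.\<close>
    have "lie G (y d) = c *\<^sub>C y d" if G: "G \<in> A" "lie G x = c *\<^sub>C x" and d: "d \<in> F" for G c d
    proof -
      let ?z = "\<lambda>d. lie G (y d) - c *\<^sub>C y d"
      have *: "(\<Sum>d\<in>F. ?z d) = 0"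
        using G(2) by (simp add: F(3) clinear_sum[OF clinear_lie] sum_subtractf cvs.scale_sum_right)
      have "lie H G = 0" using h_abelian insert.prems G by auto
      then have "lie H (?z d) = d *\<^sub>C ?z d" if "d \<in> F" for d
        using F(2) that
        by (simp add: T_def lie_linear_simps lie_derivation[of H G] cvs.scale_right_diff_distrib
            cscale_cscale mult.commute)
      then have "\<forall>d\<in>F. ?z d = 0"
        using common_eigenvectors_zero[of F "{()}" "\<lambda>_. lie H" ?z "\<lambda>d _. d"] F(1) * clinear_lie
        by auto
      with d show ?thesis by simp
    qed
    then have "y d \<in> ?S (insert H A)" if "d \<in> F" for d
      using that x F(2) by (fastforce simp: T_def)
    then show ?thesis unfolding F(3) by (intro cvs.span_sum cvs.span_base)
  qed
  then have "cvs.span (?S A) \<subseteq> cvs.span (?S (insert H A))"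
    by (intro cvs.span_minimal) (auto simp: cvs.subspace_span)
  then show ?case using insert by auto
qed simp

text \<open>It suffices to diagonalize a basis of h, which is finite. Here \<gamma> ranges over
  arbitrary functions of which only the values on h matter; linearity is restored by
  \<open>wt\<close>.\<close>

lemma span_all_root_spaces: "cvs.span (\<Union>\<gamma>. rs \<gamma>) = UNIV"
proof -
  obtain A where A: "A \<subseteq> h" "cvs.independent A" "h \<subseteq> cvs.span A"
    using cvs.maximal_independent_subset by blast
  have "x \<in> (\<Union>\<gamma>. rs \<gamma>)" if "\<forall>H\<in>A. \<exists>c. lie H x = c *\<^sub>C x" for x
  proof -
    have "\<exists>c. lie H x = c *\<^sub>C x" if "H \<in> cvs.span A" for H
      using that
    proof (induction rule: cvs.span_induct_alt)
      case base then show ?case by (intro exI[of _ 0]) (simp add: lie_linear_simps)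
    next
      case (step c G y)
      then obtain d e where "lie G x = d *\<^sub>C x" "lie y x = e *\<^sub>C x"
        using \<open>\<forall>H\<in>A. _ H\<close> by blast
      then show ?case
        by (intro exI[of _ "c * d + e"]) (simp add: lie_linear_simps cscale_cscale cvs.scale_left_distrib)
    qed
    then have "\<forall>H\<in>h. lie H x = (SOME c. lie H x = c *\<^sub>C x) *\<^sub>C x"
      using A(3) by (metis (mono_tags, lifting) someI subset_eq)
    then show ?thesis by (auto simp: root_space_def intro!: exI[of _ "\<lambda>H. SOME c. lie H x = c *\<^sub>C x"])
  qed
  then have "{x. \<forall>H\<in>A. \<exists>c. lie H x = c *\<^sub>C x} \<subseteq> (\<Union>\<gamma>. rs \<gamma>)" by blast
  from cvs.span_mono[OF this] show ?thesis
    using simultaneous_eigenvectors independent_finite[OF A(2)] A(1) by auto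
qed

text \<open>An element commuting with h spans together with h an abelian subalgebra, which by
  maximality is h. So h can be treated as the root space of weight 0.\<close>

lemma h_eq_root_space: "h = rs 0"
proof
  show "h \<subseteq> rs 0" using h_abelian by (auto simp: root_space_def)
  show "rs 0 \<subseteq> h"
  proof
    fix x assume "x \<in> rs 0"
    then have x: "lie H x = 0" "lie x H = 0" if "H \<in> h" for H
      using that lie_antisym[of x H] by (auto simp: root_space_def)
    have "lie u v = 0" if uv: "u \<in> cvs.span (insert x h)" "v \<in> cvs.span (insert x h)" for u v
    proof -
      from uv obtain a b u' v' where "u' \<in> h" "v' \<in> h" "u = a *\<^sub>C x + u'" "v = b *\<^sub>C x + v'"
        using span_insertE[OF _ subspace_h] by metis
      then show ?thesis using x h_abelian by (simp add: lie_linear_simps lie_self)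
    qed
    then have "abelian_subalgebra (cvs.span (insert x h))"
      by (auto simp: abelian_subalgebra_def lie_subalgebra_def cvs.subspace_span cvs.span_zero)
    moreover have "h \<subseteq> cvs.span (insert x h)" by (auto intro: cvs.span_base)
    ultimately have "cvs.span (insert x h) = h" by (rule h_maximal)
    then show "x \<in> h" using cvs.span_base[of x "insert x h"] by simp
  qed
qed

section \<open>The weight basis, the projection onto \<open>h\<close> and weights as
  functionals\<close>

definition "wbasis = (SOME E. E \<subseteq> (\<Union>\<gamma>. rs \<gamma>) \<and> cvs.independent E \<and> cvs.span E = UNIV)"

lemma wbasis_props: "wbasis \<subseteq> (\<Union>\<gamma>. rs \<gamma>) \<and> cvs.independent wbasis \<and> cvs.span wbasis = UNIV"
  unfolding wbasis_def
proof (rule someI_ex[of "\<lambda>E. E \<subseteq> (\<Union>\<gamma>. rs \<gamma>) \<and> cvs.independent E \<and> cvs.span E = UNIV"])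
  obtain E where E: "E \<subseteq> (\<Union>\<gamma>. rs \<gamma>)" "cvs.independent E" "(\<Union>\<gamma>. rs \<gamma>) \<subseteq> cvs.span E"
    using cvs.maximal_independent_subset by blast
  from E(3) have "cvs.span (\<Union>\<gamma>. rs \<gamma>) \<subseteq> cvs.span E"
    by (intro cvs.span_minimal cvs.subspace_span)
  then have "cvs.span E = UNIV"
    using span_all_root_spaces by auto
  with E show "\<exists>E. E \<subseteq> (\<Union>\<gamma>. rs \<gamma>) \<and> cvs.independent E \<and> cvs.span E = UNIV" by blast
qed

lemma wb_ind: "cvs.independent wbasis" and wb_span: "cvs.span wbasis = UNIV"
  and wb_finite: "finite wbasis"
  using wbasis_props independent_finite by auto

abbreviation "coord \<equiv> cvs.representation wbasis"

lemmas coord_linear = representation_clinear[OF wb_ind wb_span]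

text \<open>The values off h are arbitrary; \<open>wt\<close> replaces them by composing with
  \<open>pr\<close>.\<close>

definition "wt_h b = (SOME \<gamma>. b \<in> rs \<gamma>)"

lemma wt_h: "b \<in> wbasis \<Longrightarrow> b \<in> rs (wt_h b)"
  unfolding wt_h_def by (rule someI_ex[of "\<lambda>\<gamma>. b \<in> rs \<gamma>"]) (use wbasis_props in auto)

text \<open>The b-coordinate of \<open>lie H x\<close> is computed once from the eigenvalue of x and
  once from the basis expansion of x.\<close>

lemma coord_root_space:
  assumes "x \<in> rs \<gamma>" "b \<in> wbasis" "H \<in> h" "wt_h b H \<noteq> \<gamma> H"
  shows "coord x b = 0"
proof -
  have "coord (lie H x) b = (\<Sum>c\<in>wbasis. coord x c * coord (lie H c) b)"
    by (rule representation_image[OF wb_ind wb_span wb_finite clinear_lie])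
  also have "\<dots> = (\<Sum>c\<in>wbasis. if c = b then coord x b * wt_h b H else 0)"
    using wt_h assms(3)
    by (intro sum.cong) (auto simp: root_space_def clinear_scale[OF coord_linear]
        cvs.representation_basis[OF wb_ind])
  also have "\<dots> = coord x b * wt_h b H" using assms(2) wb_finite by simp
  finally have "\<gamma> H * coord x b = coord x b * wt_h b H"
    using assms(1,3) by (simp add: root_space_def clinear_scale[OF coord_linear])
  with assms(4) show ?thesis by (metis mult.commute mult_cancel_left)
qed

lemma coord_expand: "x = (\<Sum>b\<in>wbasis. coord x b *\<^sub>C b)"
  using cvs.sum_representation_eq[of wbasis x wbasis] wb_ind wb_span wb_finite by simp

text \<open>The projection onto h along the root spaces. Composing with it turns a function on h
  into one that vanishes on root spaces, as \<open>h_dual h\<close> demands.\<close>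

definition "pr x = (\<Sum>b\<in>wbasis \<inter> h. coord x b *\<^sub>C b)"

lemma clinear_pr: "clinear pr"
  by (rule clinearI) (simp_all add: pr_def clinear_add[OF coord_linear] clinear_scale[OF coord_linear]
      cvs.scale_left_distrib sum.distrib cvs.scale_sum_right cscale_cscale)

lemma pr_in_h: "pr x \<in> h"
  unfolding pr_def by (intro cvs.subspace_sum[OF subspace_h] cvs.subspace_scale[OF subspace_h]) auto

lemma basis_in_h: "b \<in> wbasis \<Longrightarrow> \<forall>H\<in>h. wt_h b H = 0 \<Longrightarrow> b \<in> h"
  using wt_h[of b] by (subst h_eq_root_space) (auto simp: root_space_def)

lemma pr_h: "x \<in> h \<Longrightarrow> pr x = x"
proof -
  assume x: "x \<in> h"
  have "coord x b = 0" if "b \<in> wbasis" "b \<notin> h" for b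
    using coord_root_space[of x 0 b] basis_in_h that x h_eq_root_space by auto
  then have "pr x = (\<Sum>b\<in>wbasis. coord x b *\<^sub>C b)"
    unfolding pr_def by (intro sum.mono_neutral_left) (auto simp: wb_finite)
  then show ?thesis using coord_expand by simp
qed

lemma pr_root_space: "x \<in> rs \<gamma> \<Longrightarrow> H \<in> h \<Longrightarrow> \<gamma> H \<noteq> 0 \<Longrightarrow> pr x = 0"
proof -
  assume x: "x \<in> rs \<gamma>" "H \<in> h" "\<gamma> H \<noteq> 0"
  have "coord x b = 0" if "b \<in> wbasis \<inter> h" for b
  proof (cases "wt_h b H = 0")
    case False
    have "b \<noteq> 0" using that wb_ind cvs.dependent_zero by blast
    moreover have "lie H b = 0" using that x(2) h_abelian by auto
    ultimately show ?thesis
      using wt_h[of b] that x(2) False by (auto simp: root_space_def)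
  qed (use coord_root_space[OF x(1) _ x(2)] that x(3) in auto)
  then show ?thesis by (simp add: pr_def)
qed

lemma h_dual_pr: "\<xi> \<in> h_dual h \<Longrightarrow> \<xi> (pr x) = \<xi> x"
proof -
  assume xi: "\<xi> \<in> h_dual h"
  then have lin: "clinear \<xi>" by (simp add: h_dual_def)
  have 0: "\<xi> b = 0" if "b \<in> wbasis" "b \<notin> h" for b
    using xi wt_h[OF that(1)] basis_in_h[of b] that by (auto simp: h_dual_def)
  have "\<xi> x = (\<Sum>b\<in>wbasis. coord x b *\<^sub>C \<xi> b)"
    by (subst coord_expand) (simp only: clinear_sum[OF lin] clinear_scale[OF lin])
  also have "\<dots> = (\<Sum>b\<in>wbasis \<inter> h. coord x b *\<^sub>C \<xi> b)"
    by (rule sum.mono_neutral_right) (auto simp: wb_finite 0)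
  also have "\<dots> = \<xi> (pr x)"
    by (simp only: pr_def clinear_sum[OF lin] clinear_scale[OF lin])
  finally show ?thesis ..
qed

lemma clinear_h_dual: "\<xi> \<in> h_dual h \<Longrightarrow> clinear \<xi>"
  by (simp add: h_dual_def)

lemma h_dualI: "clinear \<xi> \<Longrightarrow> (\<And>x. \<xi> (pr x) = \<xi> x) \<Longrightarrow> \<xi> \<in> h_dual h"
proof -
  assume lin: "clinear \<xi>" and pr: "\<And>x. \<xi> (pr x) = \<xi> x"
  have "\<xi> x = 0" if "H \<in> h" "\<alpha> H \<noteq> 0" "x \<in> rs \<alpha>" for \<alpha> H x
    using pr[of x] pr_root_space[OF that(3,1,2)] clinear_zero[OF lin] by simp
  with lin show ?thesis by (auto simp: h_dual_def)
qed

lemma h_dual_eqI: "\<xi> \<in> h_dual h \<Longrightarrow> \<eta> \<in> h_dual h \<Longrightarrow> (\<And>H. H \<in> h \<Longrightarrow> \<xi> H = \<eta> H) \<Longrightarrow> \<xi> = \<eta>"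
  by (rule ext) (metis h_dual_pr pr_in_h)

lemma h_dual_distinct: "\<xi> \<in> h_dual h \<Longrightarrow> \<eta> \<in> h_dual h \<Longrightarrow> \<xi> \<noteq> \<eta> \<Longrightarrow> \<exists>H\<in>h. \<xi> H \<noteq> \<eta> H"
  using h_dual_eqI by blast

lemma h_dual_0: "0 \<in> h_dual h"
  by (auto simp: h_dual_def intro: clinearI)

lemma h_dual_add: "\<xi> \<in> h_dual h \<Longrightarrow> \<eta> \<in> h_dual h \<Longrightarrow> \<xi> + \<eta> \<in> h_dual h"
  by (auto simp: h_dual_def algebra_simps clinear_add clinear_scale intro!: clinearI)

lemma h_dual_minus: "\<xi> \<in> h_dual h \<Longrightarrow> - \<xi> \<in> h_dual h"
  by (auto simp: h_dual_def clinear_add clinear_scale intro!: clinearI)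

lemma h_dual_minus_iff [simp]: "- \<xi> \<in> h_dual h \<longleftrightarrow> \<xi> \<in> h_dual h"
  using h_dual_minus[of \<xi>] h_dual_minus[of "- \<xi>"] by auto

lemma h_dual_diff: "\<xi> \<in> h_dual h \<Longrightarrow> \<eta> \<in> h_dual h \<Longrightarrow> \<xi> - \<eta> \<in> h_dual h"
  using h_dual_add[of \<xi> "- \<eta>"] by simp

lemma h_dual_cmult: "\<xi> \<in> h_dual h \<Longrightarrow> (\<lambda>x. c * \<xi> x) \<in> h_dual h"
  by (auto simp: h_dual_def algebra_simps clinear_add clinear_scale intro!: clinearI)

lemma h_dual_sum: "(\<And>i. i \<in> I \<Longrightarrow> f i \<in> h_dual h) \<Longrightarrow> (\<Sum>i\<in>I. f i) \<in> h_dual h"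
  by (induction I rule: infinite_finite_induct) (auto intro: h_dual_0 h_dual_add)

lemma h_dual_sum_list: "set xs \<subseteq> h_dual h \<Longrightarrow> sum_list xs \<in> h_dual h"
  by (induction xs) (auto intro: h_dual_0 h_dual_add)

definition "wt b = (\<lambda>x. wt_h b (pr x))"

lemma wt_in_h_dual: "b \<in> wbasis \<Longrightarrow> wt b \<in> h_dual h"
proof (rule h_dualI)
  assume b: "b \<in> wbasis"
  then have nz: "b \<noteq> 0" using wb_ind cvs.dependent_zero by blast
  have w: "wt_h b H *\<^sub>C b = lie H b" if "H \<in> h" for H
    using wt_h[OF b] that by (simp add: root_space_def)
  show "clinear (wt b)"
  proof (rule clinearI)
    fix x y c
    have "wt b (x + y) *\<^sub>C b = (wt b x + wt b y) *\<^sub>C b" "wt b (c *\<^sub>C x) *\<^sub>C b = (c * wt b x) *\<^sub>C b"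
      unfolding wt_def
      by (simp_all add: w pr_in_h cvs.subspace_add[OF subspace_h] cvs.subspace_scale[OF subspace_h] clinear_add[OF clinear_pr] clinear_scale[OF clinear_pr]
          lie_linear_simps cvs.scale_left_distrib flip: cscale_cscale)
    then show "wt b (x + y) = wt b x + wt b y" "wt b (c *\<^sub>C x) = c *\<^sub>C wt b x"
      using nz by simp_all
  qed
qed (simp add: wt_def pr_h pr_in_h)

lemma wt_root_space: "b \<in> wbasis \<Longrightarrow> b \<in> rs (wt b)"
  using wt_h by (auto simp: root_space_def wt_def pr_h)

lemma root_space_span:
  assumes "\<gamma> \<in> h_dual h" "x \<in> rs \<gamma>"
  shows "x \<in> cvs.span {b \<in> wbasis. wt b = \<gamma>}"
proof -
  have "coord x b *\<^sub>C b \<in> cvs.span {b \<in> wbasis. wt b = \<gamma>}" if b: "b \<in> wbasis" for b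
  proof (cases "wt b = \<gamma>")
    case False
    then obtain H where "H \<in> h" "wt b H \<noteq> \<gamma> H"
      using h_dual_distinct[OF wt_in_h_dual[OF b] assms(1)] by blast
    then have "coord x b = 0"
      using coord_root_space[OF assms(2) b, of H] by (simp add: wt_def pr_h)
    then show ?thesis by (simp add: cvs.span_zero)
  qed (use b in \<open>auto intro: cvs.span_scale cvs.span_base\<close>)
  then have "(\<Sum>b\<in>wbasis. coord x b *\<^sub>C b) \<in> cvs.span {b \<in> wbasis. wt b = \<gamma>}"
    by (intro cvs.span_sum)
  then show ?thesis using coord_expand by simp
qed

lemma root_space_weight: "\<gamma> \<in> h_dual h \<Longrightarrow> x \<in> rs \<gamma> \<Longrightarrow> x \<noteq> 0 \<Longrightarrow> \<gamma> \<in> wt ` wbasis"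
proof (rule ccontr)
  assume a: "\<gamma> \<in> h_dual h" "x \<in> rs \<gamma>" "x \<noteq> 0" "\<gamma> \<notin> wt ` wbasis"
  then have "{b \<in> wbasis. wt b = \<gamma>} = {}" by auto
  then show False using root_space_span[OF a(1,2)] a(3) by (metis cvs.span_empty singletonD)
qed

lemma rootI: "\<gamma> \<in> h_dual h \<Longrightarrow> \<gamma> \<noteq> 0 \<Longrightarrow> x \<in> rs \<gamma> \<Longrightarrow> x \<noteq> 0 \<Longrightarrow> \<gamma> \<in> roots h"
  by (auto simp: roots_def)

text \<open>The weights of a finite basis exhaust the roots; this gives their finiteness and the
  root space decomposition.\<close>

lemma roots_eq: "roots h = wt ` wbasis - {0}"
proof -
  have "0 \<notin> wbasis" using wb_ind cvs.dependent_zero by blast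
  then have "wt b \<in> roots h" if "b \<in> wbasis" "wt b \<noteq> 0" for b
    using that wt_root_space[of b] wt_in_h_dual[of b] by (intro rootI[of _ b]) auto
  moreover have "\<gamma> \<in> wt ` wbasis - {0}" if "\<gamma> \<in> roots h" for \<gamma>
  proof -
    have "0 \<in> rs \<gamma>" by (rule cvs.subspace_0[OF subspace_root_space])
    then obtain x where "x \<in> rs \<gamma>" "x \<noteq> 0" using \<open>\<gamma> \<in> roots h\<close> by (auto simp: roots_def)
    then show ?thesis using that root_space_weight[of \<gamma> x] by (auto simp: roots_def)
  qed
  ultimately show ?thesis by auto
qed

lemma finite_roots: "finite (roots h)"
  by (simp add: roots_eq wb_finite)

lemma roots_h_dual: "\<alpha> \<in> roots h \<Longrightarrow> \<alpha> \<in> h_dual h" and roots_nonzero: "\<alpha> \<in> roots h \<Longrightarrow> \<alpha> \<noteq> 0"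
  by (auto simp: roots_def)

lemma span_root_spaces: "cvs.span (\<Union>\<gamma>\<in>insert 0 (roots h). rs \<gamma>) = UNIV"
proof -
  have "wbasis \<subseteq> (\<Union>\<gamma>\<in>insert 0 (roots h). rs \<gamma>)"
    using wt_root_space roots_eq by blast
  from cvs.span_mono[OF this] show ?thesis using wb_span by auto
qed

lemma root_space_induct [consumes 0, case_names subspace root]:
  assumes "cvs.subspace {x. P x}" "\<And>\<gamma> x. \<gamma> = 0 \<or> \<gamma> \<in> roots h \<Longrightarrow> \<gamma> \<in> h_dual h \<Longrightarrow> x \<in> rs \<gamma> \<Longrightarrow> P x"
  shows "P x"
  by (rule UNIV_span_induct[OF span_root_spaces assms(1)]) (use assms(2) roots_h_dual h_dual_0 in auto)

lemma not_in_roots_zero: "\<gamma> \<in> h_dual h \<Longrightarrow> \<gamma> \<noteq> 0 \<Longrightarrow> \<gamma> \<notin> roots h \<Longrightarrow> x \<in> rs \<gamma> \<Longrightarrow> x = 0"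
  using rootI by blast

end

context cartan_semisimple
begin

section \<open>The Killing form\<close>

lemma killing_btrace: "killing x y = btrace wbasis wbasis (\<lambda>z. lie x (lie y z))"
  for x y :: 'g
  using ctrace_btrace[OF wb_ind wb_span wb_finite clinear_compose[OF clinear_lie clinear_lie]]
  by (simp add: killing_def comp_def)

lemma killing_add_left: "killing (x + y) z = killing x z + killing y (z :: 'g)"
  and killing_add_right: "killing z (x + y) = killing z x + killing (z :: 'g) y"
  and killing_scale_left: "killing (c *\<^sub>C x) z = c * killing x z"
  and killing_scale_right: "killing z (c *\<^sub>C x) = c * killing z x"
  by (simp_all add: killing_btrace btrace_def lie_linear_simps clinear_add[OF coord_linear]
      clinear_scale[OF coord_linear] sum.distrib sum_distrib_left)

lemma clinear_killing: "clinear (killing (x :: 'g))"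
  by (rule clinearI) (simp_all add: killing_add_right killing_scale_right)

lemma clinear_killing_left: "clinear (\<lambda>x. killing x (y :: 'g))"
  by (rule clinearI) (simp_all add: killing_add_left killing_scale_left)

lemmas killing_simps = killing_add_left killing_add_right killing_scale_left killing_scale_right
  clinear_zero[OF clinear_killing] clinear_zero[OF clinear_killing_left]
  clinear_minus[OF clinear_killing] clinear_minus[OF clinear_killing_left]
  clinear_diff[OF clinear_killing] clinear_diff[OF clinear_killing_left]

lemma killing_commute: "killing x y = killing y (x :: 'g)"
  unfolding killing_btrace
  by (rule btrace_commute[OF wb_ind wb_span wb_finite order_refl clinear_lie clinear_lie])
    (simp_all add: wb_span)

text \<open>In one of the two terms of the commutator, cyclicity of the trace moves y behind
  \<open>lie x\<close> and \<open>lie z\<close>.\<close>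

lemma killing_invariant: "killing (lie x y) z = killing x (lie y (z :: 'g))"
proof -
  have lin: "clinear (\<lambda>w. lie x (lie z w))"
    by (rule clinear_compose[OF clinear_lie clinear_lie])
  have "killing (lie x y) z = btrace wbasis wbasis (\<lambda>w. lie x (lie y (lie z w)))
      - btrace wbasis wbasis (\<lambda>w. lie y (lie x (lie z w)))"
    by (simp add: killing_btrace btrace_def lie_derivation[of x y] clinear_add[OF coord_linear]
        sum_subtractf[symmetric])
  also have "btrace wbasis wbasis (\<lambda>w. lie y (lie x (lie z w))) =
      btrace wbasis wbasis (\<lambda>w. lie x (lie z (lie y w)))"
    by (rule btrace_commute[OF wb_ind wb_span wb_finite order_refl clinear_lie lin])
      (simp_all add: wb_span)
  also have "btrace wbasis wbasis (\<lambda>w. lie x (lie y (lie z w))) - \<dots> = killing x (lie y z)"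
    by (simp add: killing_btrace btrace_def lie_derivation[of y z] lie_linear_simps
        clinear_add[OF coord_linear] sum_subtractf[symmetric])
  finally show ?thesis .
qed

lemma killing_h:
  assumes "H \<in> h" "G \<in> h"
  shows "killing H G = (\<Sum>b\<in>wbasis. wt b H * wt b G)"
  unfolding killing_btrace btrace_def
proof (rule sum.cong[OF refl])
  fix b assume b: "b \<in> wbasis"
  then show "coord (lie H (lie G b)) b = wt b H * wt b G"
    using wt_root_space[OF b] assms
    by (simp add: root_space_def lie_linear_simps cscale_cscale clinear_scale[OF coord_linear]
        cvs.representation_basis[OF wb_ind] mult.commute)
qed

text \<open>Moving \<open>lie H\<close> from x to y turns the factor \<alpha> H into - \<beta> H,
  where H is chosen with \<alpha> H + \<beta> H nonzero.\<close>

lemma killing_orth: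
  assumes "\<alpha> \<in> h_dual h" "\<beta> \<in> h_dual h" "\<alpha> + \<beta> \<noteq> 0" "x \<in> rs \<alpha>" "y \<in> rs \<beta>"
  shows "killing x y = 0"
proof -
  obtain H where H: "H \<in> h" "(\<alpha> + \<beta>) H \<noteq> 0"
    using h_dual_distinct[OF h_dual_add[OF assms(1,2)] h_dual_0 assms(3)] by auto
  have "\<alpha> H * killing x y = killing (lie H x) y"
    using H assms by (simp add: root_space_def killing_simps)
  also have "\<dots> = - killing (lie x H) y"
    by (subst lie_antisym) (simp add: killing_simps)
  also have "\<dots> = - \<beta> H * killing x y"
    using H assms by (simp add: killing_invariant root_space_def killing_simps)
  finally have "(\<alpha> H + \<beta> H) * killing x y = 0" by (simp add: algebra_simps)
  then show ?thesis using H by simp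
qed

text \<open>The bracket of opposite root vectors is a commutator on every root string, hence has
  trace 0 there.\<close>

lemma string_trace:
  assumes "\<alpha> \<in> h_dual h" "\<beta> \<in> h_dual h" "x \<in> rs \<alpha>" "y \<in> rs (- \<alpha>)"
  shows "(\<Sum>b | b \<in> wbasis \<and> (\<exists>k::int. wt b = (\<lambda>z. \<beta> z + of_int k * \<alpha> z)). wt b (lie x y)) = 0"
    (is "(\<Sum>b\<in>?C. _) = 0")
proof -
  have Csub: "?C \<subseteq> wbasis" by blast
  have H: "lie x y \<in> h"
    using lie_root_space[OF assms(3,4)] h_eq_root_space by simp
  have stab: "lie u b \<in> cvs.span ?C"
    if "u \<in> rs (\<lambda>z. of_int m * \<alpha> z)" "b \<in> ?C" for u b and m :: int
  proof -
    from that obtain k :: int where k: "b \<in> wbasis" "wt b = (\<lambda>z. \<beta> z + of_int k * \<alpha> z)" by blast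
    let ?g = "\<lambda>z. \<beta> z + of_int (k + m) * \<alpha> z"
    have "(\<lambda>z. of_int m * \<alpha> z) + wt b = ?g" by (auto simp: k(2) algebra_simps)
    then have "lie u b \<in> rs ?g"
      using lie_root_space[OF that(1) wt_root_space[OF k(1)]] by simp
    moreover have "?g \<in> h_dual h"
      using h_dual_add[OF assms(2) h_dual_cmult[OF assms(1), of "of_int (k + m)"]]
      by (simp add: plus_fun_def)
    ultimately have "lie u b \<in> cvs.span {b \<in> wbasis. wt b = ?g}"
      by (rule root_space_span[rotated])
    also have "\<dots> \<subseteq> cvs.span ?C" by (rule cvs.span_mono) blast
    finally show ?thesis .
  qed
  have x: "x \<in> rs (\<lambda>z. of_int 1 * \<alpha> z)" and y: "y \<in> rs (\<lambda>z. of_int (- 1) * \<alpha> z)"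
    using assms(3,4) by (auto simp: root_space_def)
  have "(\<Sum>b\<in>?C. wt b (lie x y)) = btrace wbasis ?C (lie (lie x y))"
    unfolding btrace_def
  proof (rule sum.cong[OF refl])
    fix b assume "b \<in> ?C"
    then have b: "b \<in> wbasis" by blast
    show "wt b (lie x y) = coord (lie (lie x y) b) b"
      using wt_root_space[OF b] H b
      by (simp add: root_space_def clinear_scale[OF coord_linear] cvs.representation_basis[OF wb_ind])
  qed
  also have "\<dots> = btrace wbasis ?C (\<lambda>z. lie x (lie y z)) - btrace wbasis ?C (\<lambda>z. lie y (lie x z))"
    by (simp add: btrace_def lie_derivation[of x y] clinear_add[OF coord_linear] sum_subtractf[symmetric])
  also have "\<dots> = 0"
    using btrace_commute[OF wb_ind wb_span wb_finite Csub clinear_lie clinear_lie stab[OF x] stab[OF y]]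
    by simp
  finally show ?thesis .
qed

text \<open>On the string through b the weights are those of b plus integer multiples of \<alpha>,
  and their values at \<open>lie x y\<close> sum to 0. Division by the number of basis vectors in
  the string, nonzero because b is one of them, gives the ratio. It is recorded as a real number
  because only the sign of its square matters.\<close>

lemma string_rational:
  assumes "\<alpha> \<in> h_dual h" "b \<in> wbasis" "x \<in> rs \<alpha>" "y \<in> rs (- \<alpha>)"
  shows "\<exists>q::real. wt b (lie x y) = of_real q * \<alpha> (lie x y)"
proof -
  let ?H = "lie x y"
  let ?C = "{c \<in> wbasis. \<exists>k::int. wt c = (\<lambda>z. wt b z + of_int k * \<alpha> z)}"
  define k where "k c = (SOME k::int. wt c = (\<lambda>z. wt b z + of_int k * \<alpha> z))" for c
  have *: "wt c = (\<lambda>z. wt b z + of_int (k c) * \<alpha> z)" if "c \<in> ?C" for c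
    unfolding k_def by (rule someI_ex[where P = "\<lambda>k::int. wt c = (\<lambda>z. wt b z + of_int k * \<alpha> z)"])
      (use that in simp)
  have k: "wt c ?H = wt b ?H + of_int (k c) * \<alpha> ?H" if "c \<in> ?C" for c
    by (rule fun_cong[OF *[OF that]])
  have "0 = (\<Sum>c\<in>?C. wt c ?H)"
    using string_trace[OF assms(1) wt_in_h_dual[OF assms(2)] assms(3,4)] by simp
  also have "\<dots> = of_nat (card ?C) * wt b ?H + of_int (\<Sum>c\<in>?C. k c) * \<alpha> ?H"
    by (simp add: k sum.distrib sum_distrib_right)
  finally have *: "of_nat (card ?C) * wt b ?H = - of_int (\<Sum>c\<in>?C. k c) * \<alpha> ?H"
    by (simp add: eq_neg_iff_add_eq_0)
  have "b \<in> ?C" using assms(2) by (auto intro!: exI[of _ 0])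
  then have "card ?C \<noteq> 0" using wb_finite by (auto simp: card_eq_0_iff)
  then have "wt b ?H = of_real (- of_int (\<Sum>c\<in>?C. k c) / of_nat (card ?C)) * \<alpha> ?H"
    using * by (simp add: field_simps)
  then show ?thesis by blast
qed

text \<open>For H = \<open>lie x y\<close>, the value \<open>killing H H\<close> is the square of
  \<alpha> H times a sum of real squares. If it vanishes, all weights vanish at H, so H is
  central.\<close>

lemma isotropic_bracket_zero:
  assumes "\<alpha> \<in> h_dual h" "x \<in> rs \<alpha>" "y \<in> rs (- \<alpha>)" and B: "killing (lie x y) (lie x y) = 0"
  shows "lie x y = 0"
proof -
  let ?H = "lie x y"
  have H: "?H \<in> h"
    using lie_root_space[OF assms(2,3)] h_eq_root_space by simp
  obtain q :: "'g \<Rightarrow> real" where q: "\<And>b. b \<in> wbasis \<Longrightarrow> wt b ?H = of_real (q b) * \<alpha> ?H"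
    using string_rational[OF assms(1) _ assms(2,3)] by metis
  have "0 = (\<Sum>b\<in>wbasis. wt b ?H * wt b ?H)"
    using B killing_h[OF H H] by simp
  also have "\<dots> = (\<Sum>b\<in>wbasis. of_real ((q b)\<^sup>2) * (\<alpha> ?H)\<^sup>2)"
    using q by (intro sum.cong) (auto simp: power2_eq_square algebra_simps)
  also have "\<dots> = of_real (\<Sum>b\<in>wbasis. (q b)\<^sup>2) * (\<alpha> ?H)\<^sup>2"
    by (simp add: sum_distrib_right)
  finally have "(\<Sum>b\<in>wbasis. (q b)\<^sup>2) = 0 \<or> \<alpha> ?H = 0"
    by (metis mult_eq_0_iff of_real_eq_0_iff power_eq_0_iff)
  then have "wt b ?H = 0" if "b \<in> wbasis" for b
    using that q[OF that] sum_nonneg_eq_0_iff[OF wb_finite, of "\<lambda>b. (q b)\<^sup>2"] by auto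
  then have "lie ?H b = 0" if "b \<in> wbasis" for b
    using that wt_root_space[OF that] H by (simp add: root_space_def)
  then have "lie ?H z = 0" for z
    by (rule UNIV_span_induct[OF wb_span, rotated])
      (auto intro!: cvs.subspaceI simp: lie_linear_simps)
  then show ?thesis by (rule central_zero)
qed

section \<open>Non-degeneracy of the Killing form\<close>

text \<open>
  The part \<open>knil\<close> of the radical \<open>krad\<close> of the Killing form in the root spaces is an ideal without
  component of weight 0, because brackets of opposite root vectors in \<open>krad\<close> vanish. Its centre
  would be an abelian ideal and non-zero by Engel's theorem, so \<open>knil = {0}\<close>, and then \<open>krad\<close> is
  an abelian ideal contained in \<open>h\<close>.
\<close>

definition "krad = {x::'g. \<forall>y. killing x y = 0}"

lemma subspace_krad: "cvs.subspace krad"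
  by (rule cvs.subspaceI) (auto simp: krad_def killing_simps)

lemma lie_ideal_krad: "lie_ideal krad"
proof -
  have "killing (lie x y) z = 0" if "y \<in> krad" for x y z
    using that lie_antisym[of x y] by (simp add: krad_def killing_simps killing_invariant)
  then show ?thesis using subspace_krad by (simp add: lie_ideal_def) (simp add: krad_def)
qed

definition "knil = cvs.span (\<Union>\<alpha>\<in>roots h. krad \<inter> rs \<alpha>)"

lemma subspace_knil: "cvs.subspace knil"
  by (simp add: knil_def cvs.subspace_span)

lemma lie_ideal_knil: "lie_ideal knil"
proof -
  have *: "lie z x \<in> knil" if x: "x \<in> krad" "x \<in> rs \<alpha>" "\<alpha> \<in> roots h"
    and z: "z \<in> rs \<gamma>" "\<gamma> \<in> h_dual h" for x z \<alpha> \<gamma>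
  proof (cases "\<alpha> + \<gamma> = 0")
    case True
    then have "z \<in> rs (- \<alpha>)" using z by (simp add: add_eq_0_iff)
    \<comment> \<open>The bracket lies in the ideal \<open>krad\<close>, so it is isotropic and
      therefore 0.\<close>
    moreover have "killing (lie x z) (lie x z) = 0"
      using lie_ideal_lie_left[OF lie_ideal_krad x(1), of z] by (simp add: krad_def)
    ultimately have "lie x z = 0"
      using isotropic_bracket_zero x roots_h_dual by blast
    then show ?thesis using lie_antisym[of z x] by (simp add: knil_def cvs.span_zero)
  next
    case False
    have "lie z x \<in> rs (\<gamma> + \<alpha>)" "lie z x \<in> krad"
      using lie_root_space[OF z(1) x(2)] lie_ideal_krad x by (auto simp: lie_ideal_def)
    moreover have "\<gamma> + \<alpha> \<in> h_dual h" using z x h_dual_add roots_h_dual by blast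
    ultimately show ?thesis
      using not_in_roots_zero[of "\<gamma> + \<alpha>" "lie z x"] False
      by (cases "\<gamma> + \<alpha> \<in> roots h") (auto simp: knil_def add.commute cvs.span_zero intro!: cvs.span_base)
  qed
  have "lie z x \<in> knil" if "x \<in> knil" for x z
  proof (rule root_space_induct[where x = z])
    show "cvs.subspace {z. lie z x \<in> knil}"
      by (rule cvs.subspaceI) (auto simp: lie_linear_simps knil_def cvs.span_zero intro: cvs.span_add cvs.span_scale)
    fix \<gamma> z assume z: "\<gamma> \<in> h_dual h" "z \<in> rs \<gamma>"
    show "lie z x \<in> knil"
    proof (rule clinear_span_subset[OF clinear_lie _ subspace_knil])
      show "x \<in> cvs.span (\<Union>\<alpha>\<in>roots h. krad \<inter> rs \<alpha>)" using that by (simp add: knil_def)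
    qed (use * z in blast)
  qed
  then show ?thesis by (auto simp: lie_ideal_def subspace_knil)
qed

definition "khom = {x \<in> knil. \<exists>\<gamma>\<in>h_dual h. x \<in> rs \<gamma>}"

lemma knil_eq_span: "knil = cvs.span khom"
proof
  have "(\<Union>\<alpha>\<in>roots h. krad \<inter> rs \<alpha>) \<subseteq> khom"
    using roots_h_dual by (auto simp: khom_def knil_def intro: cvs.span_base)
  then show "knil \<subseteq> cvs.span khom" unfolding knil_def by (rule cvs.span_mono)
  show "cvs.span khom \<subseteq> knil"
    by (rule cvs.span_minimal[OF _ subspace_knil]) (auto simp: khom_def)
qed

lemma lie_khom: "x \<in> khom \<Longrightarrow> y \<in> khom \<Longrightarrow> lie x y \<in> khom"
  using lie_ideal_knil lie_root_space h_dual_add unfolding khom_def lie_ideal_def by blast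

text \<open>The generators of \<open>knil\<close> have weights that are nonzero on h, so their span
  contains no nonzero vector of weight 0. Hence a nonzero element of \<open>khom\<close> has a
  nonzero weight, and its adjoint action is nilpotent.\<close>

lemma knil_root_space_0: "x \<in> knil \<Longrightarrow> x \<in> rs 0 \<Longrightarrow> x = 0"
proof (rule ccontr)
  assume x: "x \<in> knil" "x \<in> rs 0" "x \<noteq> 0"
  have "x = 0 \<or> (\<exists>\<alpha>\<in>roots h. x \<in> krad \<inter> rs \<alpha> \<and> (\<forall>H\<in>h. \<alpha> H = 0))"
  proof (rule eigenvector_in_graded_span[of h lie "roots h" "\<lambda>\<alpha>. krad \<inter> rs \<alpha>"])
    show "cvs.subspace (krad \<inter> rs \<alpha>)" for \<alpha>
      by (intro cvs.subspace_inter subspace_krad subspace_root_space)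
    show "x \<in> cvs.span (\<Union>\<alpha>\<in>roots h. krad \<inter> rs \<alpha>)" using x by (simp add: knil_def)
  qed (use x clinear_lie h_dual_distinct roots_h_dual in \<open>auto simp: root_space_def\<close>)
  then obtain \<alpha> where "\<alpha> \<in> roots h" "\<forall>H\<in>h. \<alpha> H = 0" using x(3) by blast
  then show False using h_dual_eqI[of \<alpha> 0] h_dual_0 roots_h_dual roots_nonzero by auto
qed

lemma funpow_root_space:
  "x \<in> rs \<alpha> \<Longrightarrow> v \<in> rs \<beta> \<Longrightarrow> (lie x ^^ n) v \<in> rs (\<lambda>z. \<beta> z + of_nat n * \<alpha> z)"
proof (induction n)
  case (Suc n)
  have "\<alpha> + (\<lambda>z. \<beta> z + of_nat n * \<alpha> z) = (\<lambda>z. \<beta> z + of_nat (Suc n) * \<alpha> z)"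
    by (auto simp: algebra_simps)
  then show ?case using lie_root_space[OF Suc.prems(1) Suc.IH] Suc.prems by simp
qed simp

text \<open>The weights \<beta> + n \<alpha> are pairwise different, and only finitely many weights
  occur.\<close>

lemma root_vector_nilpotent:
  assumes "\<alpha> \<in> h_dual h" "\<alpha> \<noteq> 0" "x \<in> rs \<alpha>" "\<beta> \<in> h_dual h" "v \<in> rs \<beta>"
  shows "\<exists>n. (lie x ^^ n) v = 0"
proof (rule ccontr)
  assume a: "\<not> ?thesis"
  let ?g = "\<lambda>n::nat. \<lambda>z. \<beta> z + of_nat n * \<alpha> z"
  have "?g n \<in> wt ` wbasis" for n
  proof (rule root_space_weight)
    show "?g n \<in> h_dual h"
      using h_dual_add[OF assms(4) h_dual_cmult[OF assms(1), of "of_nat n"]] by (simp add: plus_fun_def)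
    show "(lie x ^^ n) v \<in> rs (?g n)" using funpow_root_space[OF assms(3,5)] .
    show "(lie x ^^ n) v \<noteq> 0" using a by blast
  qed
  then have "range ?g \<subseteq> wt ` wbasis" by blast
  then have "finite (range ?g)" using wb_finite finite_subset by blast
  moreover have "inj ?g"
  proof (rule injI)
    fix m n assume "?g m = ?g n"
    moreover obtain z where "\<alpha> z \<noteq> 0" using assms(2) by (auto simp: fun_eq_iff)
    ultimately show "m = n" by (auto simp: fun_eq_iff)
  qed
  ultimately show False using finite_imageD infinite_UNIV_nat by blast
qed

text \<open>
  Engel's theorem for subalgebras of \<open>knil\<close>: only invariant subspaces \<open>V\<close> spanned by
  homogeneous elements are considered, so that the null vectors produced are homogeneous and
  can be adjoined to the subalgebra.
\<close>

definition engel :: "'g set \<Rightarrow> bool" where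
  "engel A \<longleftrightarrow> (\<forall>V W. cvs.subspace W \<and> V = cvs.span (V \<inter> khom) \<and> \<not> V \<subseteq> W \<and>
     (\<forall>a\<in>A. (\<forall>v\<in>V. lie a v \<in> V) \<and> (\<forall>w\<in>W. lie a w \<in> W)) \<longrightarrow>
     (\<exists>v\<in>V \<inter> khom. v \<notin> W \<and> (\<forall>a\<in>A. lie a v \<in> W)))"

definition "engel_subalgebra A \<longleftrightarrow> lie_subalgebra A \<and> A \<subseteq> knil \<and> engel A"

lemma khom_nilpotent:
  assumes "x \<in> khom" "v \<in> khom"
  shows "\<exists>n. (lie x ^^ n) v = 0"
proof (cases "x = 0")
  case True
  then have "(lie x ^^ 1) v = 0" by (simp add: lie_linear_simps)
  then show ?thesis by blast
next
  case False
  with assms knil_root_space_0 obtain \<alpha> \<beta>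
    where "\<alpha> \<in> h_dual h" "\<alpha> \<noteq> 0" "x \<in> rs \<alpha>" "\<beta> \<in> h_dual h" "v \<in> rs \<beta>"
    unfolding khom_def by blast
  then show ?thesis by (rule root_vector_nilpotent)
qed

lemma engel_0: "engel_subalgebra {0}"
proof -
  have "engel {0}"
    unfolding engel_def
  proof (intro allI impI, elim conjE)
    fix V W assume VW: "cvs.subspace W" "V = cvs.span (V \<inter> khom)" "\<not> V \<subseteq> W"
    have "\<not> V \<inter> khom \<subseteq> W"
      using VW cvs.span_minimal[of "V \<inter> khom" W] by auto
    then show "\<exists>v\<in>V \<inter> khom. v \<notin> W \<and> (\<forall>a\<in>{0}. lie a v \<in> W)"
      using VW(1) by (auto simp: lie_linear_simps cvs.subspace_0)
  qed
  then show ?thesis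
    by (auto simp: engel_subalgebra_def lie_subalgebra_def cvs.subspace_single_0 lie_linear_simps
        knil_def cvs.span_zero)
qed

text \<open>The inductive step of Engel's theorem. The vectors that A maps into W form an x-stable
  space because x normalizes A; the last power of \<open>lie x\<close> that leaves such a vector
  outside W yields one that x maps into W as well.\<close>

lemma engel_insert:
  assumes A: "engel_subalgebra A" and x: "x \<in> khom" "\<And>a. a \<in> A \<Longrightarrow> lie a x \<in> A"
  shows "engel_subalgebra (cvs.span (insert x A))"
proof -
  let ?A = "cvs.span (insert x A)"
  have sub: "cvs.subspace A" and subalg: "\<And>a b. a \<in> A \<Longrightarrow> b \<in> A \<Longrightarrow> lie a b \<in> A"
    using A by (auto simp: engel_subalgebra_def lie_subalgebra_def)
  have x': "lie x a \<in> A" if "a \<in> A" for a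
    using x(2)[OF that] lie_antisym[of x a] cvs.subspace_neg[OF sub] by auto
  have "lie u v \<in> ?A" if "u \<in> ?A" "v \<in> ?A" for u v
  proof -
    from that obtain c d a b where ab: "a \<in> A" "b \<in> A" "u = c *\<^sub>C x + a" "v = d *\<^sub>C x + b"
      using span_insertE[OF _ sub] by metis
    have "lie u v \<in> A"
      unfolding ab by (auto simp: lie_linear_simps lie_self intro!: cvs.subspace_add[OF sub]
          cvs.subspace_scale[OF sub] x x' subalg ab)
    then show ?thesis by (auto intro: cvs.span_base)
  qed
  then have 1: "lie_subalgebra ?A" by (auto simp: lie_subalgebra_def cvs.subspace_span)
  have 2: "?A \<subseteq> knil"
    using A x by (intro cvs.span_minimal subspace_knil) (auto simp: engel_subalgebra_def khom_def)
  have "engel ?A"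
    unfolding engel_def
  proof (intro allI impI, elim conjE)
    fix V W assume W: "cvs.subspace W" and V: "V = cvs.span (V \<inter> khom)" "\<not> V \<subseteq> W"
      and st: "\<forall>a\<in>?A. (\<forall>v\<in>V. lie a v \<in> V) \<and> (\<forall>w\<in>W. lie a w \<in> W)"
    have inA: "a \<in> ?A" if "a \<in> insert x A" for a using that by (rule cvs.span_base)
    obtain v where v: "v \<in> V \<inter> khom" "v \<notin> W" "\<And>a. a \<in> A \<Longrightarrow> lie a v \<in> W"
    proof -
      have "\<forall>a\<in>A. (\<forall>v\<in>V. lie a v \<in> V) \<and> (\<forall>w\<in>W. lie a w \<in> W)" using st inA by blast
      with A W V have "\<exists>v\<in>V \<inter> khom. v \<notin> W \<and> (\<forall>a\<in>A. lie a v \<in> W)"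
        unfolding engel_subalgebra_def engel_def by simp
      then show ?thesis using that by blast
    qed
    have pow: "(lie x ^^ n) v \<in> V \<inter> khom \<and> (\<forall>a\<in>A. lie a ((lie x ^^ n) v) \<in> W)" for n
    proof (induction n)
      case (Suc n)
      have "lie a (lie x ((lie x ^^ n) v)) \<in> W" if "a \<in> A" for a
        unfolding lie_derivation[of a x]
        using Suc st that inA x by (intro cvs.subspace_add[OF W]) auto
      then show ?case using Suc lie_khom[OF x(1)] st inA by auto
    qed (use v in auto)
    have "\<exists>n. (lie x ^^ n) v \<in> W"
      using khom_nilpotent[OF x(1)] v(1) cvs.subspace_0[OF W] by (metis IntD2)
    \<comment> \<open>The exponent n is positive because v itself lies outside W; the vector looked
      for sits at exponent n - 1.\<close>
    then obtain n where n: "(lie x ^^ n) v \<in> W" "\<And>m. m < n \<Longrightarrow> (lie x ^^ m) v \<notin> W"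
      using exists_least_iff[of "\<lambda>n. (lie x ^^ n) v \<in> W"] by blast
    with v obtain m where m: "n = Suc m" by (cases n) auto
    let ?u = "(lie x ^^ m) v"
    have "lie a ?u \<in> W" if a: "a \<in> ?A" for a
    proof -
      obtain c b where "b \<in> A" "a = c *\<^sub>C x + b" using span_insertE[OF a sub] by blast
      then show ?thesis
        using n(1) pow[of m] by (auto simp: m lie_linear_simps intro!: cvs.subspace_add[OF W] cvs.subspace_scale[OF W])
    qed
    then show "\<exists>v\<in>V \<inter> khom. v \<notin> W \<and> (\<forall>a\<in>?A. lie a v \<in> W)"
      using pow[of m] n(2)[of m] m by auto
  qed
  with 1 2 show ?thesis by (simp add: engel_subalgebra_def)
qed

sublocale fd: finite_dimensional_vector_space "cscale :: complex \<Rightarrow> 'g \<Rightarrow> 'g" wbasis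
  by unfold_locales (simp_all add: wb_finite wb_ind wb_span)

text \<open>A subalgebra of maximal dimension with the Engel property is all of \<open>knil\<close>:
  otherwise its Engel property for V = \<open>knil\<close> and W = A yields a homogeneous element
  outside A that normalizes A, and adjoining it raises the dimension.\<close>

lemma engel_knil: "engel knil"
proof -
  have "\<forall>A. engel_subalgebra A \<longrightarrow> cvs.dim A < Suc (cvs.dim (UNIV :: 'g set))"
    using fd.dim_subset[OF subset_UNIV] by (simp add: less_Suc_eq_le)
  from ex_has_greatest_nat[of engel_subalgebra, OF engel_0 this]
  obtain A where A: "engel_subalgebra A"
    and max: "\<And>A'. engel_subalgebra A' \<Longrightarrow> cvs.dim A' \<le> cvs.dim A"
    by blast
  then have sub: "cvs.subspace A" and Ak: "A \<subseteq> knil"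
    by (auto simp: engel_subalgebra_def lie_subalgebra_def)
  have "A = knil"
  proof (rule ccontr)
    assume ne: "A \<noteq> knil"
    have "khom \<subseteq> knil" by (auto simp: khom_def)
    then have "knil = cvs.span (knil \<inter> khom)" using knil_eq_span by (simp add: Int_absorb1)
    moreover have "\<forall>a\<in>A. (\<forall>v\<in>knil. lie a v \<in> knil) \<and> (\<forall>w\<in>A. lie a w \<in> A)"
      using A lie_ideal_knil by (auto simp: engel_subalgebra_def lie_subalgebra_def lie_ideal_def)
    moreover have "\<not> knil \<subseteq> A" using ne Ak by blast
    ultimately have "\<exists>x\<in>knil \<inter> khom. x \<notin> A \<and> (\<forall>a\<in>A. lie a x \<in> A)"
      using A sub unfolding engel_subalgebra_def engel_def by simp
    then obtain x where x: "x \<in> knil \<inter> khom" "x \<notin> A" "\<forall>a\<in>A. lie a x \<in> A"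
      by blast
    then have "engel_subalgebra (cvs.span (insert x A))"
      using engel_insert[OF A] by blast
    from max[OF this] show False
      using x(2) sub by (simp add: fd.dim_insert cvs.span_eq_iff[THEN iffD2])
  qed
  then show ?thesis using A by (simp add: engel_subalgebra_def)
qed

lemma knil_zero: "knil = {0}"
proof (rule ccontr)
  assume ne: "knil \<noteq> {0}"
  have 0: "0 \<in> knil" by (rule cvs.subspace_0[OF subspace_knil])
  have "khom \<subseteq> knil" by (auto simp: khom_def)
  then have "knil = cvs.span (knil \<inter> khom)" using knil_eq_span by (simp add: Int_absorb1)
  moreover have "\<forall>a\<in>knil. (\<forall>v\<in>knil. lie a v \<in> knil) \<and> (\<forall>w\<in>{0}. lie a w \<in> {0})"
    using lie_ideal_knil by (auto simp: lie_ideal_def lie_linear_simps)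
  moreover have "\<not> knil \<subseteq> {0}" using ne 0 by blast
  ultimately have "\<exists>v\<in>knil \<inter> khom. v \<notin> {0} \<and> (\<forall>a\<in>knil. lie a v \<in> {0})"
    using engel_knil cvs.subspace_single_0 unfolding engel_def by blast
  then obtain v where v: "v \<in> knil" "v \<noteq> 0" "\<forall>a\<in>knil. lie a v = 0"
    by blast
  let ?Z = "{z \<in> knil. \<forall>a\<in>knil. lie a z = 0}"
  have "lie_ideal ?Z"
    unfolding lie_ideal_def
  proof (intro conjI allI ballI)
    show "cvs.subspace ?Z"
      using subspace_knil by (auto intro!: cvs.subspaceI simp: lie_linear_simps
          cvs.subspace_0 cvs.subspace_add cvs.subspace_scale)
    fix x z assume z: "z \<in> ?Z"
    have "lie a (lie x z) = 0" if "a \<in> knil" for a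
      using z that lie_ideal_lie_left[OF lie_ideal_knil that]
      by (simp add: lie_derivation[of a x] lie_linear_simps)
    then show "lie x z \<in> ?Z" using z lie_ideal_knil by (auto simp: lie_ideal_def)
  qed
  then have "v = 0" by (rule abelian_ideal_zero) (use v in auto)
  with v show False by simp
qed

lemma krad_zero: "x \<in> krad \<Longrightarrow> x = 0"
proof -
  have "x \<in> h" if x: "x \<in> krad" for x
  proof -
    have "x \<in> cvs.span (\<Union>\<gamma>\<in>insert 0 (roots h). rs \<gamma>)" unfolding span_root_spaces by simp
    from span_UN_subspace[OF subspace_root_space this] obtain F y where
      F: "finite F" "F \<subseteq> insert 0 (roots h)" "\<forall>i\<in>F. y i \<in> rs i" "x = (\<Sum>i\<in>F. y i)" by blast
    then have FD: "i \<in> h_dual h" if "i \<in> F" for i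
      using that h_dual_0 roots_h_dual by blast
    \<comment> \<open>Only the component of weight - \<delta> pairs with a vector of weight
      \<delta>, so each component of x lies in the radical itself; for a root \<gamma> it then
      belongs to \<open>knil\<close>.\<close>
    have "y \<gamma> = 0" if \<gamma>: "\<gamma> \<in> F" "\<gamma> \<noteq> 0" for \<gamma>
    proof -
      have "killing (y \<gamma>) z = 0" for z
      proof (rule root_space_induct[where x = z])
        show "cvs.subspace {z. killing (y \<gamma>) z = 0}"
          by (rule cvs.subspaceI) (auto simp: killing_simps)
        fix \<delta> z assume \<delta>: "\<delta> \<in> h_dual h" "z \<in> rs \<delta>"
        show "killing (y \<gamma>) z = 0"
        proof (cases "\<gamma> + \<delta> = 0")
          case True
          have "killing x z = (\<Sum>i\<in>F. killing (y i) z)"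
            by (simp add: F(4) clinear_sum[OF clinear_killing_left])
          also have "\<dots> = (\<Sum>i\<in>F. if i = \<gamma> then killing (y \<gamma>) z else 0)"
          proof (rule sum.cong[OF refl])
            fix i assume i: "i \<in> F"
            have "i + \<delta> \<noteq> 0" if "i \<noteq> \<gamma>" using True that by (metis add_right_cancel)
            then show "killing (y i) z = (if i = \<gamma> then killing (y \<gamma>) z else 0)"
              using killing_orth[OF FD[OF i] \<delta>(1)] F(3) i \<delta>(2) by auto
          qed
          also have "\<dots> = killing (y \<gamma>) z" using F(1) \<gamma> by simp
          finally show ?thesis using x by (simp add: krad_def)
        qed (use killing_orth FD \<gamma> \<delta> F(3) in blast)
      qed
      then have "y \<gamma> \<in> krad \<inter> rs \<gamma>" using F(3) \<gamma> by (auto simp: krad_def)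
      then have "y \<gamma> \<in> knil" using \<gamma> F(2) by (auto simp: knil_def intro!: cvs.span_base)
      then show ?thesis using knil_zero by simp
    qed
    then have "x \<in> rs 0"
      unfolding F(4) using F(3) cvs.subspace_0[OF subspace_root_space[of h 0]]
      by (intro cvs.subspace_sum[OF subspace_root_space]) metis
    then show ?thesis using h_eq_root_space by simp
  qed
  then show "x \<in> krad \<Longrightarrow> x = 0"
    using abelian_ideal_zero[OF lie_ideal_krad] h_abelian by blast
qed

lemma killing_nondegenerate: "(\<And>y. killing x y = 0) \<Longrightarrow> x = (0 :: 'g)"
  by (rule krad_zero) (simp add: krad_def)

lemma killing_eqI: "(\<And>z. killing x z = killing y z) \<Longrightarrow> x = (y :: 'g)"
  using killing_nondegenerate[of "x - y"] by (simp add: killing_simps)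

end

section \<open>Finiteness of multisets of positive vectors with a given sum\<close>

text \<open>There is a monotone subsequence; if it decreases, it is constant from the index of its
  least value on.\<close>

lemma mono_subseq_nat: "\<exists>r::nat\<Rightarrow>nat. strict_mono r \<and> mono (\<lambda>n. f (r n))" for f :: "nat \<Rightarrow> nat"
proof -
  obtain r :: "nat \<Rightarrow> nat" where r: "strict_mono r" "monoseq (\<lambda>n. f (r n))"
    using seq_monosub[of f] by auto
  show ?thesis
  proof (cases "\<forall>m. \<forall>n\<ge>m. f (r m) \<le> f (r n)")
    case True
    then show ?thesis using r by (auto simp: mono_def)
  next
    case False
    with r have dec: "f (r n) \<le> f (r m)" if "m \<le> n" for m n
      using that by (auto simp: monoseq_def)
    obtain N where N: "\<And>n. f (r N) \<le> f (r n)"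
      using ex_has_least_nat[of "\<lambda>_. True" 0 "\<lambda>n. f (r n)"] by auto
    have "f (r (n + N)) = f (r N)" for n
      using dec[of N "n + N"] N[of "n + N"] by simp
    then have "strict_mono (\<lambda>n. r (n + N)) \<and> mono (\<lambda>n. f (r (n + N)))"
      using r(1) by (simp add: strict_mono_def mono_def)
    then show ?thesis by blast
  qed
qed

text \<open>Dickson's lemma in sequence form, by thinning out once for each coordinate.\<close>

lemma dickson_subseq:
  fixes s :: "nat \<Rightarrow> 'a \<Rightarrow> nat"
  assumes "finite A"
  shows "\<exists>r::nat\<Rightarrow>nat. strict_mono r \<and> (\<forall>a\<in>A. mono (\<lambda>n. s (r n) a))"
  using assms
proof (induction A rule: finite_induct)
  case empty
  show ?case by (intro exI[of _ id]) (simp add: strict_mono_def)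
next
  case (insert a A)
  then obtain r :: "nat \<Rightarrow> nat" where r: "strict_mono r" "\<forall>b\<in>A. mono (\<lambda>n. s (r n) b)" by blast
  obtain q :: "nat \<Rightarrow> nat" where q: "strict_mono q" "mono (\<lambda>n. s (r (q n)) a)"
    using mono_subseq_nat[of "\<lambda>n. s (r n) a"] by blast
  have "mono (\<lambda>n. s (r (q n)) b)" if "b \<in> A" for b
    using r(2) that strict_mono_mono[OF q(1)] by (auto simp: mono_def)
  then show ?case
    using q r(1) by (intro exI[of _ "r \<circ> q"]) (auto simp: strict_mono_def)
qed

lemma sum_list_count:
  fixes R :: "('b \<Rightarrow> complex) set"
  assumes "finite R" "set l \<subseteq> R"
  shows "sum_list l = (\<lambda>x. \<Sum>a\<in>R. of_nat (count_list l a) * a x)"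
  using assms(2)
proof (induction l)
  case (Cons b l)
  have "(\<Sum>a\<in>R. of_nat (count_list (b # l) a) * a x) =
      b x + (\<Sum>a\<in>R. of_nat (count_list l a) * a x)" for x
  proof -
    have "(\<Sum>a\<in>R. of_nat (count_list (b # l) a) * a x) =
        (\<Sum>a\<in>R. (if a = b then a x else 0) + of_nat (count_list l a) * a x)"
      by (rule sum.cong) (auto simp: algebra_simps)
    then show ?thesis using Cons.prems assms by (simp add: sum.distrib sum.delta)
  qed
  then show ?case using Cons by (auto simp: fun_eq_iff)
qed (auto simp: fun_eq_iff)

lemma list_with_counts:
  assumes "finite R"
  shows "\<exists>l. set l \<subseteq> R \<and> (\<forall>a\<in>R. count_list l a = n a)"
  using assms
proof (induction R rule: finite_induct)
  case (insert b R)
  then obtain l where l: "set l \<subseteq> R" "\<forall>a\<in>R. count_list l a = n a" by blast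
  have 1: "count_list (replicate m b) a = (if a = b then m else 0)" for m a
    by (induction m) auto
  have "count_list l b = 0" using l insert by (auto simp: count_list_0_iff)
  then have "\<forall>a\<in>insert b R. count_list (replicate (n b) b @ l) a = n a"
    using l insert by (auto simp: 1)
  moreover have "set (replicate (n b) b @ l) \<subseteq> insert b R" using l by auto
  ultimately show ?case by blast
qed simp

text \<open>Lists in place of multiplicities make the closure axiom of an ordering, which speaks of
  lists, applicable to the cone.\<close>

lemma nat_cone_lists: "finite R \<Longrightarrow> nat_cone R = {sum_list l | l. set l \<subseteq> R}"
proof (intro equalityI subsetI)
  assume R: "finite R"
  {
    fix \<mu> assume "\<mu> \<in> nat_cone R"
    then obtain n where n: "\<mu> = (\<lambda>x. \<Sum>\<alpha>\<in>R. of_nat (n \<alpha>) * \<alpha> x)" by (auto simp: nat_cone_def)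
    obtain l where "set l \<subseteq> R" "\<forall>a\<in>R. count_list l a = n a" using list_with_counts[OF R] by blast
    then have "\<mu> = sum_list l" using sum_list_count[OF R] by (simp add: n)
    with \<open>set l \<subseteq> R\<close> show "\<mu> \<in> {sum_list l | l. set l \<subseteq> R}" by blast
  }
  fix \<mu> assume "\<mu> \<in> {sum_list l | l. set l \<subseteq> R}"
  then show "\<mu> \<in> nat_cone R" using sum_list_count[OF R] by (auto simp: nat_cone_def)
qed

text \<open>Along a subsequence all multiplicities grow. The surplus over its first list is a
  multiset with sum 0, hence empty; so the lists of the subsequence have equal length, and a finite
  alphabet admits only finitely many of these.\<close>

lemma finite_lists_with_sum:
  fixes R :: "('b \<Rightarrow> complex) set"
  assumes R: "finite R" and pos: "\<And>l. set l \<subseteq> R \<Longrightarrow> l \<noteq> [] \<Longrightarrow> sum_list l \<noteq> 0"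
  shows "finite {l. set l \<subseteq> R \<and> sum_list l = \<mu>}" (is "finite ?L")
proof (rule ccontr)
  assume "infinite ?L"
  then obtain g :: "nat \<Rightarrow> _" where g: "inj g" "range g \<subseteq> ?L"
    using infinite_countable_subset by blast
  obtain r :: "nat \<Rightarrow> nat" where r: "strict_mono r" "\<forall>a\<in>R. mono (\<lambda>n. count_list (g (r n)) a)"
    using dickson_subseq[OF R, of "\<lambda>n. count_list (g n)"] by blast
  have gL: "set (g n) \<subseteq> R" "sum_list (g n) = \<mu>" for n using g(2) by auto
  have eq: "count_list (g (r n)) a = count_list (g (r 0)) a" if a: "a \<in> R" for n a
  proof -
    let ?d = "\<lambda>a. count_list (g (r n)) a - count_list (g (r 0)) a"
    have le: "count_list (g (r 0)) a \<le> count_list (g (r n)) a" if "a \<in> R" for a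
      using r(2) that by (auto simp: mono_def)
    obtain l where l: "set l \<subseteq> R" "\<forall>a\<in>R. count_list l a = ?d a"
      using list_with_counts[OF R, of ?d] by blast
    have "sum_list l x = \<mu> x - \<mu> x" for x
    proof -
      have "sum_list l x = (\<Sum>a\<in>R. of_nat (?d a) * a x)"
        using sum_list_count[OF R l(1)] l(2) by simp
      also have "\<dots> = (\<Sum>a\<in>R. of_nat (count_list (g (r n)) a) * a x - of_nat (count_list (g (r 0)) a) * a x)"
        using le by (intro sum.cong) (auto simp: of_nat_diff algebra_simps)
      also have "\<dots> = sum_list (g (r n)) x - sum_list (g (r 0)) x"
        by (simp only: sum_list_count[OF R gL(1)] sum_subtractf)
      finally show ?thesis by (simp add: gL)
    qed
    then have "sum_list l = 0" by (auto simp: fun_eq_iff)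
    then have "l = []" using pos l(1) by blast
    then show ?thesis using l(2) a le[OF a] by auto
  qed
  have "length (g (r n)) = length (g (r 0))" for n
    using eq sum_count_set[OF gL(1) R] by (metis (no_types, lifting) sum.cong)
  then have "range (g \<circ> r) \<subseteq> {l. set l \<subseteq> R \<and> length l = length (g (r 0))}"
    using gL(1) by auto
  then have "finite (range (g \<circ> r))"
    using finite_lists_length_eq[OF R] finite_subset by blast
  moreover have "inj (g \<circ> r)"
    using g(1) r(1) by (simp add: inj_compose strict_mono_imp_inj_on)
  ultimately show False using finite_imageD infinite_UNIV_nat by blast
qed

context cartan_semisimple
begin

section \<open>Root spaces\<close>

lemma sharp_ex: "clinear \<xi> \<Longrightarrow> \<exists>x::'g. \<forall>y. killing x y = \<xi> y"
proof -
  assume xi: "clinear \<xi>"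
  let ?T = "\<lambda>x. \<Sum>b\<in>wbasis. killing x b *\<^sub>C b"
  have rep: "coord (\<Sum>b\<in>wbasis. f b *\<^sub>C b) c = f c" if "c \<in> wbasis" for f c
    using that wb_finite
    by (simp add: clinear_sum[OF coord_linear] clinear_scale[OF coord_linear]
        cvs.representation_basis[OF wb_ind] if_distrib sum.delta' cong: if_cong)
  have eq: "killing x y = \<eta> y"
    if "clinear \<eta>" "\<forall>b\<in>wbasis. killing x b = \<eta> b" for x y and \<eta> :: "'g \<Rightarrow> complex"
    using clinear_eq_on_span[OF clinear_killing that(1), of wbasis x y] that(2) wb_span by auto
  have lin: "clinear ?T"
    by (rule clinearI) (simp_all add: killing_simps cvs.scale_left_distrib sum.distrib
        cvs.scale_sum_right cscale_cscale)
  moreover have "inj ?T"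
  proof (rule injI)
    fix x y assume "?T x = ?T y"
    then have "killing x b = killing y b" if "b \<in> wbasis" for b
      using rep[OF that, of "killing x"] rep[OF that, of "killing y"] by simp
    then show "x = y" by (intro killing_eqI eq[OF clinear_killing]) blast
  qed
  ultimately have "surj ?T" by (rule fd.linear_inj_imp_surj)
  then have "\<exists>x. (\<Sum>b\<in>wbasis. \<xi> b *\<^sub>C b) = ?T x" by (rule surjD)
  then obtain x where x: "(\<Sum>b\<in>wbasis. \<xi> b *\<^sub>C b) = ?T x" ..
  have "killing x b = \<xi> b" if "b \<in> wbasis" for b
    using rep[OF that, of "killing x"] rep[OF that, of \<xi>] x by simp
  then have "killing x y = \<xi> y" for y by (intro eq[OF xi]) blast
  then show ?thesis by blast
qed

lemma killing_sharp: "clinear \<xi> \<Longrightarrow> killing (sharp \<xi>) y = \<xi> (y :: 'g)"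
proof -
  assume "clinear \<xi>"
  then have "\<exists>!x. \<forall>y. killing x y = \<xi> y"
    using sharp_ex killing_eqI by metis
  from theI'[OF this] show ?thesis by (simp add: sharp_def)
qed

lemma sharp_eqI: "(\<And>y. killing x y = \<xi> y) \<Longrightarrow> sharp \<xi> = (x :: 'g)"
  unfolding sharp_def by (rule the_equality) (auto intro: killing_eqI)

lemma sharp_add: "clinear \<xi> \<Longrightarrow> clinear \<eta> \<Longrightarrow> sharp (\<xi> + \<eta>) = sharp \<xi> + (sharp \<eta> :: 'g)"
  by (rule sharp_eqI) (simp add: killing_simps killing_sharp)

lemma sharp_minus: "clinear \<xi> \<Longrightarrow> sharp (- \<xi>) = - (sharp \<xi> :: 'g)"
  by (rule sharp_eqI) (simp add: killing_simps killing_sharp)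

lemma sharp_0: "sharp 0 = (0 :: 'g)"
  by (rule sharp_eqI) (simp add: killing_simps)

lemma dform_eq: "clinear \<alpha> \<Longrightarrow> dform \<alpha> \<beta> = \<alpha> (sharp \<beta> :: 'g)"
  by (simp add: dform_def killing_sharp)

lemma dform_commute: "dform \<alpha> \<beta> = dform \<beta> (\<alpha> :: 'g \<Rightarrow> complex)"
  by (simp add: dform_def killing_commute)

lemma dform_add_left: "clinear \<alpha> \<Longrightarrow> clinear \<beta> \<Longrightarrow> dform (\<alpha> + \<beta>) \<gamma> = dform \<alpha> \<gamma> + dform \<beta> (\<gamma> :: 'g \<Rightarrow> complex)"
  by (simp add: dform_def sharp_add killing_simps)

lemma dform_minus_left: "clinear \<alpha> \<Longrightarrow> dform (- \<alpha>) \<gamma> = - dform \<alpha> (\<gamma> :: 'g \<Rightarrow> complex)"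
  by (simp add: dform_def sharp_minus killing_simps)

lemma dform_add_right: "clinear \<alpha> \<Longrightarrow> clinear \<beta> \<Longrightarrow> dform \<gamma> (\<alpha> + \<beta>) = dform \<gamma> \<alpha> + dform (\<gamma> :: 'g \<Rightarrow> complex) \<beta>"
  by (simp add: dform_def sharp_add killing_simps)

lemma dform_minus_right: "clinear \<alpha> \<Longrightarrow> dform \<gamma> (- \<alpha>) = - dform (\<gamma> :: 'g \<Rightarrow> complex) \<alpha>"
  by (simp add: dform_def sharp_minus killing_simps)

lemma killing_h_root_space:
  assumes "H \<in> h" "\<gamma> \<in> h_dual h" "\<gamma> \<noteq> 0" "x \<in> rs \<gamma>"
  shows "killing H x = 0" "killing x H = 0"
  using killing_orth[OF h_dual_0 assms(2), of H x] assms h_eq_root_space killing_commute[of x H]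
  by auto

text \<open>Root spaces of nonzero weight are orthogonal to h, so the restriction of the Killing
  form to h inherits non-degeneracy.\<close>

lemma h_eqI:
  assumes "x \<in> h" "y \<in> h" "\<And>H. H \<in> h \<Longrightarrow> killing x H = killing y H"
  shows "x = y"
proof (rule killing_eqI)
  fix z show "killing x z = killing y z"
  proof (rule root_space_induct[where x = z])
    show "cvs.subspace {z. killing x z = killing y z}"
      by (rule cvs.subspaceI) (auto simp: killing_simps)
    fix \<gamma> z assume "\<gamma> \<in> h_dual h" "z \<in> rs \<gamma>"
    then show "killing x z = killing y z"
      using assms killing_h_root_space h_eq_root_space by (cases "\<gamma> = 0") auto
  qed
qed

lemma sharp_in_h: "\<xi> \<in> h_dual h \<Longrightarrow> sharp \<xi> \<in> h"
proof -
  assume xi: "\<xi> \<in> h_dual h"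
  let ?t = "sharp \<xi>"
  \<comment> \<open>Both sides are tested against weight vectors: for a nonzero weight both pairings
    vanish, and on h the components of \<open>?t\<close> outside h do not contribute.\<close>
  have "?t = pr ?t"
  proof (rule killing_eqI)
    fix z show "killing ?t z = killing (pr ?t) z"
    proof (rule root_space_induct[where x = z])
      show "cvs.subspace {z. killing ?t z = killing (pr ?t) z}"
        by (rule cvs.subspaceI) (auto simp: killing_simps)
      fix \<gamma> z assume g: "\<gamma> \<in> h_dual h" "z \<in> rs \<gamma>"
      show "killing ?t z = killing (pr ?t) z"
      proof (cases "\<gamma> = 0")
        case False
        then obtain H where "H \<in> h" "\<gamma> H \<noteq> 0"
          using h_dual_distinct[OF g(1) h_dual_0] by auto
        then have "\<xi> z = 0" using xi g by (auto simp: h_dual_def)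
        then show ?thesis
          using killing_h_root_space[OF pr_in_h g(1) False g(2)] killing_sharp xi clinear_h_dual by simp
      next
        case True
        have "killing x z = killing (pr x) z" for x
        proof (rule root_space_induct[where x = x])
          show "cvs.subspace {x. killing x z = killing (pr x) z}"
            by (rule cvs.subspaceI) (auto simp: killing_simps clinear_zero[OF clinear_pr]
                clinear_add[OF clinear_pr] clinear_scale[OF clinear_pr])
          fix \<delta> x assume d: "\<delta> \<in> h_dual h" "x \<in> rs \<delta>"
          show "killing x z = killing (pr x) z"
          proof (cases "\<delta> = 0")
            case False
            then obtain H where "H \<in> h" "\<delta> H \<noteq> 0"
              using h_dual_distinct[OF d(1) h_dual_0] by auto
            then have "pr x = 0" using pr_root_space d by blast
            then show ?thesis
              using killing_h_root_space[OF _ d(1) False d(2)] True g(2) h_eq_root_space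
              by (simp add: killing_simps)
          qed (use d h_eq_root_space pr_h in auto)
        qed
        then show ?thesis by blast
      qed
    qed
  qed
  then show ?thesis using pr_in_h by metis
qed

lemma lie_root_vectors:
  assumes "\<alpha> \<in> h_dual h" "x \<in> rs \<alpha>" "y \<in> rs (- \<alpha>)"
  shows "lie x y = killing x y *\<^sub>C sharp \<alpha>"
proof (rule h_eqI)
  show "lie x y \<in> h" using lie_root_space[OF assms(2,3)] h_eq_root_space by simp
  show "killing x y *\<^sub>C sharp \<alpha> \<in> h"
    using sharp_in_h[OF assms(1)] subspace_h cvs.subspace_scale by blast
  fix H assume H: "H \<in> h"
  have "lie y H = \<alpha> H *\<^sub>C y"
    using assms(3) H lie_antisym[of y H] by (simp add: root_space_def)
  then show "killing (lie x y) H = killing (killing x y *\<^sub>C sharp \<alpha>) H"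
    using clinear_h_dual[OF assms(1)] by (simp add: killing_invariant killing_simps killing_sharp)
qed

section \<open>Opposite roots and one-dimensionality of root spaces\<close>

lemma dual_root_vector:
  assumes "\<alpha> \<in> h_dual h" "x \<in> rs \<alpha>" "x \<noteq> 0"
  shows "\<exists>y\<in>rs (- \<alpha>). killing x y = 1"
proof (rule ccontr)
  assume a: "\<not> ?thesis"
  have 0: "killing x y = 0" if "y \<in> rs (- \<alpha>)" for y
  proof (rule ccontr)
    assume "killing x y \<noteq> 0"
    then have "killing x (inverse (killing x y) *\<^sub>C y) = 1" by (simp add: killing_simps)
    moreover have "inverse (killing x y) *\<^sub>C y \<in> rs (- \<alpha>)"
      by (rule cvs.subspace_scale[OF subspace_root_space that])
    ultimately show False using a by blast
  qed
  have "killing x z = 0" for z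
  proof (rule root_space_induct[where x = z])
    show "cvs.subspace {z. killing x z = 0}"
      by (rule cvs.subspaceI) (auto simp: killing_simps)
    fix \<gamma> z assume "\<gamma> \<in> h_dual h" "z \<in> rs \<gamma>"
    then show "killing x z = 0"
      using 0 killing_orth[OF assms(1) _ _ assms(2)] by (metis add_eq_0_iff)
  qed
  with assms(3) show False using killing_nondegenerate by blast
qed

lemma root_vector_ex: "\<alpha> \<in> roots h \<Longrightarrow> \<exists>x\<in>rs \<alpha>. x \<noteq> 0"
  using cvs.subspace_0[OF subspace_root_space[of h \<alpha>]] by (auto simp: roots_def)

lemma roots_minus: "\<alpha> \<in> roots h \<Longrightarrow> - \<alpha> \<in> roots h"
proof -
  assume a: "\<alpha> \<in> roots h"
  then obtain x y where "x \<in> rs \<alpha>" "y \<in> rs (- \<alpha>)" "killing x y = 1"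
    using root_vector_ex dual_root_vector roots_h_dual by metis
  moreover from this have "y \<noteq> 0" by (auto simp: killing_simps)
  ultimately show ?thesis
    using rootI[of "- \<alpha>" y] roots_h_dual[OF a] roots_nonzero[OF a] by auto
qed

text \<open>Otherwise \<open>sharp \<alpha>\<close> would be an isotropic bracket of opposite root
  vectors, hence 0.\<close>

lemma dform_root_nonzero: "\<alpha> \<in> roots h \<Longrightarrow> \<alpha> (sharp \<alpha>) \<noteq> 0"
proof
  assume a: "\<alpha> \<in> roots h" "\<alpha> (sharp \<alpha>) = 0"
  then obtain x y where xy: "x \<in> rs \<alpha>" "y \<in> rs (- \<alpha>)" "killing x y = 1"
    using root_vector_ex dual_root_vector roots_h_dual by metis
  have lin: "clinear \<alpha>" and d: "\<alpha> \<in> h_dual h" using a roots_h_dual clinear_h_dual by auto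
  have l: "lie x y = sharp \<alpha>" using lie_root_vectors[OF d xy(1,2)] xy(3) by (simp add: cscale_one)
  then have "lie x y = 0"
    using isotropic_bracket_zero[OF d xy(1,2)] a(2) killing_sharp[OF lin] by simp
  then have "\<alpha> z = 0" for z using l killing_sharp[OF lin, of z] by (simp add: killing_simps)
  then show False using roots_nonzero[OF a(1)] by auto
qed

text \<open>A vector of \<open>rs \<alpha>\<close> killed by \<open>lie y\<close> would be a lowest weight vector of positive weight
  for the copy of \<open>sl(2)\<close> generated by \<open>x\<close> and \<open>y\<close>.\<close>

lemma root_space_dim_1:
  assumes a: "\<alpha> \<in> roots h" and xy: "x \<in> rs \<alpha>" "y \<in> rs (- \<alpha>)" "killing x y = 1" and z: "z \<in> rs \<alpha>"
  shows "z = killing z y *\<^sub>C x"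
proof (rule ccontr)
  assume ne: "z \<noteq> killing z y *\<^sub>C x"
  define u where "u = z - killing z y *\<^sub>C x"
  let ?t = "sharp \<alpha>"
  let ?u = "\<lambda>n. (lie x ^^ n) u"
  have d: "\<alpha> \<in> h_dual h" using a roots_h_dual by auto
  have u: "u \<in> rs \<alpha>" "u \<noteq> 0" "killing u y = 0"
    using ne xy cvs.subspace_diff[OF subspace_root_space z cvs.subspace_scale[OF subspace_root_space xy(1)]]
    by (simp_all add: u_def killing_simps)
  have t: "?t \<in> h" by (rule sharp_in_h[OF d])
  have yx: "lie y x = - ?t"
    using lie_root_vectors[OF d xy(1,2)] xy(3) lie_antisym[of y x] by (simp add: cscale_one)
  have tu: "lie ?t (?u n) = (of_nat (n + 1) * \<alpha> ?t) *\<^sub>C ?u n" for n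
    using funpow_root_space[OF xy(1) u(1), of n] t by (simp add: root_space_def algebra_simps)
  \<comment> \<open>Each passage of y through a letter x produces \<open>- ?t\<close>, which acts on
    \<open>?u m\<close> by - (m + 1) times \<open>\<alpha> ?t\<close>; the constant is the sum 1 +
    ... + (n + 1).\<close>
  have step: "lie y (?u (Suc n)) = (- \<alpha> ?t * of_nat ((n + 1) * (n + 2)) / 2) *\<^sub>C ?u n" for n
  proof (induction n)
    case 0
    have "lie u y = 0" using lie_root_vectors[OF d u(1) xy(2)] u(3) by simp
    then have "lie y u = 0" using lie_antisym[of y u] by simp
    then show ?case
      using tu[of 0] by (simp add: lie_derivation[of y x] yx lie_linear_simps)
  next
    case (Suc n)
    have "lie y (?u (Suc (Suc n))) = lie (lie y x) (?u (Suc n)) + lie x (lie y (?u (Suc n)))"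
      by (simp add: lie_derivation[of y x])
    also have "\<dots> = - (lie ?t (?u (Suc n))) + (- \<alpha> ?t * of_nat ((n + 1) * (n + 2)) / 2) *\<^sub>C ?u (Suc n)"
      unfolding Suc.IH by (simp add: yx lie_linear_simps)
    also have "\<dots> = (- (of_nat (n + 2) * \<alpha> ?t) + (- \<alpha> ?t * of_nat ((n + 1) * (n + 2)) / 2)) *\<^sub>C ?u (Suc n)"
      unfolding tu by (simp add: cvs.scale_left_distrib cvs.scale_left_diff_distrib)
    also have "- (of_nat (n + 2) * \<alpha> ?t) + (- \<alpha> ?t * of_nat ((n + 1) * (n + 2)) / 2)
        = - \<alpha> ?t * of_nat ((Suc n + 1) * (Suc n + 2)) / 2"
      by (simp add: field_simps)
    finally show ?case .
  qed
  have "?u n \<noteq> 0" for n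
  proof (induction n)
    case (Suc n)
    have "of_nat ((n + 1) * (n + 2)) \<noteq> (0 :: complex)" using of_nat_eq_0_iff by (metis Suc_eq_plus1 add_2_eq_Suc' mult_eq_0_iff nat.distinct(1))
    then have "lie y (?u (Suc n)) \<noteq> 0"
      unfolding step using Suc dform_root_nonzero[OF a] by simp
    then show ?case by (metis clinear_zero clinear_lie)
  qed (simp add: u)
  then show False
    using root_vector_nilpotent[OF d roots_nonzero[OF a] xy(1) d u(1)] by blast
qed

section \<open>Subspaces spanned by root spaces\<close>

text \<open>A bracket whose weight is neither 0 nor a root vanishes, so closure has to be checked
  only for sums in \<open>insert 0 (roots h)\<close>; the value 0 is included because opposite root
  vectors bracket into h.\<close>

lemma lie_root_nilpotent:
  assumes "\<And>\<gamma> \<delta>. \<gamma> \<in> R \<Longrightarrow> \<delta> \<in> S \<Longrightarrow> \<gamma> + \<delta> \<in> insert 0 (roots h) \<Longrightarrow> \<gamma> + \<delta> \<in> T"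
    and "R \<subseteq> h_dual h" "S \<subseteq> h_dual h" "x \<in> root_nilpotent h R" "y \<in> root_nilpotent h S"
  shows "lie x y \<in> root_nilpotent h T"
proof -
  have sub: "cvs.subspace (root_nilpotent h T)" by (simp add: root_nilpotent_def cvs.subspace_span)
  have *: "lie u v \<in> root_nilpotent h T" if "\<gamma> \<in> R" "u \<in> rs \<gamma>" "\<delta> \<in> S" "v \<in> rs \<delta>" for u v \<gamma> \<delta>
  proof (cases "\<gamma> + \<delta> \<in> insert 0 (roots h)")
    case True
    then show ?thesis
      using assms(1) that lie_root_space[OF that(2,4)]
      by (auto simp: root_nilpotent_def intro!: cvs.span_base)
  next
    case False
    have "\<gamma> + \<delta> \<in> h_dual h" using that(1,3) assms(2,3) by (intro h_dual_add) auto
    from not_in_roots_zero[OF this _ _ lie_root_space[OF that(2,4)]] False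
    have "lie u v = 0" by simp
    then show ?thesis using cvs.subspace_0[OF sub] by simp
  qed
  have **: "lie u y \<in> root_nilpotent h T" if "\<gamma> \<in> R" "u \<in> rs \<gamma>" for u \<gamma>
    by (rule clinear_span_subset[OF clinear_lie _ sub, of "\<Union>\<alpha>\<in>S. rs \<alpha>"])
      (use assms(5) that * in \<open>auto simp: root_nilpotent_def\<close>)
  show ?thesis
    by (rule clinear_span_subset[OF clinear_lie_left _ sub, of "\<Union>\<alpha>\<in>R. rs \<alpha>"])
      (use assms(4) ** in \<open>auto simp: root_nilpotent_def\<close>)
qed

lemma subspace_root_nilpotent: "cvs.subspace (root_nilpotent h R)"
  by (simp add: root_nilpotent_def cvs.subspace_span)

lemma root_nilpotent_base: "x \<in> rs \<gamma> \<Longrightarrow> \<gamma> \<in> R \<Longrightarrow> x \<in> root_nilpotent h R"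
  by (auto simp: root_nilpotent_def intro!: cvs.span_base)

lemma root_nilpotent_Un:
  "root_nilpotent h (R \<union> S) = {x + y | x y. x \<in> root_nilpotent h R \<and> y \<in> root_nilpotent h S}"
  by (auto simp: root_nilpotent_def UN_Un cvs.span_Un)

text \<open>Coordinates in the weight basis are confined to weights of R and also to weights of
  S.\<close>

lemma root_nilpotent_disjoint:
  assumes "R \<subseteq> h_dual h" "S \<subseteq> h_dual h" "R \<inter> S = {}"
    and "x \<in> root_nilpotent h R" "x \<in> root_nilpotent h S"
  shows "x = 0"
proof -
  have *: "x \<in> cvs.span {b \<in> wbasis. wt b \<in> R}" if "R \<subseteq> h_dual h" "x \<in> root_nilpotent h R" for R
  proof -
    have "rs \<gamma> \<subseteq> cvs.span {b \<in> wbasis. wt b \<in> R}" if "\<gamma> \<in> R" for \<gamma>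
    proof -
      have "rs \<gamma> \<subseteq> cvs.span {b \<in> wbasis. wt b = \<gamma>}"
        using root_space_span that \<open>R \<subseteq> h_dual h\<close> by blast
      also have "\<dots> \<subseteq> cvs.span {b \<in> wbasis. wt b \<in> R}"
        by (rule cvs.span_mono) (use that in auto)
      finally show ?thesis .
    qed
    then have "root_nilpotent h R \<subseteq> cvs.span {b \<in> wbasis. wt b \<in> R}"
      unfolding root_nilpotent_def by (intro cvs.span_minimal cvs.subspace_span) auto
    with that show ?thesis by blast
  qed
  have "coord x b = 0" for b
  proof (cases "b \<in> wbasis \<and> wt b \<in> R")
    case True
    then show ?thesis
      using representation_outside[OF wb_ind _ *[OF assms(2,5)], of b] assms(3) by auto
  qed (use representation_outside[OF wb_ind _ *[OF assms(1,4)], of b] in auto)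
  then show ?thesis using coord_expand[of x] by simp
qed

end

section \<open>Invariant orderings\<close>

locale triangular = cartan_semisimple h for h :: "'g::complex_lie_algebra set" +
  fixes lam :: "'g \<Rightarrow> complex" and Pos :: "('g \<Rightarrow> complex) set"
  assumes lam: "lam \<in> h_dual h" and ord: "invariant_ordering h lam Pos"
begin

abbreviation "hp \<equiv> roots_hat h lam \<inter> Pos"
abbreviation "hm \<equiv> roots_hat h lam \<inter> uminus ` Pos"
abbreviation "orth \<equiv> roots_orth h lam"
abbreviation "np \<equiv> n_plus h lam Pos"
abbreviation "nm \<equiv> n_minus h lam Pos"
abbreviation "gl \<equiv> stabilizer lam"
abbreviation "bp \<equiv> b_plus h lam Pos"

lemma clinear_lam: "clinear lam"
  using clinear_h_dual lam by blast

lemma roots_Pos: "roots h = Pos \<union> uminus ` Pos" and Pos_disjoint: "Pos \<inter> uminus ` Pos = {}"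
  and Pos_closed: "set \<beta>s \<subseteq> Pos \<Longrightarrow> sum_list \<beta>s \<in> roots h \<Longrightarrow> sum_list \<beta>s \<in> Pos"
  using ord by (auto simp: invariant_ordering_def root_ordering_def)

lemma hp_orth: "\<alpha> \<in> hp \<Longrightarrow> \<beta> \<in> orth \<Longrightarrow> \<alpha> + \<beta> \<in> roots h \<Longrightarrow> \<alpha> + \<beta> \<in> hp"
  using ord unfolding invariant_ordering_def by blast

lemma Pos_roots: "\<alpha> \<in> Pos \<Longrightarrow> \<alpha> \<in> roots h"
  using roots_Pos by blast

lemma finite_Pos: "finite Pos"
  using finite_roots roots_Pos by simp

lemma Pos_h_dual: "\<alpha> \<in> Pos \<Longrightarrow> \<alpha> \<in> h_dual h"
  using Pos_roots roots_h_dual by blast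

lemma Pos_minus: "\<alpha> \<in> Pos \<Longrightarrow> - \<alpha> \<notin> Pos"
  using Pos_disjoint by force

text \<open>If \<beta> and the remaining entries sum to 0, the latter sum to the root - \<beta>,
  which closure would make positive.\<close>

lemma Pos_sum_nonzero:
  assumes "set l \<subseteq> Pos" "l \<noteq> []"
  shows "sum_list l \<noteq> 0"
proof
  assume 0: "sum_list l = 0"
  obtain \<beta> m where l: "l = \<beta> # m" using assms(2) by (cases l) auto
  then have "sum_list m = - \<beta>" using 0 by (simp add: eq_neg_iff_add_eq_0 add.commute)
  moreover have "- \<beta> \<in> roots h" using assms(1) l roots_minus Pos_roots by simp
  ultimately have "- \<beta> \<in> Pos" using Pos_closed[of m] assms(1) l by simp
  with Pos_minus show False using assms(1) l by simp
qed

text \<open>Combined with the reflection of the ordering, this makes -lam and -Pos an instance of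
  the same locale, whose projection onto U(n-) is \<open>pi_plus\<close> for the original
  data.\<close>

lemma triangular_minus_lam: "triangular h (- lam) Pos"
proof
  show "- lam \<in> h_dual h" using lam by simp
  show "invariant_ordering h (- lam) Pos"
    using ord by (simp add: invariant_ordering_def roots_hat_def roots_orth_def
        dform_minus_right[OF clinear_lam])
qed

lemma hat_orth_minus_lam: "roots_hat h (- lam) = roots_hat h lam" "roots_orth h (- lam) = orth"
  by (simp_all add: roots_hat_def roots_orth_def dform_minus_right[OF clinear_lam])

lemma orth_minus: "- \<alpha> \<in> orth \<longleftrightarrow> \<alpha> \<in> orth"
proof -
  have "- \<alpha> \<in> orth" if "\<alpha> \<in> orth" for \<alpha>
    using that roots_minus roots_h_dual clinear_h_dual
    by (auto simp: roots_orth_def dform_minus_left)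
  from this[of \<alpha>] this[of "- \<alpha>"] show ?thesis by auto
qed

lemma hat_minus: "- \<alpha> \<in> roots_hat h lam \<longleftrightarrow> \<alpha> \<in> roots_hat h lam"
  using orth_minus roots_minus[of \<alpha>] roots_minus[of "- \<alpha>"] by (auto simp: roots_hat_def)

lemma uminus_uminus_image: "uminus ` uminus ` S = (S :: ('g \<Rightarrow> complex) set)"
  by (simp add: image_image)

lemma in_uminus_image: "\<alpha> \<in> uminus ` S \<longleftrightarrow> - \<alpha> \<in> (S :: ('g \<Rightarrow> complex) set)"
  by force

text \<open>The reflection turns \<open>nm\<close> into \<open>np\<close>, so that closure
  properties are proved for one side and quoted for the other.\<close>

lemma triangular_minus_Pos: "triangular h lam (uminus ` Pos)"
proof
  show "lam \<in> h_dual h" by (rule lam)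
  have closed: "sum_list \<beta>s \<in> uminus ` Pos" if "set \<beta>s \<subseteq> uminus ` Pos" "sum_list \<beta>s \<in> roots h" for \<beta>s
  proof -
    have "sum_list (map uminus \<beta>s) = - sum_list \<beta>s"
      by (induction \<beta>s) auto
    moreover have "set (map uminus \<beta>s) \<subseteq> Pos" using that(1) by auto
    ultimately have "- sum_list \<beta>s \<in> Pos"
      using Pos_closed[of "map uminus \<beta>s"] roots_minus[OF that(2)] by simp
    then show ?thesis by (simp add: in_uminus_image)
  qed
  have "\<alpha> + \<beta> \<in> roots_hat h lam \<inter> uminus ` Pos"
    if "\<alpha> \<in> hm" "\<beta> \<in> orth" "\<alpha> + \<beta> \<in> roots h" for \<alpha> \<beta>
  proof -
    have "- \<alpha> \<in> hp" "- \<beta> \<in> orth" using that by (auto simp: hat_minus orth_minus)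
    moreover have "- \<alpha> + - \<beta> \<in> roots h" using roots_minus[OF that(3)] by simp
    ultimately have "- \<alpha> + - \<beta> \<in> hp" by (rule hp_orth)
    then have "- (\<alpha> + \<beta>) \<in> roots_hat h lam" "- (\<alpha> + \<beta>) \<in> Pos" by simp_all
    then show ?thesis using hat_minus[of "\<alpha> + \<beta>"] in_uminus_image[of "\<alpha> + \<beta>" Pos] by blast
  qed
  moreover have "root_ordering h (uminus ` Pos)"
    using closed roots_Pos Pos_disjoint unfolding root_ordering_def uminus_uminus_image by blast
  ultimately show "invariant_ordering h lam (uminus ` Pos)"
    unfolding invariant_ordering_def by blast
qed

lemma nm_eq: "nm = n_plus h lam (uminus ` Pos)" and bm_eq: "b_minus h lam Pos = b_plus h lam (uminus ` Pos)"
  and np_minus_lam: "n_plus h (- lam) P = n_plus h lam P" and nm_minus_lam: "n_minus h (- lam) P = n_minus h lam P"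
  and gl_minus_lam: "stabilizer (- lam) = gl"
  by (simp_all add: n_minus_def n_plus_def b_minus_def b_plus_def hat_orth_minus_lam stabilizer_def)

section \<open>The stabilizer and the triangular decomposition\<close>

lemma orth_h_dual: "orth \<subseteq> h_dual h" and hat_h_dual: "roots_hat h lam \<subseteq> h_dual h"
  using roots_h_dual by (auto simp: roots_orth_def roots_hat_def)

lemma lam_root_space: "\<gamma> \<in> h_dual h \<Longrightarrow> \<gamma> \<noteq> 0 \<Longrightarrow> x \<in> rs \<gamma> \<Longrightarrow> lam x = 0"
  using h_dual_distinct[of \<gamma> 0] h_dual_0 lam unfolding h_dual_def by auto

lemma lam_lie_root_vectors:
  assumes "\<gamma> \<in> h_dual h" "x \<in> rs \<gamma>" "\<delta> \<in> h_dual h" "y \<in> rs \<delta>"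
  shows "lam (lie x y) = (if \<delta> = - \<gamma> then killing x y * dform \<gamma> lam else 0)"
proof (cases "\<delta> = - \<gamma>")
  case True
  then have "lie x y = killing x y *\<^sub>C sharp \<gamma>" using lie_root_vectors assms by blast
  then show ?thesis
    using True dform_eq[OF clinear_lam] by (simp add: clinear_scale[OF clinear_lam] dform_commute)
next
  case False
  then have "\<gamma> + \<delta> \<noteq> 0" by (simp add: add_eq_0_iff)
  then show ?thesis
    using False lam_root_space[OF h_dual_add[OF assms(1,3)] _ lie_root_space[OF assms(2,4)]] by simp
qed

lemma subspace_stabilizer: "cvs.subspace gl"
  by (rule cvs.subspaceI)
    (auto simp: stabilizer_def lie_linear_simps clinear_add[OF clinear_lam]
      clinear_scale[OF clinear_lam] clinear_zero[OF clinear_lam])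

text \<open>The form \<open>lam (lie x y)\<close> pairs the root spaces of \<gamma> and - \<gamma>
  with the factor \<open>dform \<gamma> lam\<close>. A component of a stabilizing x at a weight
  where this factor is nonzero would be detected by its dual root vector.\<close>

lemma gl_eq: "gl = root_nilpotent h (insert 0 orth)"
proof
  have "x \<in> gl" if "\<gamma> \<in> insert 0 orth" "x \<in> rs \<gamma>" for x \<gamma>
  proof -
    have g: "\<gamma> \<in> h_dual h" "dform \<gamma> lam = 0"
      using that orth_h_dual h_dual_0 by (auto simp: roots_orth_def dform_def sharp_0 killing_simps)
    have "lam (lie x y) = 0" for y
    proof (rule root_space_induct[where x = y])
      show "cvs.subspace {y. lam (lie x y) = 0}"
        by (rule cvs.subspaceI) (auto simp: lie_linear_simps clinear_add[OF clinear_lam]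
            clinear_scale[OF clinear_lam] clinear_zero[OF clinear_lam])
      fix \<delta> y assume "\<delta> \<in> h_dual h" "y \<in> rs \<delta>"
      then show "lam (lie x y) = 0" using lam_lie_root_vectors[OF g(1) that(2)] g(2) by simp
    qed
    then show ?thesis by (simp add: stabilizer_def)
  qed
  then show "root_nilpotent h (insert 0 orth) \<subseteq> gl"
    unfolding root_nilpotent_def by (intro cvs.span_minimal subspace_stabilizer) blast
  show "gl \<subseteq> root_nilpotent h (insert 0 orth)"
  proof
    fix x assume x: "x \<in> gl"
    have "x \<in> cvs.span (\<Union>\<gamma>\<in>insert 0 (roots h). rs \<gamma>)" unfolding span_root_spaces by simp
    from span_UN_subspace[OF subspace_root_space this] obtain F y where
      F: "finite F" "F \<subseteq> insert 0 (roots h)" "\<forall>i\<in>F. y i \<in> rs i" "x = (\<Sum>i\<in>F. y i)" by blast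
    then have FD: "i \<in> h_dual h" if "i \<in> F" for i
      using that h_dual_0 roots_h_dual by blast
    have "y \<gamma> = 0" if \<gamma>: "\<gamma> \<in> F" "\<gamma> \<notin> insert 0 orth" for \<gamma>
    proof (rule ccontr)
      assume "y \<gamma> \<noteq> 0"
      then obtain z where z: "z \<in> rs (- \<gamma>)" "killing (y \<gamma>) z = 1"
        using dual_root_vector FD \<gamma> F(3) by blast
      have "lam (lie x z) = (\<Sum>i\<in>F. lam (lie (y i) z))"
        by (simp add: F(4) clinear_sum[OF clinear_lie_left] clinear_sum[OF clinear_lam])
      also have "\<dots> = (\<Sum>i\<in>F. if i = \<gamma> then dform \<gamma> lam else 0)"
        using lam_lie_root_vectors[OF FD _ _ z(1)] F(3) FD \<gamma> z(2) by (intro sum.cong) auto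
      also have "\<dots> = dform \<gamma> lam" using F(1) \<gamma> by simp
      finally have "dform \<gamma> lam = 0" using x by (simp add: stabilizer_def)
      then show False using \<gamma> F(2) by (auto simp: roots_orth_def)
    qed
    then show "x \<in> root_nilpotent h (insert 0 orth)"
      unfolding F(4) using F(3) cvs.subspace_0[OF subspace_root_nilpotent]
      by (intro cvs.subspace_sum[OF subspace_root_nilpotent]) (metis root_nilpotent_base)
  qed
qed

lemma np_eq: "np = root_nilpotent h hp" and nm_root: "nm = root_nilpotent h hm"
  by (simp_all add: n_plus_def n_minus_def)

lemma bp_eq: "bp = root_nilpotent h (insert 0 orth \<union> hp)"
  unfolding root_nilpotent_Un b_plus_def gl_eq np_eq ..

lemma orth_hp_closed: "\<alpha> \<in> hp \<Longrightarrow> \<beta> \<in> insert 0 orth \<Longrightarrow> \<alpha> + \<beta> \<in> insert 0 (roots h) \<Longrightarrow> \<alpha> + \<beta> \<in> hp"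
proof -
  assume a: "\<alpha> \<in> hp" "\<beta> \<in> insert 0 orth" "\<alpha> + \<beta> \<in> insert 0 (roots h)"
  have "\<alpha> + \<beta> \<noteq> 0"
  proof
    assume "\<alpha> + \<beta> = 0"
    then have "\<beta> = - \<alpha>" by (simp add: add_eq_0_iff)
    then show False using a(1,2) orth_minus roots_nonzero by (auto simp: roots_hat_def)
  qed
  then show ?thesis using a hp_orth by auto
qed

text \<open>If \<alpha> + \<beta> were orthogonal to lam, invariance applied to \<alpha> and -
  (\<alpha> + \<beta>) would make - \<beta> positive.\<close>

lemma hp_closed: "\<alpha> \<in> hp \<Longrightarrow> \<beta> \<in> hp \<Longrightarrow> \<alpha> + \<beta> \<in> insert 0 (roots h) \<Longrightarrow> \<alpha> + \<beta> \<in> hp"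
proof -
  assume a: "\<alpha> \<in> hp" "\<beta> \<in> hp" "\<alpha> + \<beta> \<in> insert 0 (roots h)"
  then have "\<alpha> + \<beta> \<noteq> 0" using Pos_sum_nonzero[of "[\<alpha>, \<beta>]"] by simp
  then have P: "\<alpha> + \<beta> \<in> Pos" using Pos_closed[of "[\<alpha>, \<beta>]"] a by simp
  have "\<alpha> + \<beta> \<notin> orth"
  proof
    assume "\<alpha> + \<beta> \<in> orth"
    then have "- (\<alpha> + \<beta>) \<in> orth" by (simp only: orth_minus)
    moreover have "\<alpha> + - (\<alpha> + \<beta>) = - \<beta>" by simp
    moreover have "- \<beta> \<in> roots h" using a(2) Pos_roots roots_minus by blast
    ultimately have "- \<beta> \<in> Pos" using hp_orth[OF a(1)] by (metis IntD2)
    then show False using a(2) Pos_minus by blast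
  qed
  then show ?thesis using P Pos_roots by (simp add: roots_hat_def)
qed

lemma orth_closed: "\<alpha> \<in> insert 0 orth \<Longrightarrow> \<beta> \<in> insert 0 orth \<Longrightarrow> \<alpha> + \<beta> \<in> insert 0 (roots h) \<Longrightarrow>
    \<alpha> + \<beta> \<in> insert 0 orth"
  using orth_h_dual clinear_h_dual h_dual_0 dform_add_left by (auto simp: roots_orth_def roots_h_dual)

lemma lie_np: "x \<in> np \<Longrightarrow> y \<in> np \<Longrightarrow> lie x y \<in> np"
  unfolding np_eq by (rule lie_root_nilpotent[OF hp_closed]) (use hat_h_dual in auto)

lemma lie_np_gl: "x \<in> np \<Longrightarrow> y \<in> gl \<Longrightarrow> lie x y \<in> np"
  unfolding np_eq gl_eq
  by (rule lie_root_nilpotent[OF orth_hp_closed]) (use hat_h_dual orth_h_dual h_dual_0 in auto)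

lemma lie_gl: "x \<in> gl \<Longrightarrow> y \<in> gl \<Longrightarrow> lie x y \<in> gl"
  unfolding gl_eq by (rule lie_root_nilpotent[OF orth_closed]) (use orth_h_dual h_dual_0 in auto)

lemma subspace_np: "cvs.subspace np" and subspace_nm: "cvs.subspace nm" and subspace_bp: "cvs.subspace bp"
  unfolding np_eq nm_root bp_eq by (rule subspace_root_nilpotent)+

lemma lie_bp: "x \<in> bp \<Longrightarrow> y \<in> bp \<Longrightarrow> lie x y \<in> bp"
proof -
  assume "x \<in> bp" "y \<in> bp"
  then obtain a b c d where *: "x = a + b" "y = c + d" "a \<in> gl" "c \<in> gl" "b \<in> np" "d \<in> np"
    unfolding b_plus_def by blast
  have "lie a d \<in> np" using lie_np_gl[OF *(6,3)] lie_antisym[of a d] subspace_np cvs.subspace_neg by metis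
  then have "lie a d + (lie b c + lie b d) \<in> np" "lie a c \<in> gl"
    using *(3-6) by (simp_all add: cvs.subspace_add[OF subspace_np] lie_np lie_np_gl lie_gl)
  moreover have "lie x y = lie a c + (lie a d + (lie b c + lie b d))"
    by (simp add: * lie_linear_simps algebra_simps)
  ultimately show ?thesis unfolding b_plus_def by blast
qed

lemma gl_np_disjoint: "x \<in> gl \<Longrightarrow> x \<in> np \<Longrightarrow> x = 0"
  unfolding np_eq gl_eq
  by (rule root_nilpotent_disjoint[of "insert 0 orth" hp])
    (use hat_h_dual orth_h_dual h_dual_0 roots_nonzero in \<open>auto simp: roots_hat_def\<close>)

lemma nm_bp_disjoint: "x \<in> nm \<Longrightarrow> x \<in> bp \<Longrightarrow> x = 0"
  unfolding nm_root bp_eq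
  by (rule root_nilpotent_disjoint[of hm "insert 0 orth \<union> hp"])
    (use hat_h_dual orth_h_dual h_dual_0 roots_nonzero Pos_disjoint in \<open>auto simp: roots_hat_def\<close>)

lemma nm_bp_sum: "\<exists>a\<in>nm. \<exists>b\<in>bp. x = a + b"
proof -
  have "hm \<union> (insert 0 orth \<union> hp) = insert 0 (roots h)"
    using roots_Pos by (auto simp: roots_hat_def roots_orth_def)
  then have "root_nilpotent h (hm \<union> (insert 0 orth \<union> hp)) = UNIV"
    using span_root_spaces by (simp only: root_nilpotent_def)
  then show ?thesis unfolding root_nilpotent_Un[of hm] nm_root bp_eq by blast
qed

lemma gl_subset_bp: "gl \<subseteq> bp" and np_subset_bp: "np \<subseteq> bp"
  unfolding b_plus_def using cvs.subspace_0[OF subspace_np] cvs.subspace_0[OF subspace_stabilizer]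
  by force+

lemma lie_nm: "x \<in> nm \<Longrightarrow> y \<in> nm \<Longrightarrow> lie x y \<in> nm"
  using triangular.lie_np[OF triangular_minus_Pos] unfolding nm_eq .

lemma lie_nm_gl: "x \<in> nm \<Longrightarrow> y \<in> gl \<Longrightarrow> lie x y \<in> nm"
  using triangular.lie_np_gl[OF triangular_minus_Pos] unfolding nm_eq .

lemma h_subset_gl: "h \<subseteq> gl"
  unfolding gl_eq using root_nilpotent_base[of _ 0 "insert 0 orth"] h_eq_root_space by blast

text \<open>The Lie algebra character from which the generalized Verma module is induced.\<close>

definition "chi x = (THE c. \<exists>a\<in>gl. \<exists>b\<in>np. x = a + b \<and> c = lam a)"

lemma chi: "a \<in> gl \<Longrightarrow> b \<in> np \<Longrightarrow> chi (a + b) = lam a"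
proof -
  assume ab: "a \<in> gl" "b \<in> np"
  have "a' = a" if "a' \<in> gl" "b' \<in> np" "a + b = a' + b'" for a' b'
  proof -
    from that(3) have "a - a' = b' - b" by (simp add: algebra_simps)
    then have "a - a' = 0"
      using gl_np_disjoint cvs.subspace_diff[OF subspace_stabilizer ab(1) that(1)]
        cvs.subspace_diff[OF subspace_np that(2) ab(2)] by metis
    then show ?thesis by simp
  qed
  then show ?thesis unfolding chi_def by (intro the_equality) (use ab in blast)+
qed

lemma chi_gl: "x \<in> gl \<Longrightarrow> chi x = lam x" and chi_np: "x \<in> np \<Longrightarrow> chi x = 0"
  using chi[of x 0] chi[of 0 x] cvs.subspace_0[OF subspace_np] cvs.subspace_0[OF subspace_stabilizer]
    clinear_zero[OF clinear_lam] by auto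

lemma chi_add: "x \<in> bp \<Longrightarrow> y \<in> bp \<Longrightarrow> chi (x + y) = chi x + chi y"
proof -
  assume "x \<in> bp" "y \<in> bp"
  then obtain a b c d where *: "x = a + b" "y = c + d" "a \<in> gl" "c \<in> gl" "b \<in> np" "d \<in> np"
    unfolding b_plus_def by blast
  have "chi ((a + c) + (b + d)) = lam (a + c)"
    using * by (intro chi cvs.subspace_add subspace_np subspace_stabilizer)
  then show ?thesis using * chi by (simp add: clinear_add[OF clinear_lam] add.assoc add.left_commute)
qed

lemma chi_scale: "x \<in> bp \<Longrightarrow> chi (c *\<^sub>C x) = c * chi x"
proof -
  assume "x \<in> bp"
  then obtain a b where *: "x = a + b" "a \<in> gl" "b \<in> np" unfolding b_plus_def by blast
  have "chi (c *\<^sub>C a + c *\<^sub>C b) = lam (c *\<^sub>C a)"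
    using * by (intro chi cvs.subspace_scale subspace_np subspace_stabilizer)
  then show ?thesis using * chi by (simp add: clinear_scale[OF clinear_lam] cvs.scale_right_distrib)
qed

text \<open>Only the bracket of the stabilizer components contributes, and lam vanishes on it by the
  definition of the stabilizer.\<close>

lemma chi_lie: "x \<in> bp \<Longrightarrow> y \<in> bp \<Longrightarrow> chi (lie x y) = 0"
proof -
  assume "x \<in> bp" "y \<in> bp"
  then obtain a b c d where *: "x = a + b" "y = c + d" "a \<in> gl" "c \<in> gl" "b \<in> np" "d \<in> np"
    unfolding b_plus_def by blast
  have "lie a d \<in> np" using lie_np_gl[OF *(6,3)] lie_antisym[of a d] subspace_np cvs.subspace_neg by metis
  then have "lie a d + (lie b c + lie b d) \<in> np" "lie a c \<in> gl"
    using *(3-6) by (simp_all add: cvs.subspace_add[OF subspace_np] lie_np lie_np_gl lie_gl)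
  from chi[OF this(2,1)] have "chi (lie x y) = lam (lie a c)"
    by (simp add: * lie_linear_simps algebra_simps)
  then show ?thesis using *(3) by (simp add: stabilizer_def)
qed

end

section \<open>Modules over the enveloping algebra\<close>

lemma cscale_lookup: "Poly_Mapping.lookup (c *\<^sub>C p) k = c *\<^sub>C Poly_Mapping.lookup p k"
  for p :: "'a \<Rightarrow>\<^sub>0 'b::complex_vspace"
  by (cases "Poly_Mapping.lookup p k = 0") (simp_all add: cscale_poly_mapping_def Poly_Mapping.map.rep_eq)

lemma poly_mapping_add_induct [case_names zero single add]:
  assumes "P 0" "\<And>k c. P (Poly_Mapping.single k c)" "\<And>p q. P p \<Longrightarrow> P q \<Longrightarrow> P (p + q)"
  shows "P (p :: 'a \<Rightarrow>\<^sub>0 'b::monoid_add)"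
proof (induction p rule: Poly_Mapping.update_induct)
  case (update f a b)
  have "Poly_Mapping.update a b f = f + Poly_Mapping.single a b"
    using update(1) by (intro poly_mapping_eqI)
      (auto simp: lookup_update lookup_add lookup_single when_def in_keys_iff)
  then show ?case using assms update by simp
qed (rule assms)

text \<open>The linear extension of g from the basis of singletons. The action of the free algebra
  and the maps out of a tensor product are instances.\<close>

definition plin :: "('a \<Rightarrow> 'b::complex_vspace) \<Rightarrow> ('a \<Rightarrow>\<^sub>0 complex) \<Rightarrow> 'b" where
  "plin g p = (\<Sum>k\<in>Poly_Mapping.keys p. Poly_Mapping.lookup p k *\<^sub>C g k)"

lemma plin_superset:
  "finite K \<Longrightarrow> Poly_Mapping.keys p \<subseteq> K \<Longrightarrow> plin g p = (\<Sum>k\<in>K. Poly_Mapping.lookup p k *\<^sub>C g k)"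
  unfolding plin_def by (rule sum.mono_neutral_left) (auto simp: in_keys_iff)

lemma clinear_plin: "clinear (plin g)"
proof (rule clinearI)
  fix p q :: "'a \<Rightarrow>\<^sub>0 complex" and c
  let ?K = "Poly_Mapping.keys p \<union> Poly_Mapping.keys q"
  have "Poly_Mapping.keys (p + q) \<subseteq> ?K" by (rule keys_add)
  then show "plin g (p + q) = plin g p + plin g q"
    by (simp add: plin_superset[of ?K] lookup_add cvs.scale_left_distrib sum.distrib)
  have "Poly_Mapping.keys (c *\<^sub>C p) \<subseteq> Poly_Mapping.keys p"
    by (auto simp: in_keys_iff cscale_lookup)
  then show "plin g (c *\<^sub>C p) = c *\<^sub>C plin g p"
    by (simp add: plin_superset[of "Poly_Mapping.keys p"] cscale_lookup cvs.scale_sum_right cscale_cscale)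
qed

lemma plin_single: "plin g (Poly_Mapping.single k c) = c *\<^sub>C g k"
  by (subst plin_superset[of "{k}"]) auto

lemma cscale_free_algebra: "c *\<^sub>C p = Poly_Mapping.single 0 c * p" for p :: "'g free_algebra"
proof (induction p rule: poly_mapping_add_induct)
  case (single k d)
  have "c *\<^sub>C Poly_Mapping.single k d = Poly_Mapping.single k (c * d)"
    by (rule poly_mapping_eqI) (simp add: cscale_lookup lookup_single when_def)
  then show ?case by (simp add: mult_single)
qed (simp_all add: distrib_left cscale_add_right)

lemma single_0_commute: "Poly_Mapping.single 0 c * p = p * Poly_Mapping.single 0 c" for p :: "'g free_algebra"
  by (induction p rule: poly_mapping_add_induct)
    (simp_all add: mult_single mult.commute distrib_left distrib_right)

lemma cscale_mult_left: "(c *\<^sub>C x) * y = c *\<^sub>C (x * y)" for x y :: "'g::complex_lie_algebra uea"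
  by transfer (simp add: cscale_free_algebra mult.assoc uea_ideal.zero)

lemma cscale_mult_right: "x * (c *\<^sub>C y) = c *\<^sub>C (x * y)" for x y :: "'g::complex_lie_algebra uea"
  by transfer
    (metis (no_types, lifting) cscale_free_algebra diff_self mult.assoc single_0_commute uea_ideal.zero)

lemma clinear_mult_left: "clinear (\<lambda>y. x * y)" for x :: "'g::complex_lie_algebra uea"
  by (rule clinearI) (simp_all add: distrib_left cscale_mult_right)

lemma clinear_mult_right: "clinear (\<lambda>y. y * x)" for x :: "'g::complex_lie_algebra uea"
  by (rule clinearI) (simp_all add: distrib_right cscale_mult_left)

lemma uea_inj_add: "uea_inj (x + y) = uea_inj x + uea_inj y"
  by transfer (use uea_ideal.add_rel in \<open>simp add: diff_diff_add\<close>)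

lemma uea_inj_scale: "uea_inj (c *\<^sub>C x) = c *\<^sub>C uea_inj x"
  by transfer (rule uea_ideal.scale_rel)

lemma uea_inj_lie: "uea_inj (lie x y) = uea_inj x * uea_inj y - uea_inj y * uea_inj x"
proof -
  have "uea_inj x * uea_inj y - uea_inj y * uea_inj x - uea_inj (lie x y) = 0"
    by transfer (use uea_ideal.lie_rel in simp)
  then show ?thesis by simp
qed

lemma clinear_uea_inj: "clinear uea_inj"
  by (rule clinearI) (rule uea_inj_add uea_inj_scale)+

definition uword :: "'g::complex_lie_algebra list \<Rightarrow> 'g uea" where
  "uword xs = prod_list (map uea_inj xs)"

lemma uword_simps [simp]: "uword [] = 1" "uword (x # xs) = uea_inj x * uword xs"
  "uword (xs @ ys) = uword xs * uword ys"
  by (simp_all add: uword_def)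

lemma abs_uea_single: "abs_uea (Poly_Mapping.single (FM xs) c) = c *\<^sub>C uword xs"
proof (induction xs arbitrary: c)
  case Nil
  have "Poly_Mapping.single (FM []) c = c *\<^sub>C (1 :: 'a free_algebra)"
    by (simp add: cscale_free_algebra zero_free_monoid_def)
  then show ?case by (simp add: one_uea.abs_eq cscale_uea.abs_eq)
next
  case (Cons x xs)
  have "Poly_Mapping.single (FM (x # xs)) c = fa_gen x * Poly_Mapping.single (FM xs) c"
    by (simp add: fa_gen_def mult_single)
  then have "abs_uea (Poly_Mapping.single (FM (x # xs)) c) = uea_inj x * abs_uea (Poly_Mapping.single (FM xs) c)"
    by (simp add: uea_inj.abs_eq times_uea.abs_eq)
  then show ?case by (simp add: Cons cscale_mult_right)
qed

lemma uea_cases: obtains p where "z = abs_uea p"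
  using Quotient3_abs_rep[OF Quotient3_uea] by metis

lemma span_uword: "cvs.span (range uword) = UNIV"
proof -
  have "abs_uea p \<in> cvs.span (range uword)" for p :: "'a free_algebra"
  proof (induction p rule: poly_mapping_add_induct)
    case zero
    then show ?case by (simp add: cvs.span_zero flip: zero_uea_def)
  next
    case (single k c)
    then show ?case
      by (cases k) (use cvs.span_scale[OF cvs.span_base[OF rangeI]] in \<open>simp add: abs_uea_single\<close>)
  next
    case (add p q)
    then show ?case by (simp add: cvs.span_add flip: plus_uea.abs_eq)
  qed
  then show ?thesis using uea_cases by (metis UNIV_eq_I)
qed

lemma uea_rep_abs: "rep_uea (abs_uea p) - p \<in> uea_ideal"
proof -
  have "abs_uea (rep_uea (abs_uea p)) = abs_uea p"
    by (rule Quotient3_abs_rep[OF Quotient3_uea])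
  then show ?thesis
    using Quotient3_rel[OF Quotient3_uea, of "rep_uea (abs_uea p)" p] by (simp add: uea_ideal.zero)
qed

subsection \<open>Subalgebras\<close>

lemma subspace_clinear_eq:
  "clinear f \<Longrightarrow> clinear g \<Longrightarrow> cvs.subspace {z. f z = g z}"
  by (rule cvs.subspaceI) (simp_all add: clinear_zero clinear_add clinear_scale)

lemma subspace_clinear_vimage:
  "clinear f \<Longrightarrow> cvs.subspace T \<Longrightarrow> cvs.subspace {z. f z \<in> T}"
  by (rule cvs.subspaceI) (simp_all add: clinear_zero clinear_add clinear_scale
      cvs.subspace_0 cvs.subspace_add cvs.subspace_scale)

lemma U_uword: "U L = cvs.span (uword ` {xs. set xs \<subseteq> L})"
  by (simp add: U_def uword_def image_Collect)

lemma subspace_U: "cvs.subspace (U L)"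
  by (simp add: U_def cvs.subspace_span)

lemma U_one: "1 \<in> U L"
  unfolding U_uword by (rule cvs.span_base) (rule image_eqI[of _ _ "[]"], auto)

lemma U_inj: "x \<in> L \<Longrightarrow> uea_inj x \<in> U L"
  unfolding U_uword by (rule cvs.span_base) (rule image_eqI[of _ _ "[x]"], auto)

lemma U_UNIV: "U UNIV = UNIV"
  by (simp add: U_uword span_uword)

lemma U_mono: "L \<subseteq> M \<Longrightarrow> U L \<subseteq> U M"
  unfolding U_uword by (rule cvs.span_mono) auto

lemma U_span_induct:
  assumes "z \<in> U L" "cvs.subspace {z. P z}" "\<And>xs. set xs \<subseteq> L \<Longrightarrow> P (uword xs)"
  shows "P z"
  using cvs.span_induct[of z "uword ` {xs. set xs \<subseteq> L}" P] assms by (auto simp: U_uword)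

lemma U_mult:
  assumes "x \<in> U L" "y \<in> U L"
  shows "x * y \<in> U L"
proof (rule U_span_induct[OF assms(1)])
  show "cvs.subspace {x. x * y \<in> U L}"
    by (rule subspace_clinear_vimage[OF clinear_mult_right subspace_U])
  fix xs assume xs: "set xs \<subseteq> L"
  show "uword xs * y \<in> U L"
  proof (rule U_span_induct[OF assms(2)])
    show "cvs.subspace {y. uword xs * y \<in> U L}"
      by (rule subspace_clinear_vimage[OF clinear_mult_left subspace_U])
    fix ys assume ys: "set ys \<subseteq> L"
    show "uword xs * uword ys \<in> U L"
      unfolding U_uword by (rule cvs.span_base) (rule image_eqI[of _ _ "xs @ ys"], use xs ys in auto)
  qed
qed

lemma U_words: "set xs \<subseteq> L \<Longrightarrow> uword xs \<in> U L"
  unfolding U_uword by (auto intro: cvs.span_base)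

lemma U_induct [consumes 1, case_names subspace one left]:
  assumes "z \<in> U L" "cvs.subspace {z. P z}" "P 1"
    "\<And>x z. x \<in> L \<Longrightarrow> z \<in> U L \<Longrightarrow> P z \<Longrightarrow> P (uea_inj x * z)"
  shows "P z"
proof (rule U_span_induct[OF assms(1,2)])
  show "P (uword xs)" if "set xs \<subseteq> L" for xs
    using that by (induction xs) (use assms(3,4) U_words in auto)
qed

lemma U_induct_right [consumes 1, case_names subspace one right]:
  assumes "z \<in> U L" "cvs.subspace {z. P z}" "P 1"
    "\<And>x z. x \<in> L \<Longrightarrow> z \<in> U L \<Longrightarrow> P z \<Longrightarrow> P (z * uea_inj x)"
  shows "P z"
proof (rule U_span_induct[OF assms(1,2)])
  show "P (uword xs)" if "set xs \<subseteq> L" for xs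
    using that by (induction xs rule: rev_induct) (use assms(3,4) U_words in auto)
qed

lemma uea_induct [case_names subspace one left]:
  assumes "cvs.subspace {z. P z}" "P 1" "\<And>x z. P z \<Longrightarrow> P (uea_inj x * z)"
  shows "P z"
  using U_induct[of z UNIV P] assms U_UNIV by auto

text \<open>The spanning half of a triangular decomposition. A letter x is moved to the right
  through v by x a = a x + [x, a]; the claim is made for all x in L at once because the bracket
  stays in L but need not lie in A or B.\<close>

lemma U_triangular:
  assumes sum: "\<And>x. x \<in> L \<Longrightarrow> \<exists>a\<in>A. \<exists>b\<in>B. x = a + b"
    and closed: "\<And>x a. x \<in> L \<Longrightarrow> a \<in> A \<Longrightarrow> lie x a \<in> L" and z: "z \<in> U L"
  shows "z \<in> cvs.span {v * b | v b. v \<in> U A \<and> b \<in> U B}" (is "_ \<in> ?T")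
proof -
  have T: "cvs.subspace ?T" by (rule cvs.subspace_span)
  have base: "v * b \<in> ?T" if "v \<in> U A" "b \<in> U B" for v b
    using that by (auto intro: cvs.span_base)
  have left: "v * z \<in> ?T" if "v \<in> U A" "z \<in> ?T" for v z
  proof (rule clinear_span_subset[OF clinear_mult_left _ T that(2)])
    fix u assume "u \<in> {v * b | v b. v \<in> U A \<and> b \<in> U B}"
    then obtain w b where "u = w * b" "w \<in> U A" "b \<in> U B" by blast
    then show "v * u \<in> ?T" using base[OF U_mult[OF that(1)]] by (simp flip: mult.assoc)
  qed
  have right: "z * b \<in> ?T" if "b \<in> U B" "z \<in> ?T" for b z
  proof (rule clinear_span_subset[OF clinear_mult_right _ T that(2)])
    fix u assume "u \<in> {v * b | v b. v \<in> U A \<and> b \<in> U B}"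
    then obtain w c where "u = w * c" "w \<in> U A" "c \<in> U B" by blast
    then show "u * b \<in> ?T" using base[OF _ U_mult[OF _ that(1)]] by (simp add: mult.assoc)
  qed
  have gen: "\<forall>x\<in>L. uea_inj x * v \<in> ?T" if "v \<in> U A" for v
    using that
  proof (induction rule: U_induct)
    case subspace
    have "{v. \<forall>x\<in>L. uea_inj x * v \<in> ?T} = (\<Inter>x\<in>L. {v. uea_inj x * v \<in> ?T})" by blast
    then show ?case
      using subspace_clinear_vimage[OF clinear_mult_left T] by (auto intro!: cvs.subspace_Inter)
  next
    case one
    show ?case
    proof
      fix x assume "x \<in> L"
      then obtain a b where "a \<in> A" "b \<in> B" "x = a + b" using sum by blast
      then show "uea_inj x * 1 \<in> ?T"
        using base[of "uea_inj a" 1] base[of 1 "uea_inj b"] U_inj[of a A] U_inj[of b B] U_one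
        by (auto simp: uea_inj_add intro!: cvs.span_add)
    qed
  next
    case (left a v)
    show ?case
    proof
      fix x assume x: "x \<in> L"
      have "uea_inj x * (uea_inj a * v) = uea_inj a * (uea_inj x * v) + uea_inj (lie x a) * v"
        by (simp add: uea_inj_lie algebra_simps)
      then show "uea_inj x * (uea_inj a * v) \<in> ?T"
        using left closed x \<open>\<And>v z. v \<in> U A \<Longrightarrow> z \<in> ?T \<Longrightarrow> v * z \<in> ?T\<close>[OF U_inj]
        by (auto intro!: cvs.span_add)
    qed
  qed
  show ?thesis
    using z
  proof (induction rule: U_induct)
    case subspace
    then show ?case using T by simp
  next
    case one
    then show ?case using base[OF U_one U_one] by simp
  next
    case (left x z)
    show ?case
      by (rule clinear_span_subset[OF clinear_mult_left _ T left(3)])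
        (use gen left(1) right in \<open>auto simp flip: mult.assoc\<close>)
  qed
qed

subsection \<open>The universal property\<close>

text \<open>The carrier is a subspace of a type, so that the linear maps on the Lie algebra can
  serve as a module.\<close>

locale lie_rep =
  fixes \<rho> :: "'g::complex_lie_algebra \<Rightarrow> 'v::complex_vspace \<Rightarrow> 'v" and S :: "'v set"
  assumes subspace_S: "cvs.subspace S"
    and closed: "v \<in> S \<Longrightarrow> \<rho> x v \<in> S"
    and add_right: "v \<in> S \<Longrightarrow> w \<in> S \<Longrightarrow> \<rho> x (v + w) = \<rho> x v + \<rho> x w"
    and scale_right: "v \<in> S \<Longrightarrow> \<rho> x (c *\<^sub>C v) = c *\<^sub>C \<rho> x v"
    and add_left: "v \<in> S \<Longrightarrow> \<rho> (x + y) v = \<rho> x v + \<rho> y v"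
    and scale_left: "v \<in> S \<Longrightarrow> \<rho> (c *\<^sub>C x) v = c *\<^sub>C \<rho> x v"
    and bracket: "v \<in> S \<Longrightarrow> \<rho> (lie x y) v = \<rho> x (\<rho> y v) - \<rho> y (\<rho> x v)"
begin

fun letters :: "'g free_monoid \<Rightarrow> 'g list" where "letters (FM xs) = xs"

lemma letters_add: "letters (a + b) = letters a @ letters b"
  by (cases a; cases b) simp

lemma foldr_closed: "v \<in> S \<Longrightarrow> foldr \<rho> xs v \<in> S"
  by (induction xs) (auto simp: closed)

lemma foldr_add: "v \<in> S \<Longrightarrow> w \<in> S \<Longrightarrow> foldr \<rho> xs (v + w) = foldr \<rho> xs v + foldr \<rho> xs w"
  by (induction xs) (auto simp: add_right foldr_closed)

lemma foldr_scale: "v \<in> S \<Longrightarrow> foldr \<rho> xs (c *\<^sub>C v) = c *\<^sub>C foldr \<rho> xs v"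
  by (induction xs) (auto simp: scale_right foldr_closed)

definition fa_act :: "'g free_algebra \<Rightarrow> 'v \<Rightarrow> 'v" where
  "fa_act p v = plin (\<lambda>k. foldr \<rho> (letters k) v) p"

lemma clinear_fa_act: "clinear (\<lambda>p. fa_act p v)"
  unfolding fa_act_def by (rule clinear_plin)

lemmas fa_act_add = clinear_add[OF clinear_fa_act] and fa_act_zero = clinear_zero[OF clinear_fa_act]
  and fa_act_diff = clinear_diff[OF clinear_fa_act] and fa_act_scale = clinear_scale[OF clinear_fa_act]

lemma fa_act_single: "fa_act (Poly_Mapping.single k c) v = c *\<^sub>C foldr \<rho> (letters k) v"
  by (simp add: fa_act_def plin_single)

lemma fa_act_closed: "v \<in> S \<Longrightarrow> fa_act p v \<in> S"
  unfolding fa_act_def plin_def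
  by (intro cvs.subspace_sum[OF subspace_S] cvs.subspace_scale[OF subspace_S] foldr_closed)

lemma fa_act_add_right: "v \<in> S \<Longrightarrow> w \<in> S \<Longrightarrow> fa_act p (v + w) = fa_act p v + fa_act p w"
  by (simp add: fa_act_def plin_def foldr_add cvs.scale_right_distrib sum.distrib)

lemma fa_act_scale_right: "v \<in> S \<Longrightarrow> fa_act p (c *\<^sub>C v) = c *\<^sub>C fa_act p v"
  by (simp add: fa_act_def plin_def foldr_scale cvs.scale_sum_right cscale_cscale mult.commute)

lemma fa_act_zero_right: "fa_act p 0 = 0"
  using fa_act_scale_right[of 0 p 0] cvs.subspace_0[OF subspace_S] by simp

lemma fa_act_mult: "v \<in> S \<Longrightarrow> fa_act (p * q) v = fa_act p (fa_act q v)"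
proof (induction p rule: poly_mapping_add_induct)
  case (single a c)
  then show ?case
  proof (induction q rule: poly_mapping_add_induct)
    case (single b d)
    then show ?case
      by (simp add: mult_single fa_act_single letters_add foldr_scale foldr_closed cscale_cscale)
  qed (simp_all add: fa_act_zero fa_act_zero_right distrib_left fa_act_add fa_act_add_right fa_act_closed)
qed (simp_all add: fa_act_zero distrib_right fa_act_add)

lemma fa_act_gen: "fa_act (fa_gen x) v = \<rho> x v"
  by (simp add: fa_gen_def fa_act_single cscale_one)

text \<open>Each generating relation acts as 0 by one of the axioms of a representation. The vector
  is arbitrary in the induction because a right factor changes it.\<close>

lemma fa_act_ideal: "p \<in> uea_ideal \<Longrightarrow> v \<in> S \<Longrightarrow> fa_act p v = 0"
  by (induction arbitrary: v rule: uea_ideal.induct)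
    (simp_all add: fa_act_diff fa_act_gen fa_act_scale fa_act_mult fa_act_add fa_act_zero
      fa_act_zero_right fa_act_closed add_left scale_left bracket)

definition act :: "'g uea \<Rightarrow> 'v \<Rightarrow> 'v" where "act z v = fa_act (rep_uea z) v"

lemma act_abs: "v \<in> S \<Longrightarrow> act (abs_uea p) v = fa_act p v"
  using fa_act_ideal[OF uea_rep_abs, of v p] by (simp add: act_def fa_act_diff)

lemma act_closed: "v \<in> S \<Longrightarrow> act z v \<in> S"
  by (simp add: act_def fa_act_closed)

lemma act_add: "v \<in> S \<Longrightarrow> act (x + y) v = act x v + act y v"
  by (cases x rule: uea_cases; cases y rule: uea_cases) (simp add: plus_uea.abs_eq act_abs fa_act_add)

lemma act_scale: "v \<in> S \<Longrightarrow> act (c *\<^sub>C x) v = c *\<^sub>C act x v"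
  by (cases x rule: uea_cases) (simp add: cscale_uea.abs_eq act_abs fa_act_scale)

lemma clinear_act: "v \<in> S \<Longrightarrow> clinear (\<lambda>z. act z v)"
  by (rule clinearI) (simp_all add: act_add act_scale)

lemma act_one: "v \<in> S \<Longrightarrow> act 1 v = v"
  using act_abs[of v "1"] fa_act_single[of 0 1 v]
  by (simp add: one_uea.abs_eq zero_free_monoid_def cscale_one flip: single_one)

lemma act_inj: "v \<in> S \<Longrightarrow> act (uea_inj x) v = \<rho> x v"
  by (simp add: uea_inj.abs_eq act_abs fa_act_gen)

lemma act_mult: "v \<in> S \<Longrightarrow> act (x * y) v = act x (act y v)"
  by (cases x rule: uea_cases; cases y rule: uea_cases) (simp add: times_uea.abs_eq act_abs fa_act_mult fa_act_closed)

lemma act_scale_right: "v \<in> S \<Longrightarrow> act x (c *\<^sub>C v) = c *\<^sub>C act x v"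
  by (simp add: act_def fa_act_scale_right)

end

subsection \<open>Characters, counit and antipode\<close>

lemma U_character_unique:
  assumes "U_character L \<chi>" "U_character L \<psi>" "\<And>x. x \<in> L \<Longrightarrow> \<chi> (uea_inj x) = \<psi> (uea_inj x)"
  shows "\<chi> = \<psi>"
proof
  have zero: "\<chi> 0 = 0" if "U_character L \<chi>" for \<chi> :: "'a uea \<Rightarrow> complex"
  proof -
    have "\<forall>c. \<chi> (c *\<^sub>C 1) = c * \<chi> 1"
      using that U_one unfolding U_character_def by blast
    from this[rule_format, of 0] show ?thesis by simp
  qed
  fix z show "\<chi> z = \<psi> z"
  proof (cases "z \<in> U L")
    case True
    \<comment> \<open>Membership in \<open>U L\<close> is carried along because the characters are
      additive and multiplicative only there.\<close>
    then have "z \<in> U L \<and> \<chi> z = \<psi> z"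
    proof (induction rule: U_induct)
      case subspace
      then show ?case
        using assms(1,2) zero[OF assms(1)] zero[OF assms(2)]
        by (auto intro!: cvs.subspaceI simp: U_character_def cvs.subspace_0[OF subspace_U]
            cvs.subspace_add[OF subspace_U] cvs.subspace_scale[OF subspace_U])
    next
      case (left x z)
      then show ?case using assms U_inj[of x L] U_mult[of "uea_inj x" L z] by (simp add: U_character_def)
    qed (use assms U_one in \<open>auto simp: U_character_def\<close>)
    then show ?thesis by blast
  qed (use assms in \<open>auto simp: U_character_def\<close>)
qed

lemma extend_character_eq:
  assumes "U_character L \<chi>" "\<And>x. x \<in> L \<Longrightarrow> \<chi> (uea_inj x) = \<phi> x"
  shows "extend_character L \<phi> = \<chi>"
  unfolding extend_character_def
proof (rule the_equality)
  fix \<psi> assume "U_character L \<psi> \<and> (\<forall>x\<in>L. \<psi> (uea_inj x) = \<phi> x)"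
  then show "\<psi> = \<chi>" using assms by (intro U_character_unique[of L]) auto
qed (use assms in auto)

lemma U_character_restrict:
  assumes "U_character L \<chi>" "M \<subseteq> L"
  shows "U_character M (\<lambda>z. if z \<in> U M then \<chi> z else 0)"
  using assms(1) U_mono[OF assms(2)] U_one[of M] U_mult[of _ M] cvs.subspace_add[OF subspace_U[of M]]
    cvs.subspace_scale[OF subspace_U[of M]]
  unfolding U_character_def by (simp add: subset_iff)

text \<open>Existence comes from the trivial representation on the complex numbers, evaluated at
  1.\<close>

lemma counit_character: "U_character UNIV (counit :: 'g::complex_lie_algebra uea \<Rightarrow> complex)"
  and counit_inj: "counit (uea_inj (x :: 'g)) = 0"
proof -
  interpret lie_rep "\<lambda>(_ :: 'g) _. 0" "UNIV :: complex set"
    by unfold_locales simp_all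
  have lin: "act z c = c * act z 1" for z c
    using act_scale_right[of 1 z c] by simp
  have "U_character UNIV (\<lambda>z. act z 1)"
    by (simp add: U_character_def U_UNIV act_one act_add act_scale act_mult lin[of _ "act _ 1"])
  moreover have "act (uea_inj x) 1 = 0" for x by (simp add: act_inj)
  ultimately have eq: "counit = (\<lambda>z. act z 1)"
    unfolding counit_def by (intro extend_character_eq)
  then show "U_character UNIV (counit :: 'g::complex_lie_algebra uea \<Rightarrow> complex)"
    "counit (uea_inj (x :: 'g)) = 0"
    using \<open>U_character UNIV (\<lambda>z. act z 1)\<close> fun_cong[OF eq, of "uea_inj x"]
    by (simp_all add: eq act_inj)
qed

lemma counit_one [simp]: "counit 1 = 1"
  and counit_add: "counit (x + y) = counit x + counit y"
  and counit_mult: "counit (x * y) = counit x * counit y"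
  and counit_scale: "counit (c *\<^sub>C x) = c * counit x"
  using counit_character by (auto simp: U_character_def U_UNIV)

lemma clinear_counit: "clinear counit"
  by (rule clinearI) (simp_all add: counit_add counit_scale)

text \<open>Right multiplication by - x is a representation on the enveloping algebra, and the
  antipode of z is the image of 1 under z.\<close>

lemma antipode_props:
  "clinear (antipode :: 'g::complex_lie_algebra uea \<Rightarrow> 'g uea) \<and> antipode (1 :: 'g uea) = 1 \<and>
   (\<forall>x y :: 'g uea. antipode (x * y) = antipode y * antipode x) \<and>
   (\<forall>x :: 'g. antipode (uea_inj x) = - uea_inj x)"
proof -
  interpret lie_rep "\<lambda>x (z :: 'g uea). - (z * uea_inj x)" UNIV
    by unfold_locales
      (simp_all add: distrib_right distrib_left cscale_mult_left cscale_mult_right uea_inj_add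
        uea_inj_scale uea_inj_lie algebra_simps)
  let ?S = "\<lambda>z. act z 1"
  \<comment> \<open>The action commutes with left multiplications, hence is right multiplication by
    the image of 1; antimultiplicativity follows.\<close>
  have w: "act z w = w * act z 1" for z w
  proof (induction z rule: uea_induct)
    case subspace
    show ?case
      by (rule subspace_clinear_eq[OF clinear_act clinear_compose[OF clinear_mult_left clinear_act]]) auto
  next
    case (left x z)
    then show ?case by (simp add: act_mult act_inj mult.assoc)
  qed (simp add: act_one)
  have "?S (x * y) = ?S y * ?S x" for x y
    using w[of x "act y 1"] by (simp add: act_mult)
  then have S: "clinear ?S" "?S 1 = 1" "\<And>x y. ?S (x * y) = ?S y * ?S x" "\<And>x. ?S (uea_inj x) = - uea_inj x"
    by (simp_all add: clinear_act act_one act_inj)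
  have "\<exists>!S. clinear S \<and> S 1 = 1 \<and> (\<forall>x y. S (x * y) = S y * S x) \<and> (\<forall>x. S (uea_inj x) = - uea_inj (x::'g))"
  proof (rule ex1I[of _ ?S])
    fix T assume T: "clinear T \<and> T 1 = 1 \<and> (\<forall>x y. T (x * y) = T y * T x) \<and> (\<forall>x. T (uea_inj x) = - uea_inj (x::'g))"
    show "T = ?S"
    proof
      fix z show "T z = ?S z"
      proof (induction z rule: uea_induct)
        case subspace
        then show ?case using T S by (intro subspace_clinear_eq) auto
      qed (use T S in auto)
    qed
  qed (use S in auto)
  from theI'[OF this] show ?thesis unfolding antipode_def .
qed

lemma clinear_antipode: "clinear antipode" and antipode_one [simp]: "antipode 1 = 1"
  and antipode_mult: "antipode (x * y) = antipode y * antipode x"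
  and antipode_inj: "antipode (uea_inj a) = - uea_inj a"
  using antipode_props by auto

lemma antipode_antipode [simp]: "antipode (antipode z) = z"
proof (induction z rule: uea_induct)
  case subspace
  show ?case
    by (rule subspace_clinear_eq[OF clinear_compose[OF clinear_antipode clinear_antipode]])
      (rule clinearI, simp_all)
qed (simp_all add: antipode_mult antipode_inj clinear_minus[OF clinear_antipode])

section \<open>Generalized Verma modules\<close>

instantiation "fun" :: (type, complex_vspace) complex_vspace
begin
definition cscale_fun :: "complex \<Rightarrow> ('a \<Rightarrow> 'b) \<Rightarrow> 'a \<Rightarrow> 'b" where "cscale_fun c f = (\<lambda>x. c *\<^sub>C f x)"
instance
  by standard (auto simp: cscale_fun_def cscale_add_right cscale_add_left cscale_cscale cscale_one)
end

lemma cscale_fun_apply [simp]: "(c *\<^sub>C f) x = c *\<^sub>C f x"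
  by (simp add: cscale_fun_def)

text \<open>
  The module induced from the character \<open>\<chi>\<close> of \<open>B\<close> is constructed on \<open>U A\<close> without recourse to the
  Poincare-Birkhoff-Witt theorem: linear maps \<open>\<psi>\<close> from the Lie algebra to its enveloping algebra
  form a module under \<open>(a \<psi>) x = a * \<psi> x + \<psi> [x, a]\<close>, and for \<open>\<tau> (a + b) = a + \<chi> b\<close> the maps
  \<open>R x z = (z \<tau>) x\<close> are a representation on the whole enveloping algebra with \<open>R a v = a * v\<close>
  for \<open>v \<in> U A\<close> and \<open>R b 1 = \<chi> b\<close>.
\<close>

locale lie_split =
  fixes A B :: "'g::complex_lie_algebra set" and \<chi> :: "'g \<Rightarrow> complex"
  assumes subspace_A: "cvs.subspace A" and subspace_B: "cvs.subspace B"
    and disjoint: "x \<in> A \<Longrightarrow> x \<in> B \<Longrightarrow> x = 0" and sum: "\<exists>a\<in>A. \<exists>b\<in>B. x = a + b"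
    and lie_A: "x \<in> A \<Longrightarrow> y \<in> A \<Longrightarrow> lie x y \<in> A" and lie_B: "x \<in> B \<Longrightarrow> y \<in> B \<Longrightarrow> lie x y \<in> B"
    and chi_add: "x \<in> B \<Longrightarrow> y \<in> B \<Longrightarrow> \<chi> (x + y) = \<chi> x + \<chi> y"
    and chi_scale: "x \<in> B \<Longrightarrow> \<chi> (c *\<^sub>C x) = c * \<chi> x"
    and chi_lie: "x \<in> B \<Longrightarrow> y \<in> B \<Longrightarrow> \<chi> (lie x y) = 0"
begin

definition "pa x = (THE a. a \<in> A \<and> x - a \<in> B)"
definition "pb x = x - pa x"

lemma pa_unique:
  assumes "a \<in> A" "x - a \<in> B"
  shows "pa x = a"
  unfolding pa_def
proof (rule the_equality)
  fix a' assume a': "a' \<in> A \<and> x - a' \<in> B"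
  then have "(x - a) - (x - a') \<in> B" "a' - a \<in> A"
    using assms cvs.subspace_diff[OF subspace_A] cvs.subspace_diff[OF subspace_B] by blast+
  then have "a' - a = 0" by (intro disjoint) auto
  then show "a' = a" by simp
qed (use assms in auto)

lemma pa_in: "pa x \<in> A" and pb_in: "pb x \<in> B"
proof -
  obtain a b where "a \<in> A" "b \<in> B" "x = a + b" using sum by blast
  moreover from this have "pa x = a" by (intro pa_unique) auto
  ultimately show "pa x \<in> A" "pb x \<in> B" by (auto simp: pb_def)
qed

lemma split: "x = pa x + pb x"
  by (simp add: pb_def)

lemma pa_A: "x \<in> A \<Longrightarrow> pa x = x"
  by (rule pa_unique) (auto simp: cvs.subspace_0[OF subspace_B])

lemma pa_B: "x \<in> B \<Longrightarrow> pa x = 0"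
  by (rule pa_unique) (auto simp: cvs.subspace_0[OF subspace_A])

lemma pb_A: "x \<in> A \<Longrightarrow> pb x = 0" and pb_B: "x \<in> B \<Longrightarrow> pb x = x"
  by (simp_all add: pb_def pa_A pa_B)

lemma pa_add: "pa (x + y) = pa x + pa y"
proof (rule pa_unique)
  show "x + y - (pa x + pa y) \<in> B"
    using cvs.subspace_add[OF subspace_B pb_in[of x] pb_in[of y]] by (simp add: pb_def algebra_simps)
qed (use cvs.subspace_add[OF subspace_A] pa_in in auto)

lemma pa_scale: "pa (c *\<^sub>C x) = c *\<^sub>C pa x"
proof (rule pa_unique)
  show "c *\<^sub>C x - c *\<^sub>C pa x \<in> B"
    using cvs.subspace_scale[OF subspace_B pb_in[of x]] by (simp add: pb_def cvs.scale_right_diff_distrib)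
qed (use cvs.subspace_scale[OF subspace_A] pa_in in auto)

lemma pb_add: "pb (x + y) = pb x + pb y" and pb_scale: "pb (c *\<^sub>C x) = c *\<^sub>C pb x"
  by (simp_all add: pb_def pa_add pa_scale cvs.scale_right_diff_distrib)

definition "\<tau> x = uea_inj (pa x) + \<chi> (pb x) *\<^sub>C 1"

lemma clinear_\<tau>: "clinear \<tau>"
  by (rule clinearI)
    (simp_all add: \<tau>_def pa_add pb_add pa_scale pb_scale uea_inj_add uea_inj_scale chi_add chi_scale pb_in
      cscale_add_right cscale_add_left cscale_cscale)

sublocale hom: lie_rep "\<lambda>(a::'g) (\<psi> :: 'g \<Rightarrow> 'g uea) x. uea_inj a * \<psi> x + \<psi> (lie x a)" "{\<psi>. clinear \<psi>}"
proof
  show "cvs.subspace {\<psi> :: 'g \<Rightarrow> 'g uea. clinear \<psi>}"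
    by (rule cvs.subspaceI)
      (auto intro!: clinearI simp: clinear_add clinear_scale cscale_add_right cscale_cscale mult.commute algebra_simps)
next
  fix v :: "'g \<Rightarrow> 'g uea" and x y assume v: "v \<in> {\<psi>. clinear \<psi>}"
  then have lin: "clinear v" by simp
  show "(\<lambda>z. uea_inj x * v z + v (lie z x)) \<in> {\<psi>. clinear \<psi>}"
    by (auto intro!: clinearI simp: clinear_add[OF lin] clinear_scale[OF lin] lie_linear_simps
        cscale_add_right cscale_mult_right algebra_simps)
  show "(\<lambda>z. uea_inj (x + y) * v z + v (lie z (x + y))) =
      (\<lambda>z. uea_inj x * v z + v (lie z x)) + (\<lambda>z. uea_inj y * v z + v (lie z y))"
    by (auto simp: fun_eq_iff uea_inj_add clinear_add[OF lin] lie_linear_simps algebra_simps)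
  have j: "lie z (lie x y) = lie (lie z x) y - lie (lie z y) x" for z
    using lie_derivation[of z x y] lie_antisym[of x "lie z y"] by simp
  show "(\<lambda>z. uea_inj (lie x y) * v z + v (lie z (lie x y))) =
      (\<lambda>z. uea_inj x * (uea_inj y * v z + v (lie z y)) + (uea_inj y * v (lie z x) + v (lie (lie z x) y))) -
      (\<lambda>z. uea_inj y * (uea_inj x * v z + v (lie z x)) + (uea_inj x * v (lie z y) + v (lie (lie z y) x)))"
    by (auto simp: fun_eq_iff uea_inj_lie j clinear_diff[OF lin] algebra_simps)
next
  fix v :: "'g \<Rightarrow> 'g uea" and x c assume "v \<in> {\<psi>. clinear \<psi>}"
  then have lin: "clinear v" by simp
  show "(\<lambda>z. uea_inj (c *\<^sub>C x) * v z + v (lie z (c *\<^sub>C x))) = c *\<^sub>C (\<lambda>z. uea_inj x * v z + v (lie z x))"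
    by (auto simp: fun_eq_iff uea_inj_scale clinear_scale[OF lin] lie_linear_simps cscale_add_right cscale_mult_left)
qed (auto simp: fun_eq_iff algebra_simps cscale_add_right cscale_mult_right)

definition "R x z = hom.act z \<tau> x"

lemma clinear_R: "clinear (R x)"
  using hom.act_add[of \<tau>] hom.act_scale[of \<tau>] clinear_\<tau> by (intro clinearI) (simp_all add: R_def)

lemma clinear_R_left: "clinear (\<lambda>x. R x z)"
  using hom.act_closed[of \<tau> z] clinear_\<tau> by (simp add: R_def)

lemma R_one: "R x 1 = \<tau> x"
  using hom.act_one[of \<tau>] clinear_\<tau> by (simp add: R_def)

lemma R_left: "R x (uea_inj a * z) = uea_inj a * R x z + R (lie x a) z"
  using hom.act_mult[of \<tau>] hom.act_inj hom.act_closed[of \<tau> z] clinear_\<tau> by (simp add: R_def)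

text \<open>Induction on z with x and y general. The step is formal from \<open>R_left\<close> and
  the Jacobi identity, so everything rests on z = 1, where it matters that A and B are subalgebras
  and that \<chi> vanishes on brackets of B.\<close>

lemma R_bracket: "R (lie x y) z = R x (R y z) - R y (R x z)"
proof (induction z arbitrary: x y rule: uea_induct)
  case subspace
  have "{z. \<forall>x y. R (lie x y) z = R x (R y z) - R y (R x z)} =
    (\<Inter>x. \<Inter>y. {z. R (lie x y) z = R x (R y z) - R y (R x z)})" by blast
  moreover have "clinear (\<lambda>z. R x (R y z) - R y (R x z))" for x y
    by (rule clinearI)
      (simp_all add: clinear_add[OF clinear_R] clinear_scale[OF clinear_R] cvs.scale_right_diff_distrib)
  ultimately show ?case
    using subspace_clinear_eq[OF clinear_R] by (auto intro!: cvs.subspace_Inter)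
next
  case one
  \<comment> \<open>The mixed brackets of A with B are absorbed into \<open>lie x y\<close>; on the
    other two brackets \<tau> is explicit.\<close>
  have "lie x (pa y) - lie y (pa x) = lie x y + lie (pa x) (pa y) - lie (pb x) (pb y)"
  proof -
    have e1: "lie x y = lie (pa x) (pa y) + lie (pa x) (pb y) + lie (pb x) (pa y) + lie (pb x) (pb y)"
      by (subst (1) split[of x], subst (1) split[of y]) (simp add: lie_linear_simps)
    have e2: "lie x (pa y) = lie (pa x) (pa y) + lie (pb x) (pa y)"
      by (subst (1) split[of x]) (simp add: lie_linear_simps)
    have e3: "lie y (pa x) = - lie (pa x) (pa y) - lie (pa x) (pb y)"
      by (subst (1) split[of y]) (simp add: lie_linear_simps lie_antisym[of _ "pa x"])
    show ?thesis unfolding e1 e2 e3 by simp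
  qed
  from arg_cong[OF this, of \<tau>]
  have "\<tau> (lie x (pa y)) - \<tau> (lie y (pa x)) = \<tau> (lie x y) + \<tau> (lie (pa x) (pa y)) - \<tau> (lie (pb x) (pb y))"
    by (simp only: clinear_add[OF clinear_\<tau>] clinear_diff[OF clinear_\<tau>])
  also have "\<tau> (lie (pb x) (pb y)) = 0"
    by (simp add: \<tau>_def pa_B pb_B lie_B pb_in chi_lie clinear_zero[OF clinear_uea_inj])
  also have "\<tau> (lie (pa x) (pa y)) = uea_inj (lie (pa x) (pa y))"
    using chi_scale[of 0 0] cvs.subspace_0[OF subspace_B]
    by (simp add: \<tau>_def pa_A pb_A lie_A pa_in)
  finally have *: "\<tau> (lie x (pa y)) - \<tau> (lie y (pa x)) = \<tau> (lie x y) + uea_inj (lie (pa x) (pa y))" by simp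
  have RR: "R x (R y 1) = uea_inj (pa y) * \<tau> x + \<tau> (lie x (pa y)) + \<chi> (pb y) *\<^sub>C \<tau> x" for x y
  proof -
    have "R y 1 = uea_inj (pa y) * 1 + \<chi> (pb y) *\<^sub>C 1" by (simp add: R_one \<tau>_def)
    then show ?thesis
      by (simp only: clinear_add[OF clinear_R] clinear_scale[OF clinear_R] R_left) (simp add: R_one)
  qed
  have "R x (R y 1) - R y (R x 1) = uea_inj (pa y) * uea_inj (pa x) - uea_inj (pa x) * uea_inj (pa y)
      + (\<tau> (lie x (pa y)) - \<tau> (lie y (pa x)))"
    unfolding RR
    by (simp add: \<tau>_def[of x] \<tau>_def[of y] algebra_simps cscale_add_right cscale_mult_left cscale_mult_right
        cscale_cscale)
  also have "\<dots> = R (lie x y) 1" unfolding * by (simp add: uea_inj_lie R_one)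
  finally show ?case ..
next
  case (left a z)
  have d: "lie (lie x y) a = lie x (lie y a) - lie y (lie x a)"
    using lie_derivation[of x y a] by simp
  have "R x (R y (uea_inj a * z)) - R y (R x (uea_inj a * z)) =
      uea_inj a * (R x (R y z) - R y (R x z)) +
      (R (lie x a) (R y z) - R y (R (lie x a) z)) + (R x (R (lie y a) z) - R (lie y a) (R x z))"
    by (simp add: R_left clinear_add[OF clinear_R] algebra_simps)
  also have "\<dots> = uea_inj a * R (lie x y) z + R (lie (lie x a) y) z + R (lie x (lie y a)) z"
    by (simp only: left)
  also have "\<dots> = uea_inj a * R (lie x y) z + R (lie (lie x y) a) z"
    unfolding d by (simp add: clinear_diff[OF clinear_R_left] lie_antisym[of y "lie x a"]
        clinear_minus[OF clinear_R_left] clinear_add[OF clinear_R_left])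
  finally show ?case by (simp add: R_left)
qed

sublocale verma: lie_rep R UNIV
  by unfold_locales
    (auto simp: clinear_add[OF clinear_R] clinear_scale[OF clinear_R] clinear_add[OF clinear_R_left]
      clinear_scale[OF clinear_R_left] R_bracket)

text \<open>The action on the highest weight vector 1. It is the identity on \<open>U A\<close> and
  kills the left ideal generated by all b - \<chi> b, so it is the projection that belongs to the
  factorization into \<open>U A\<close> and \<open>U B\<close>.\<close>

definition "f z = verma.act z 1"

lemma clinear_f: "clinear f"
proof -
  have "f = (\<lambda>z. verma.act z 1)" by (simp add: fun_eq_iff f_def)
  then show ?thesis using verma.clinear_act by simp
qed

lemma R_A: "v \<in> U A \<Longrightarrow> a \<in> A \<Longrightarrow> R a v = uea_inj a * v"
proof (induction arbitrary: a rule: U_induct)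
  case subspace
  have "{v. \<forall>a. a \<in> A \<longrightarrow> R a v = uea_inj a * v} = (\<Inter>a\<in>A. {v. R a v = uea_inj a * v})" by blast
  then show ?case
    using subspace_clinear_eq[OF clinear_R clinear_mult_left] by (auto intro!: cvs.subspace_Inter)
next
  case one
  then show ?case
    using chi_scale[of 0 0] cvs.subspace_0[OF subspace_B] by (simp add: R_one \<tau>_def pa_A pb_A)
next
  case (left x z)
  then show ?case by (simp add: R_left lie_A uea_inj_lie algebra_simps)
qed

lemma R_U: "v \<in> U A \<Longrightarrow> R x v \<in> U A"
proof (induction arbitrary: x rule: U_induct)
  case subspace
  have "{v. \<forall>x. R x v \<in> U A} = (\<Inter>x. {v. R x v \<in> U A})" by blast
  then show ?case
    using subspace_clinear_vimage[OF clinear_R subspace_U] by (auto intro!: cvs.subspace_Inter)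
next
  case one
  then show ?case
    by (simp add: R_one \<tau>_def U_inj pa_in U_one cvs.subspace_add[OF subspace_U] cvs.subspace_scale[OF subspace_U])
next
  case (left y z)
  then show ?case by (simp add: R_left U_mult U_inj cvs.subspace_add[OF subspace_U])
qed

lemma act_U:
  assumes "z \<in> U A" and v: "v \<in> U A"
  shows "verma.act z v = z * v"
  using assms(1)
proof (induction z rule: U_induct)
  case (left x z)
  then show ?case by (simp add: verma.act_mult verma.act_inj R_A U_mult v mult.assoc)
qed (simp_all add: verma.act_one subspace_clinear_eq[OF verma.clinear_act clinear_mult_right])

lemma f_U: "v \<in> U A \<Longrightarrow> f v = v"
  using act_U[OF _ U_one] by (simp add: f_def)

lemma f_in_U: "f z \<in> U A"
proof (induction z rule: uea_induct)
  case subspace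
  show ?case by (rule subspace_clinear_vimage[OF clinear_f subspace_U])
qed (simp_all add: f_def verma.act_one U_one verma.act_mult verma.act_inj R_U)

lemma f_mult: "f (z * w) = verma.act z (f w)"
  by (simp add: f_def verma.act_mult)

text \<open>Left multiplication descends to the module, so the letters of a product can be applied
  one at a time, with a projection after each of them.\<close>

lemma f_mult_f: "f (z * f w) = f (z * w)"
  by (simp add: f_mult f_U f_in_U)

lemma f_mult_U: "v \<in> U A \<Longrightarrow> f (v * z) = v * f z"
  by (simp add: f_mult act_U f_in_U)

lemma f_mult_B: "b \<in> B \<Longrightarrow> f (z * uea_inj b) = \<chi> b *\<^sub>C f z"
proof -
  assume b: "b \<in> B"
  have "f (uea_inj b) = \<chi> b *\<^sub>C 1"
    using b by (simp add: f_def verma.act_inj R_one \<tau>_def pa_B pb_B clinear_zero[OF clinear_uea_inj])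
  then show ?thesis by (simp add: f_mult verma.act_scale_right) (simp add: f_def)
qed

text \<open>f maps \<open>U B\<close> to multiples of 1, and the counit reads off the
  multiple.\<close>

definition "\<chi>U z = (if z \<in> U B then counit (f z) else 0)"

lemma f_UB: "b \<in> U B \<Longrightarrow> f (z * b) = \<chi>U b *\<^sub>C f z"
proof -
  assume b: "b \<in> U B"
  \<comment> \<open>Existence of a scalar uniform in z is stable under sums and products; its value
    is identified afterwards from z = 1.\<close>
  have *: "\<exists>c. \<forall>z. f (z * b) = c *\<^sub>C f z"
    using b
  proof (induction rule: U_induct_right)
    case subspace
    show ?case
    proof (rule cvs.subspaceI)
      show "0 \<in> {b. \<exists>c. \<forall>z. f (z * b) = c *\<^sub>C f z}"
        using clinear_zero[OF clinear_f] by (auto intro: exI[of _ 0])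
      fix x y assume "x \<in> {b. \<exists>c. \<forall>z. f (z * b) = c *\<^sub>C f z}" "y \<in> {b. \<exists>c. \<forall>z. f (z * b) = c *\<^sub>C f z}"
      then obtain c d where "\<forall>z. f (z * x) = c *\<^sub>C f z" "\<forall>z. f (z * y) = d *\<^sub>C f z" by blast
      then have "\<forall>z. f (z * (x + y)) = (c + d) *\<^sub>C f z"
        by (simp add: distrib_left clinear_add[OF clinear_f] cscale_add_left)
      then show "x + y \<in> {b. \<exists>c. \<forall>z. f (z * b) = c *\<^sub>C f z}" by blast
    next
      fix k x assume "x \<in> {b. \<exists>c. \<forall>z. f (z * b) = c *\<^sub>C f z}"
      then obtain c where "\<forall>z. f (z * x) = c *\<^sub>C f z" by blast
      then have "\<forall>z. f (z * (k *\<^sub>C x)) = (k * c) *\<^sub>C f z"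
        by (simp add: cscale_mult_right clinear_scale[OF clinear_f] cscale_cscale)
      then show "k *\<^sub>C x \<in> {b. \<exists>c. \<forall>z. f (z * b) = c *\<^sub>C f z}" by blast
    qed
  next
    case one
    show ?case by (auto intro!: exI[of _ 1] simp: cscale_one)
  next
    case (right x b)
    then obtain c where "\<forall>z. f (z * b) = c *\<^sub>C f z" by blast
    then have "\<forall>z. f (z * (b * uea_inj x)) = (\<chi> x * c) *\<^sub>C f z"
      using right(1) by (simp add: f_mult_B cscale_cscale flip: mult.assoc)
    then show ?case by blast
  qed
  then obtain c where c: "\<And>z. f (z * b) = c *\<^sub>C f z" by blast
  have "f b = c *\<^sub>C 1" using c[of 1] f_U[OF U_one] by simp
  then have "\<chi>U b = c" using b by (simp add: \<chi>U_def counit_scale)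
  with c show ?thesis by simp
qed

text \<open>\<open>U B\<close> is defined inside the big enveloping algebra, so a character of B
  does not extend to it by a universal property of its own; the extension is read off from the
  action on the highest weight vector.\<close>

lemma \<chi>U_character: "U_character B \<chi>U" and \<chi>U_inj: "b \<in> B \<Longrightarrow> \<chi>U (uea_inj b) = \<chi> b"
proof -
  have f1: "f b = \<chi>U b *\<^sub>C 1" if "b \<in> U B" for b
    using f_UB[OF that, of 1] f_U[OF U_one] by simp
  have mult: "\<chi>U (x * y) = \<chi>U x * \<chi>U y" if "x \<in> U B" "y \<in> U B" for x y
    using f_UB[OF that(2), of x] f1[OF that(1)] that U_mult[OF that]
    by (simp add: \<chi>U_def[of "x * y"] counit_scale)
  show "U_character B \<chi>U"
    unfolding U_character_def
    using mult U_one[of B] f_U[OF U_one] cvs.subspace_add[OF subspace_U[of B]]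
      cvs.subspace_scale[OF subspace_U[of B]]
    by (auto simp: \<chi>U_def clinear_add[OF clinear_f] clinear_scale[OF clinear_f] counit_add counit_scale
        cscale_cscale)
  show "\<chi>U (uea_inj b) = \<chi> b" if "b \<in> B"
    using f_mult_B[OF that, of 1] f_U[OF U_one] U_inj[OF that] by (simp add: \<chi>U_def counit_scale)
qed

end

context triangular
begin

section \<open>The projections and the Shapovalov pairing\<close>

sublocale vm: lie_split nm bp chi
  by unfold_locales
    (use nm_bp_sum in \<open>auto simp: subspace_nm subspace_bp nm_bp_disjoint lie_nm lie_bp chi_add chi_scale chi_lie\<close>)

lemma extend_character_gl: "x \<in> U gl \<Longrightarrow> extend_character gl lam x = vm.\<chi>U x"
proof -
  have "extend_character gl lam = (\<lambda>z. if z \<in> U gl then vm.\<chi>U z else 0)"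
    using U_character_restrict[OF vm.\<chi>U_character gl_subset_bp] vm.\<chi>U_inj gl_subset_bp chi_gl
    by (intro extend_character_eq) (auto simp: U_inj)
  then show "x \<in> U gl \<Longrightarrow> ?thesis" by simp
qed

lemma chi_np_counit: "u \<in> U np \<Longrightarrow> vm.\<chi>U u = counit u"
proof -
  have "(\<lambda>z. if z \<in> U np then vm.\<chi>U z else 0) = (\<lambda>z. if z \<in> U np then counit z else 0)"
    using vm.\<chi>U_inj np_subset_bp chi_np
    by (intro U_character_unique[OF U_character_restrict[OF vm.\<chi>U_character np_subset_bp]
          U_character_restrict[OF counit_character]]) (auto simp: counit_inj U_inj)
  from fun_cong[OF this, of u] show "u \<in> U np \<Longrightarrow> ?thesis" by simp
qed

lemma chi_b_plus_eq: "chi_b_plus h lam Pos = vm.\<chi>U"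
  unfolding chi_b_plus_def
proof (rule the_equality)
  show "U_character bp vm.\<chi>U \<and> (\<forall>x\<in>gl. vm.\<chi>U (uea_inj x) = lam x) \<and> (\<forall>x\<in>np. vm.\<chi>U (uea_inj x) = 0)"
    using vm.\<chi>U_character vm.\<chi>U_inj gl_subset_bp np_subset_bp chi_gl chi_np by auto
  fix \<psi> assume psi: "U_character bp \<psi> \<and> (\<forall>x\<in>gl. \<psi> (uea_inj x) = lam x) \<and> (\<forall>x\<in>np. \<psi> (uea_inj x) = 0)"
  show "\<psi> = vm.\<chi>U"
  proof (rule U_character_unique[of bp])
    fix x assume "x \<in> bp"
    then obtain a b where x: "x = a + b" "a \<in> gl" "b \<in> np" unfolding b_plus_def by blast
    then have "uea_inj a \<in> U bp" "uea_inj b \<in> U bp"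
      using gl_subset_bp np_subset_bp U_inj by blast+
    then have "\<psi> (uea_inj x) = lam a" using psi x by (simp add: uea_inj_add U_character_def)
    also have "\<dots> = vm.\<chi>U (uea_inj x)" using vm.\<chi>U_inj[OF \<open>x \<in> bp\<close>] x chi by simp
    finally show "\<psi> (uea_inj x) = vm.\<chi>U (uea_inj x)" .
  qed (use psi vm.\<chi>U_character in auto)
qed

text \<open>The module map meets the defining equations of the projection, which settles existence.
  Uniqueness uses that products from \<open>U nm\<close> and \<open>U bp\<close> span, and inside
  \<open>U bp\<close> those from \<open>U gl\<close> and \<open>U np\<close>.\<close>

lemma pi_minus_eq: "pi_minus h lam Pos = vm.f"
  unfolding pi_minus_def
proof (rule the_equality)
  have *: "vm.f (v * x * u) = (extend_character gl lam x * counit u) *\<^sub>C v"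
    if "v \<in> U nm" "x \<in> U gl" "u \<in> U np" for v x u
  proof -
    have "x \<in> U bp" "u \<in> U bp" using that U_mono gl_subset_bp np_subset_bp by blast+
    then show ?thesis
      using that by (simp add: vm.f_UB vm.f_U chi_np_counit extend_character_gl cscale_cscale mult.commute)
  qed
  then show "clinear vm.f \<and> (\<forall>v\<in>U nm. \<forall>x\<in>U gl. \<forall>u\<in>U np.
      vm.f (v * x * u) = (extend_character gl lam x * counit u) *\<^sub>C v)"
    using vm.clinear_f by blast
  fix g assume g: "clinear g \<and> (\<forall>v\<in>U nm. \<forall>x\<in>U gl. \<forall>u\<in>U np.
      g (v * x * u) = (extend_character gl lam x * counit u) *\<^sub>C v)"
  have 1: "g (v * b) = vm.f (v * b)" if v: "v \<in> U nm" and b: "b \<in> U bp" for v b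
  proof (rule clinear_eq_on_span[where f = "\<lambda>b. g (v * b)" and g = "\<lambda>b. vm.f (v * b)" and x = b])
    show "b \<in> cvs.span {x * u | x u. x \<in> U gl \<and> u \<in> U np}"
    proof -
      have "\<exists>a\<in>gl. \<exists>b\<in>np. x = a + b" if "x \<in> bp" for x
        using that unfolding b_plus_def by blast
      moreover have "lie x a \<in> bp" if "x \<in> bp" "a \<in> gl" for x a
        using that gl_subset_bp lie_bp by blast
      ultimately show ?thesis using b by (rule U_triangular)
    qed
    show "clinear (\<lambda>b. g (v * b))" "clinear (\<lambda>b. vm.f (v * b))"
      using g vm.clinear_f clinear_mult_left by (auto intro: clinear_compose)
  qed (use g v * in \<open>auto simp flip: mult.assoc\<close>)
  show "g = vm.f"
  proof
    fix z
    have "z \<in> cvs.span {v * b | v b. v \<in> U nm \<and> b \<in> U bp}"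
      by (rule U_triangular[of UNIV]) (use nm_bp_sum U_UNIV in auto)
    then show "g z = vm.f z"
      by (rule clinear_eq_on_span[rotated 3]) (use g vm.clinear_f 1 in auto)
  qed
qed

text \<open>Changing the signs of lam and of the ordering exchanges the two nilpotent subalgebras
  and keeps the stabilizer, so the two defining conditions coincide.\<close>

lemma pi_plus_eq: "pi_plus h lam Pos = pi_minus h (- lam) (uminus ` Pos)"
proof -
  have "n_minus h (- lam) (uminus ` Pos) = np" "n_plus h (- lam) (uminus ` Pos) = nm"
    by (simp_all add: np_minus_lam nm_minus_lam nm_eq) (simp add: n_plus_def n_minus_def uminus_uminus_image)
  then show ?thesis
    unfolding pi_plus_def pi_minus_def gl_minus_lam
    by (intro arg_cong[where f = The] ext) (simp, blast)
qed

text \<open>The projection of the enveloping algebra onto \<open>U gl\<close>, followed by the character \<open>lam\<close>.\<close>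

definition "phi z = counit (vm.f z)"

lemma clinear_phi: "clinear phi"
proof -
  have "phi = (\<lambda>z. counit (vm.f z))" by (simp add: fun_eq_iff phi_def)
  then show ?thesis using clinear_compose[OF clinear_counit vm.clinear_f] by simp
qed

lemma phi_one: "phi 1 = 1"
  using vm.f_U[OF U_one] by (simp add: phi_def)

lemma phi_UB: "b \<in> U bp \<Longrightarrow> phi (z * b) = phi z * vm.\<chi>U b"
  by (simp add: phi_def vm.f_UB counit_scale)

lemma phi_gl_right: "x \<in> gl \<Longrightarrow> phi (z * uea_inj x) = lam x * phi z"
  using vm.f_mult_B[of x z] gl_subset_bp chi_gl by (auto simp: phi_def counit_scale)

lemma phi_np_right: "x \<in> np \<Longrightarrow> phi (z * uea_inj x) = 0"
  using vm.f_mult_B[of x z] np_subset_bp chi_np by (auto simp: phi_def clinear_zero[OF clinear_counit])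

lemma phi_U_left: "v \<in> U nm \<Longrightarrow> phi (v * z) = counit v * phi z"
  by (simp add: phi_def vm.f_mult_U counit_mult)

lemma phi_nm_left: "a \<in> nm \<Longrightarrow> phi (uea_inj a * z) = 0"
  by (simp add: phi_U_left U_inj counit_inj)

lemma phi_mult_f: "phi (z * vm.f w) = phi (z * w)"
  by (simp add: phi_def vm.f_mult_f)

lemma bracket_gl_U: "v \<in> U nm \<Longrightarrow> x \<in> gl \<Longrightarrow> uea_inj x * v - v * uea_inj x \<in> U nm"
proof (induction rule: U_induct)
  case subspace
  have "clinear (\<lambda>v. uea_inj x * v - v * uea_inj x)"
    by (rule clinearI) (simp_all add: algebra_simps cscale_mult_left cscale_mult_right cvs.scale_right_diff_distrib)
  from subspace_clinear_vimage[OF this subspace_U, of nm]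
  show ?case by (cases "x \<in> gl") (simp_all add: cvs.subspace_UNIV)
next
  case one
  then show ?case by (simp add: cvs.subspace_0[OF subspace_U])
next
  case (left y z)
  have "uea_inj x * (uea_inj y * z) - uea_inj y * z * uea_inj x =
      uea_inj (lie x y) * z + uea_inj y * (uea_inj x * z - z * uea_inj x)"
    by (simp add: uea_inj_lie algebra_simps)
  moreover have "lie x y \<in> nm"
    using lie_nm_gl[OF left(1,4)] lie_antisym[of x y] cvs.subspace_neg[OF subspace_nm] by simp
  ultimately show ?case
    using left by (simp add: cvs.subspace_add[OF subspace_U] U_mult U_inj)
qed

lemma f_gl_left:
  assumes "v \<in> U nm" "x \<in> gl"
  shows "vm.f (uea_inj x * v) = (uea_inj x * v - v * uea_inj x) + lam x *\<^sub>C v"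
proof -
  have "vm.f (uea_inj x * v) = vm.f (uea_inj x * v - v * uea_inj x) + vm.f (v * uea_inj x)"
    by (simp flip: clinear_add[OF vm.clinear_f])
  then show ?thesis
    using vm.f_U[OF bracket_gl_U[OF assms]] vm.f_mult_B[of x v] assms gl_subset_bp chi_gl[OF assms(2)]
    by (auto simp: vm.f_U)
qed

text \<open>Left and right multiplication by x differ on \<open>U nm\<close> by a commutator, which
  the counit kills; so \<open>phi\<close> transforms by lam on both sides.\<close>

lemma phi_gl_left: "x \<in> gl \<Longrightarrow> phi (uea_inj x * z) = lam x * phi z"
proof -
  assume x: "x \<in> gl"
  have "phi (uea_inj x * z) = phi (uea_inj x * vm.f z)" by (simp add: phi_mult_f)
  also have "\<dots> = counit ((uea_inj x * vm.f z - vm.f z * uea_inj x) + lam x *\<^sub>C vm.f z)"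
    by (simp add: phi_def f_gl_left[OF vm.f_in_U x])
  also have "\<dots> = lam x * counit (vm.f z)"
    by (simp add: counit_add clinear_diff[OF clinear_counit] counit_mult counit_inj counit_scale)
  finally show ?thesis by (simp add: phi_def)
qed

text \<open>The factorization into \<open>U nm\<close> and \<open>U bp\<close> reduces every element
  to letters that can be stripped off by these rules. The criterion serves to recognize
  \<open>phi\<close> in the functional of the exchanged data composed with the antipode.\<close>

lemma phi_unique:
  assumes "clinear \<psi>" "\<psi> 1 = 1" "\<And>a z. a \<in> nm \<Longrightarrow> \<psi> (uea_inj a * z) = 0"
    "\<And>x z. x \<in> gl \<Longrightarrow> \<psi> (z * uea_inj x) = lam x * \<psi> z" "\<And>x z. x \<in> np \<Longrightarrow> \<psi> (z * uea_inj x) = 0"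
  shows "\<psi> = phi"
proof
  fix z
  have lin: "clinear (\<lambda>z. \<psi> (w * z))" "clinear (\<lambda>z. phi (w * z))" for w
    by (rule clinear_compose[OF assms(1) clinear_mult_left] clinear_compose[OF clinear_phi clinear_mult_left])+
  have r: "\<psi> b = phi b" if "b \<in> U bp" for b
    using that
  proof (induction rule: U_induct_right)
    case subspace
    show ?case by (rule subspace_clinear_eq[OF assms(1) clinear_phi])
  next
    case (right x z)
    then obtain a b where x: "x = a + b" "a \<in> gl" "b \<in> np" unfolding b_plus_def by blast
    then show ?case
      using right assms(4,5) by (simp add: uea_inj_add distrib_left clinear_add[OF assms(1)]
          clinear_add[OF clinear_phi] phi_gl_right phi_np_right)
  qed (simp add: assms(2) phi_one)
  have l: "\<psi> (v * b) = phi (v * b)" if "v \<in> U nm" "b \<in> U bp" for v b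
    using that(1)
  proof (induction rule: U_induct)
    case subspace
    show ?case
      by (rule subspace_clinear_eq[OF clinear_compose[OF assms(1) clinear_mult_right]
            clinear_compose[OF clinear_phi clinear_mult_right]])
  qed (use r that assms(3) in \<open>simp_all add: mult.assoc phi_nm_left\<close>)
  have "z \<in> cvs.span {v * b | v b. v \<in> U nm \<and> b \<in> U bp}"
    by (rule U_triangular[of UNIV]) (use nm_bp_sum U_UNIV in auto)
  then show "\<psi> z = phi z"
    by (rule clinear_eq_on_span[rotated 3]) (use assms(1) clinear_phi l in auto)
qed

lemma chi_b_plus_props:
  "U_character bp (chi_b_plus h lam Pos)" "x \<in> gl \<Longrightarrow> chi_b_plus h lam Pos (uea_inj x) = lam x"
  "x \<in> np \<Longrightarrow> chi_b_plus h lam Pos (uea_inj x) = 0"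
  using vm.\<chi>U_character vm.\<chi>U_inj gl_subset_bp np_subset_bp chi_gl chi_np
  by (auto simp: chi_b_plus_eq)

lemma chi_b_minus_props:
  "U_character (b_minus h lam Pos) (chi_b_minus h lam Pos)"
  "x \<in> gl \<Longrightarrow> chi_b_minus h lam Pos (uea_inj x) = lam x"
  "x \<in> nm \<Longrightarrow> chi_b_minus h lam Pos (uea_inj x) = 0"
proof -
  have "chi_b_minus h lam Pos = chi_b_plus h lam (uminus ` Pos)"
    by (simp add: chi_b_minus_def chi_b_plus_def bm_eq nm_eq)
  then show "U_character (b_minus h lam Pos) (chi_b_minus h lam Pos)"
    "x \<in> gl \<Longrightarrow> chi_b_minus h lam Pos (uea_inj x) = lam x"
    "x \<in> nm \<Longrightarrow> chi_b_minus h lam Pos (uea_inj x) = 0"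
    using triangular.chi_b_plus_props[OF triangular_minus_Pos] by (simp_all add: bm_eq nm_eq)
qed

lemma nm_subset_bm: "nm \<subseteq> b_minus h lam Pos"
  using triangular.np_subset_bp[OF triangular_minus_Pos] by (simp add: nm_eq bm_eq)

lemma phi_Ubm: "r \<in> U (b_minus h lam Pos) \<Longrightarrow> phi (r * z) = chi_b_minus h lam Pos r * phi z"
proof -
  let ?b = "b_minus h lam Pos" and ?c = "chi_b_minus h lam Pos"
  have c: "?c 1 = 1" "\<And>x y. x \<in> U ?b \<Longrightarrow> y \<in> U ?b \<Longrightarrow> ?c (x + y) = ?c x + ?c y"
    "\<And>x y. x \<in> U ?b \<Longrightarrow> y \<in> U ?b \<Longrightarrow> ?c (x * y) = ?c x * ?c y"
    "\<And>k x. x \<in> U ?b \<Longrightarrow> ?c (k *\<^sub>C x) = k * ?c x"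
    using chi_b_minus_props(1) unfolding U_character_def by blast+
  have c0: "?c 0 = 0" using c(4)[OF U_one, of 0] by simp
  assume "r \<in> U ?b"
  then have "r \<in> U ?b \<and> (\<forall>z. phi (r * z) = ?c r * phi z)"
  proof (induction r rule: U_induct)
    case subspace
    show ?case
      by (rule cvs.subspaceI)
        (auto simp: c c0 clinear_zero[OF clinear_phi] clinear_add[OF clinear_phi] clinear_scale[OF clinear_phi]
          distrib_right cscale_mult_left cvs.subspace_0[OF subspace_U] cvs.subspace_add[OF subspace_U]
          cvs.subspace_scale[OF subspace_U])
  next
    case (left x z)
    then obtain a b where x: "x = a + b" "a \<in> gl" "b \<in> nm" unfolding b_minus_def by blast
    have a: "a \<in> ?b" "b \<in> ?b"
      using x nm_subset_bm cvs.subspace_0[OF subspace_nm] unfolding b_minus_def by force+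
    have "?c (uea_inj x) = lam a" "phi (uea_inj x * w) = lam a * phi w" for w
      using x a by (simp_all add: c U_inj uea_inj_add distrib_right clinear_add[OF clinear_phi]
          phi_gl_left phi_nm_left chi_b_minus_props(2,3))
    then show ?case
      using left U_inj[OF left(1)] by (simp add: c U_mult mult.assoc)
  qed (simp add: c U_one)
  then show ?thesis by blast
qed

lemma chi_b_minus_nm: "v \<in> U nm \<Longrightarrow> chi_b_minus h lam Pos v = counit v"
  using phi_Ubm[of v 1] phi_U_left[of v 1] U_mono[OF nm_subset_bm] by (auto simp: phi_one)

text \<open>The functional sending (a, x, b) to \<open>a * phi x * b\<close> vanishes on the
  relations, so at most one scalar is possible. Conversely, in a product of v in \<open>U nm\<close>
  and b in \<open>U bp\<close> both factors can be moved across the tensor signs, so the scalar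
  exists.\<close>

lemma shapovalov_eq: "shapovalov h lam Pos u v = phi (antipode u * v)"
proof -
  let ?A = "U (b_minus h lam Pos)" and ?B = "U bp"
  let ?R = "bimodule_tensor_relations ?A (chi_b_minus h lam Pos) ?B (chi_b_plus h lam Pos)"
  let ?e = "\<lambda>a x b. Poly_Mapping.single (a, x, b) (1 :: complex)"
  define \<Psi> where "\<Psi> = plin (\<lambda>(a, x, b). a * phi x * b)"
  have lin: "clinear \<Psi>" unfolding \<Psi>_def by (rule clinear_plin)
  have single: "\<Psi> (?e a x b) = a * phi x * b" for a x b
    by (simp add: \<Psi>_def plin_single)
  have 0: "\<Psi> r = 0" if "r \<in> ?R" for r
    using that unfolding bimodule_tensor_relations_def Let_def
    by (elim UnE CollectE exE conjE; hypsubst; simp add: clinear_add[OF lin] clinear_diff[OF lin] clinear_scale[OF lin] single phi_Ubm phi_UB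
        chi_b_plus_eq clinear_add[OF clinear_phi] clinear_scale[OF clinear_phi] algebra_simps)
  have zero: "\<Psi> r = 0" if "r \<in> cvs.span ?R" for r
    by (rule clinear_eq_on_span[OF lin _ _ that]) (auto intro: clinearI 0)
  have sub: "cvs.subspace (cvs.span ?R)" by (rule cvs.subspace_span)
  have rel: "r \<in> cvs.span ?R" if "r \<in> ?R" for r using that by (rule cvs.span_base)
  have addr: "?e 1 (x + y) 1 - ?e 1 x 1 - ?e 1 y 1 \<in> cvs.span ?R" for x y
  proof (rule rel)
    have "?e 1 (x + y) 1 - ?e 1 x 1 - ?e 1 y 1 \<in>
        {?e a (x + x') b - ?e a x b - ?e a x' b | a x x' b. True}"
      by blast
    then show "?e 1 (x + y) 1 - ?e 1 x 1 - ?e 1 y 1 \<in> ?R"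
      unfolding bimodule_tensor_relations_def Let_def by (intro UnI1[OF UnI1[OF UnI1[OF UnI1[OF UnI1[OF UnI1[OF UnI2]]]]]])
  qed
  have scaler: "?e 1 (c *\<^sub>C x) 1 - c *\<^sub>C ?e 1 x 1 \<in> cvs.span ?R" for x c
    by (rule rel) (unfold bimodule_tensor_relations_def Let_def, blast)
  have main: "?e 1 z 1 - phi z *\<^sub>C ?e 1 1 1 \<in> cvs.span ?R" for z
  proof -
    have "z \<in> cvs.span {v * b | v b. v \<in> U nm \<and> b \<in> ?B}"
      by (rule U_triangular[of UNIV]) (use nm_bp_sum U_UNIV in auto)
    then show ?thesis
    proof (induction rule: cvs.span_induct_alt)
      case base
      show ?case using scaler[of 0 0] by (simp add: clinear_zero[OF clinear_phi])
    next
      case (step c w z)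
      then obtain v b where w: "w = v * b" "v \<in> U nm" "b \<in> ?B" by blast
      then have v: "v \<in> ?A" using U_mono[OF nm_subset_bm] by blast
      let ?cv = "chi_b_minus h lam Pos v" and ?cb = "chi_b_plus h lam Pos b"
      have "?e (1 * ?cv) b 1 - ?e 1 (v * b) 1 \<in> ?R"
        unfolding bimodule_tensor_relations_def Let_def using v by blast
      moreover have "?e ?cv (1 * b) 1 - ?e ?cv 1 (?cb * 1) \<in> ?R"
        unfolding bimodule_tensor_relations_def Let_def using w by blast
      moreover have "?e (?cv * 1) 1 ?cb - ?cv *\<^sub>C ?e 1 1 ?cb \<in> ?R"
        unfolding bimodule_tensor_relations_def Let_def by blast
      moreover have "?e 1 1 (?cb * 1) - ?cb *\<^sub>C ?e 1 1 1 \<in> ?R"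
        unfolding bimodule_tensor_relations_def Let_def by blast
      \<comment> \<open>The terms telescope: v crosses to the left factor, b crosses to the right
        one, then both scalars are pulled out.\<close>
      ultimately have "- (?e ?cv b 1 - ?e 1 w 1) + (?e ?cv b 1 - ?e ?cv 1 ?cb)
          + (?e ?cv 1 ?cb - ?cv *\<^sub>C ?e 1 1 ?cb) + ?cv *\<^sub>C (?e 1 1 ?cb - ?cb *\<^sub>C ?e 1 1 1) \<in> cvs.span ?R"
        using w by (intro cvs.span_add cvs.span_neg cvs.span_scale rel) simp_all
      moreover have "phi w = ?cv * ?cb"
        using w by (simp add: phi_U_left chi_b_minus_nm chi_b_plus_eq phi_one phi_UB[of b 1, simplified])
      ultimately have ew: "?e 1 w 1 - phi w *\<^sub>C ?e 1 1 1 \<in> cvs.span ?R"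
        by (simp add: cvs.scale_right_diff_distrib cscale_cscale)
      have "(?e 1 (c *\<^sub>C w + z) 1 - ?e 1 (c *\<^sub>C w) 1 - ?e 1 z 1) + (?e 1 (c *\<^sub>C w) 1 - c *\<^sub>C ?e 1 w 1)
          + c *\<^sub>C (?e 1 w 1 - phi w *\<^sub>C ?e 1 1 1) + (?e 1 z 1 - phi z *\<^sub>C ?e 1 1 1) \<in> cvs.span ?R"
        by (intro cvs.span_add addr scaler cvs.span_scale ew step(2))
      then show ?case
        by (simp add: clinear_add[OF clinear_phi] clinear_scale[OF clinear_phi]
            cvs.scale_right_diff_distrib cvs.scale_left_distrib cscale_cscale diff_diff_add)
    qed
  qed
  have "(THE c. ?e 1 (antipode u * v) 1 - c *\<^sub>C ?e 1 1 1 \<in> cvs.span ?R) = phi (antipode u * v)"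
  proof (rule the_equality)
    show "?e 1 (antipode u * v) 1 - phi (antipode u * v) *\<^sub>C ?e 1 1 1 \<in> cvs.span ?R" by (rule main)
    fix c assume "?e 1 (antipode u * v) 1 - c *\<^sub>C ?e 1 1 1 \<in> cvs.span ?R"
    from zero[OF this] show "c = phi (antipode u * v)"
      by (simp add: clinear_diff[OF lin] clinear_scale[OF lin] single phi_one)
  qed
  then show ?thesis by (simp add: shapovalov_def)
qed

end

section \<open>Tensor products\<close>

lemma tensor_add_left: "(a + a') \<otimes>\<^sub>C b = a \<otimes>\<^sub>C b + a' \<otimes>\<^sub>C b"
proof -
  have "(a + a') \<otimes>\<^sub>C b - a \<otimes>\<^sub>C b - a' \<otimes>\<^sub>C b = 0"
    by transfer (simp, rule cvs.span_base, unfold ctensor_relations_def, blast)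
  then show ?thesis by (simp add: algebra_simps)
qed

lemma tensor_add_right: "a \<otimes>\<^sub>C (b + b') = a \<otimes>\<^sub>C b + a \<otimes>\<^sub>C b'"
proof -
  have "a \<otimes>\<^sub>C (b + b') - a \<otimes>\<^sub>C b - a \<otimes>\<^sub>C b' = 0"
    by transfer (simp, rule cvs.span_base, unfold ctensor_relations_def, blast)
  then show ?thesis by (simp add: algebra_simps)
qed

lemma single_cscale: "Poly_Mapping.single k c = c *\<^sub>C Poly_Mapping.single k (1 :: complex)"
  by (rule poly_mapping_eqI) (simp add: cscale_lookup lookup_single when_def)

lemma tensor_scale_left: "(c *\<^sub>C a) \<otimes>\<^sub>C b = c *\<^sub>C (a \<otimes>\<^sub>C b)"
  for a :: "'a::complex_vspace" and b :: "'b::complex_vspace"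
proof -
  have "Poly_Mapping.single (c *\<^sub>C a, b) 1 - Poly_Mapping.single (a, b) c \<in> cvs.span ctensor_relations"
    for a :: 'a and b :: 'b and c
    by (rule cvs.span_base, unfold ctensor_relations_def, blast)
  then have r: "Poly_Mapping.single (c *\<^sub>C a, b) 1 - c *\<^sub>C Poly_Mapping.single (a, b) 1 \<in> cvs.span ctensor_relations"
    for a :: 'a and b :: 'b and c
    by (simp only: flip: single_cscale)
  have "(c *\<^sub>C a) \<otimes>\<^sub>C b - c *\<^sub>C (a \<otimes>\<^sub>C b) = 0"
    by transfer (use r in simp)
  then show ?thesis by simp
qed

lemma tensor_scale_right: "a \<otimes>\<^sub>C (c *\<^sub>C b) = c *\<^sub>C (a \<otimes>\<^sub>C b)"
  for a :: "'a::complex_vspace" and b :: "'b::complex_vspace"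
proof -
  have "Poly_Mapping.single (a, c *\<^sub>C b) 1 - Poly_Mapping.single (a, b) c \<in> cvs.span ctensor_relations"
    for a :: 'a and b :: 'b and c
    by (rule cvs.span_base, unfold ctensor_relations_def, blast)
  then have r: "Poly_Mapping.single (a, c *\<^sub>C b) 1 - c *\<^sub>C Poly_Mapping.single (a, b) 1 \<in> cvs.span ctensor_relations"
    for a :: 'a and b :: 'b and c
    by (simp only: flip: single_cscale)
  have "a \<otimes>\<^sub>C (c *\<^sub>C b) - c *\<^sub>C (a \<otimes>\<^sub>C b) = 0"
    by transfer (use r in simp)
  then show ?thesis by simp
qed

lemma clinear_tensor_left: "clinear (\<lambda>a. a \<otimes>\<^sub>C b)" and clinear_tensor_right: "clinear (\<lambda>b. a \<otimes>\<^sub>C b)"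
  by (rule clinearI, simp_all add: tensor_add_left tensor_add_right tensor_scale_left tensor_scale_right)+

lemma abs_ctensor_plin: "abs_ctensor p = plin (\<lambda>(a, b). a \<otimes>\<^sub>C b) p"
proof (induction p rule: poly_mapping_add_induct)
  case zero
  show ?case by (simp add: clinear_zero[OF clinear_plin] flip: zero_ctensor_def)
next
  case (single k c)
  have "abs_ctensor (Poly_Mapping.single k c) = c *\<^sub>C abs_ctensor (Poly_Mapping.single k 1)"
    by (subst single_cscale) (simp add: cscale_ctensor.abs_eq)
  then show ?case by (cases k) (simp add: plin_single ctensor_pure.abs_eq)
next
  case (add p q)
  then show ?case by (simp add: clinear_add[OF clinear_plin] flip: plus_ctensor.abs_eq)
qed

lemma ctensor_cases: obtains p where "T = abs_ctensor p"
  using Quotient3_abs_rep[OF Quotient3_ctensor] by metis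

lemma tensor_linear_eqI:
  fixes S T :: "('a::complex_vspace, 'b::complex_vspace) ctensor \<Rightarrow> 'c::complex_vspace"
  assumes "clinear S" "clinear T" "\<And>a b. S (a \<otimes>\<^sub>C b) = T (a \<otimes>\<^sub>C b)"
  shows "S = T"
proof
  fix x :: "('a, 'b) ctensor"
  obtain p where p: "x = abs_ctensor p" by (rule ctensor_cases)
  show "S x = T x"
    unfolding p abs_ctensor_plin plin_def
    by (auto simp: clinear_sum[OF assms(1)] clinear_sum[OF assms(2)] clinear_scale[OF assms(1)]
        clinear_scale[OF assms(2)] assms(3) split: prod.split intro!: sum.cong)
qed

lemma tensor_universal:
  fixes \<beta> :: "'a::complex_vspace \<Rightarrow> 'b::complex_vspace \<Rightarrow> 'c::complex_vspace"
  assumes "\<And>b. clinear (\<lambda>a. \<beta> a b)" "\<And>a. clinear (\<beta> a)"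
  shows "\<exists>T. clinear T \<and> (\<forall>a b. T (a \<otimes>\<^sub>C b) = \<beta> a b)"
proof -
  let ?g = "\<lambda>(a, b). \<beta> a b"
  note lin = clinear_plin[of ?g]
  have rel: "plin ?g r = 0" if "r \<in> ctensor_relations" for r
    using that unfolding ctensor_relations_def
    by (elim UnE CollectE exE conjE; hypsubst;
        simp add: clinear_diff[OF lin] plin_single clinear_add[OF assms(1)] clinear_add[OF assms(2)]
          clinear_scale[OF assms(1)] clinear_scale[OF assms(2)] cscale_one)
  have zero: "plin ?g r = 0" if "r \<in> cvs.span ctensor_relations" for r
    by (rule clinear_eq_on_span[OF lin _ rel that]) (rule clinearI, simp_all)
  define T where "T x = plin ?g (rep_ctensor x)" for x :: "('a, 'b) ctensor"
  have abs: "T (abs_ctensor p) = plin ?g p" for p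
  proof -
    have "abs_ctensor (rep_ctensor (abs_ctensor p)) = abs_ctensor p"
      by (rule Quotient3_abs_rep[OF Quotient3_ctensor])
    then have "rep_ctensor (abs_ctensor p) - p \<in> cvs.span ctensor_relations"
      using Quotient3_rel[OF Quotient3_ctensor, of "rep_ctensor (abs_ctensor p)" p]
      by (simp add: cvs.span_zero)
    from zero[OF this] show ?thesis by (simp add: T_def clinear_diff[OF lin])
  qed
  have "clinear T"
  proof (rule clinearI)
    fix x y :: "('a, 'b) ctensor" and c
    obtain p q where "x = abs_ctensor p" "y = abs_ctensor q" by (metis ctensor_cases)
    then show "T (x + y) = T x + T y" "T (c *\<^sub>C x) = c *\<^sub>C T x"
      by (simp_all add: plus_ctensor.abs_eq cscale_ctensor.abs_eq abs clinear_add[OF lin] clinear_scale[OF lin])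
  qed
  moreover have "T (a \<otimes>\<^sub>C b) = \<beta> a b" for a b
    by (simp add: ctensor_pure.abs_eq abs plin_single cscale_one)
  ultimately show ?thesis by blast
qed

section \<open>The grading\<close>

context cartan_semisimple
begin

text \<open>The weight space of the adjoint action of h. For \<mu> in \<open>h_dual h\<close> it is
  the homogeneous part \<open>uea_degree h \<mu>\<close>; being given by equations, it is easily
  seen to be respected by products, the projection and the antipode.\<close>

definition "ws \<mu> = {z :: 'g uea. \<forall>H\<in>h. uea_inj H * z - z * uea_inj H = \<mu> H *\<^sub>C z}"

text \<open>The set \<open>insert 0 (roots h)\<close> gives \<open>uea_degree\<close>; smaller R
  give the homogeneous parts of \<open>U np\<close> and \<open>U nm\<close>.\<close>

definition "gdeg R \<mu> = cvs.span {uword xs | xs \<beta>s. list_all2 (\<lambda>x \<beta>. \<beta> \<in> R \<and> x \<in> rs \<beta>) xs \<beta>s \<and> sum_list \<beta>s = \<mu>}"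

lemma mem_h: "x \<in> h \<longleftrightarrow> x \<in> rs 0"
  using h_eq_root_space by blast

lemma uea_degree_gdeg: "uea_degree h \<mu> = gdeg (insert 0 (roots h)) \<mu>"
proof -
  have "(\<lambda>x \<beta>. \<beta> \<in> roots h \<and> x \<in> rs \<beta> \<or> \<beta> = 0 \<and> x \<in> h) = (\<lambda>x \<beta>. \<beta> \<in> insert 0 (roots h) \<and> x \<in> rs \<beta>)"
    by (intro ext) (auto simp: mem_h)
  then show ?thesis by (simp only: uea_degree_def gdeg_def uword_def)
qed

lemma clinear_ad: "clinear (\<lambda>z. uea_inj x * z - z * uea_inj x)"
  by (rule clinearI)
    (simp_all add: algebra_simps cscale_mult_left cscale_mult_right cvs.scale_right_diff_distrib)

lemma subspace_ws: "cvs.subspace (ws \<mu>)"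
  by (rule cvs.subspaceI)
    (auto simp: ws_def algebra_simps cscale_mult_left cscale_mult_right cvs.scale_right_diff_distrib
      cscale_add_right cscale_cscale)

lemma subspace_gdeg: "cvs.subspace (gdeg R \<mu>)"
  by (simp add: gdeg_def cvs.subspace_span)

lemma ws_one: "1 \<in> ws 0"
  by (simp add: ws_def)

lemma ws_mult: "y \<in> ws \<mu> \<Longrightarrow> z \<in> ws \<nu> \<Longrightarrow> y * z \<in> ws (\<mu> + \<nu>)"
proof -
  assume a: "y \<in> ws \<mu>" "z \<in> ws \<nu>"
  have "uea_inj H * (y * z) - y * z * uea_inj H =
      (uea_inj H * y - y * uea_inj H) * z + y * (uea_inj H * z - z * uea_inj H)" for H
    by (simp add: algebra_simps)
  then show ?thesis
    using a by (simp add: ws_def cscale_mult_left cscale_mult_right cscale_add_left)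
qed

lemma ws_inj: "x \<in> rs \<beta> \<Longrightarrow> uea_inj x \<in> ws \<beta>"
  by (simp add: ws_def root_space_def uea_inj_scale flip: uea_inj_lie)

lemma gdeg_ws: "gdeg R \<mu> \<subseteq> ws \<mu>"
  unfolding gdeg_def
proof (rule cvs.span_minimal[OF _ subspace_ws], safe)
  fix xs \<beta>s assume "list_all2 (\<lambda>x \<beta>. \<beta> \<in> R \<and> x \<in> rs \<beta>) xs \<beta>s"
  then show "uword xs \<in> ws (sum_list \<beta>s)"
  proof (induction rule: list_all2_induct)
    case Nil
    show ?case unfolding uword_simps sum_list.Nil by (rule ws_one)
  next
    case (Cons x xs \<beta> \<beta>s)
    then show ?case
      unfolding uword_simps sum_list.Cons by (intro ws_mult ws_inj) auto
  qed
qed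

lemma gdeg_one: "1 \<in> gdeg R 0"
  unfolding gdeg_def by (rule cvs.span_base) (auto intro!: exI[of _ "[]"])

lemma gdeg_left:
  assumes "x \<in> rs \<beta>" "\<beta> \<in> R" "z \<in> gdeg R \<mu>"
  shows "uea_inj x * z \<in> gdeg R (\<beta> + \<mu>)"
proof (rule clinear_span_subset[OF clinear_mult_left _ subspace_gdeg assms(3)[unfolded gdeg_def]])
  fix w assume "w \<in> {uword xs | xs \<beta>s. list_all2 (\<lambda>x \<beta>. \<beta> \<in> R \<and> x \<in> rs \<beta>) xs \<beta>s \<and> sum_list \<beta>s = \<mu>}"
  then obtain xs \<beta>s where "w = uword xs" "list_all2 (\<lambda>x \<beta>. \<beta> \<in> R \<and> x \<in> rs \<beta>) xs \<beta>s" "sum_list \<beta>s = \<mu>"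
    by blast
  then have "uea_inj x * w = uword (x # xs)"
    "list_all2 (\<lambda>x \<beta>. \<beta> \<in> R \<and> x \<in> rs \<beta>) (x # xs) (\<beta> # \<beta>s)" "sum_list (\<beta> # \<beta>s) = \<beta> + \<mu>"
    using assms by auto
  then show "uea_inj x * w \<in> gdeg R (\<beta> + \<mu>)"
    unfolding gdeg_def by (intro cvs.span_base) blast
qed

lemma gdeg_nonzero: "z \<in> gdeg R \<mu> \<Longrightarrow> z \<noteq> 0 \<Longrightarrow> \<exists>\<beta>s. set \<beta>s \<subseteq> R \<and> sum_list \<beta>s = \<mu>"
proof (rule ccontr)
  assume a: "z \<in> gdeg R \<mu>" "z \<noteq> 0" "\<nexists>\<beta>s. set \<beta>s \<subseteq> R \<and> sum_list \<beta>s = \<mu>"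
  have "set \<beta>s \<subseteq> R" if "list_all2 (\<lambda>x \<beta>. \<beta> \<in> R \<and> x \<in> rs \<beta>) xs \<beta>s" for xs \<beta>s
    using that by (induction rule: list_all2_induct) auto
  with a(3) have "{uword xs | xs \<beta>s. list_all2 (\<lambda>x \<beta>. \<beta> \<in> R \<and> x \<in> rs \<beta>) xs \<beta>s \<and> sum_list \<beta>s = \<mu>} = {}"
    by blast
  then have "gdeg R \<mu> = {0}" unfolding gdeg_def by (simp only: cvs.span_empty)
  then show False using a(1,2) by simp
qed

lemma insert_roots_h_dual: "insert 0 (roots h) \<subseteq> h_dual h"
  using roots_h_dual h_dual_0 by blast

lemma uea_degree_h_dual: "z \<in> uea_degree h \<mu> \<Longrightarrow> z \<noteq> 0 \<Longrightarrow> \<mu> \<in> h_dual h"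
proof -
  assume "z \<in> uea_degree h \<mu>" "z \<noteq> 0"
  then obtain \<beta>s where "set \<beta>s \<subseteq> insert 0 (roots h)" "sum_list \<beta>s = \<mu>"
    using gdeg_nonzero[of z] unfolding uea_degree_gdeg by blast
  then show ?thesis using h_dual_sum_list[of \<beta>s] insert_roots_h_dual by auto
qed

lemma U_gdeg_span:
  assumes R: "R \<subseteq> h_dual h" and z: "z \<in> U (root_nilpotent h R)"
  shows "z \<in> cvs.span (\<Union>\<mu>\<in>h_dual h. gdeg R \<mu>)" (is "_ \<in> ?T")
  using z
proof (induction rule: U_induct)
  case subspace
  show ?case using cvs.subspace_span[of "\<Union>\<mu>\<in>h_dual h. gdeg R \<mu>"] by simp
next
  case one
  show ?case using gdeg_one h_dual_0 by (auto intro!: cvs.span_base)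
next
  case (left x z)
  have T: "cvs.subspace ?T" by (rule cvs.subspace_span)
  have "uea_inj y * z \<in> ?T" if "y \<in> rs \<beta>" "\<beta> \<in> R" for y \<beta>
  proof (rule clinear_span_subset[OF clinear_mult_left _ T left(3)])
    fix w assume "w \<in> (\<Union>\<mu>\<in>h_dual h. gdeg R \<mu>)"
    then obtain \<mu> where "\<mu> \<in> h_dual h" "w \<in> gdeg R \<mu>" by blast
    then show "uea_inj y * w \<in> ?T"
      using gdeg_left[OF that] h_dual_add[of \<beta> \<mu>] that(2) R by (intro cvs.span_base) auto
  qed
  then show ?case
    using left(1) clinear_span_subset[OF clinear_compose[OF clinear_mult_right clinear_uea_inj] _ T,
        of "\<Union>\<alpha>\<in>R. rs \<alpha>" z x]
    by (auto simp: root_nilpotent_def)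
qed

text \<open>\<open>U\<close> of the root spaces is spanned by words in R, which are weight vectors,
  so a weight vector is a combination of words of its own weight. This confines the weights of
  \<open>U nm\<close> to the negative cone.\<close>

lemma U_ws_gdeg:
  assumes "R \<subseteq> h_dual h" "z \<in> U (root_nilpotent h R)" "\<mu> \<in> h_dual h" "z \<in> ws \<mu>"
  shows "z \<in> gdeg R \<mu>"
proof -
  have eig: "uea_inj H * y - y * uea_inj H = \<nu> H *\<^sub>C y" if "y \<in> gdeg R \<nu>" "H \<in> h" for y \<nu> H
    using gdeg_ws that unfolding ws_def by blast
  have "z = 0 \<or> (\<exists>\<nu>\<in>h_dual h. z \<in> gdeg R \<nu> \<and> (\<forall>H\<in>h. \<nu> H = \<mu> H))"
  proof (rule eigenvector_in_graded_span[of h "\<lambda>H z. uea_inj H * z - z * uea_inj H" "h_dual h" "gdeg R"])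
    show "z \<in> cvs.span (\<Union>\<mu>\<in>h_dual h. gdeg R \<mu>)" by (rule U_gdeg_span[OF assms(1,2)])
  qed (use clinear_ad subspace_gdeg eig assms(4) h_dual_distinct in \<open>auto simp: ws_def\<close>)
  then show ?thesis
    using cvs.subspace_0[OF subspace_gdeg] h_dual_eqI assms(3) by blast
qed

lemma root_nilpotent_UNIV: "root_nilpotent h (insert 0 (roots h)) = UNIV"
  unfolding root_nilpotent_def by (rule span_root_spaces)

lemma uea_degree_ws: "\<mu> \<in> h_dual h \<Longrightarrow> uea_degree h \<mu> = ws \<mu>"
  using U_ws_gdeg[OF insert_roots_h_dual, of _ \<mu>] gdeg_ws
  unfolding uea_degree_gdeg root_nilpotent_UNIV U_UNIV by blast

lemma subspace_uea_degree: "cvs.subspace (uea_degree h \<mu>)"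
  unfolding uea_degree_gdeg by (rule subspace_gdeg)

lemma uea_component_eqI:
  assumes F: "finite F" "F \<subseteq> h_dual h" "\<And>\<mu>. \<mu> \<in> F \<Longrightarrow> y \<mu> \<in> ws \<mu>" "x = (\<Sum>\<mu>\<in>F. y \<mu>)"
  shows "uea_component h x = (\<lambda>\<mu>. if \<mu> \<in> F then y \<mu> else 0)"
  unfolding uea_component_def
proof (rule the_equality, intro conjI allI)
  let ?f = "\<lambda>\<mu>. if \<mu> \<in> F then y \<mu> else 0"
  have sub: "{\<mu>. ?f \<mu> \<noteq> 0} \<subseteq> F" by auto
  then show "finite {\<mu>. ?f \<mu> \<noteq> 0}" using F(1) finite_subset by blast
  show "?f \<mu> \<in> uea_degree h \<mu>" for \<mu>
    using F(2,3) uea_degree_ws cvs.subspace_0[OF subspace_uea_degree] by auto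
  have "(\<Sum>\<mu> | ?f \<mu> \<noteq> 0. ?f \<mu>) = (\<Sum>\<mu>\<in>F. ?f \<mu>)"
    by (rule sum.mono_neutral_left[OF F(1) sub]) auto
  then show x: "x = (\<Sum>\<mu> | ?f \<mu> \<noteq> 0. ?f \<mu>)" using F(4) by simp
  fix g assume g: "finite {\<mu>. g \<mu> \<noteq> 0} \<and> (\<forall>\<mu>. g \<mu> \<in> uea_degree h \<mu>) \<and> x = (\<Sum>\<mu> | g \<mu> \<noteq> 0. g \<mu>)"
  \<comment> \<open>A competing family may use other degrees. On the union of both supports the
    differences are weight vectors with sum 0, so they all vanish.\<close>
  let ?G = "{\<mu>. g \<mu> \<noteq> 0}"
  have G: "?G \<subseteq> h_dual h" using g uea_degree_h_dual by blast
  have FG: "F \<union> ?G \<subseteq> h_dual h" using F(2) G by blast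
  have "(\<Sum>\<mu>\<in>F \<union> ?G. ?f \<mu>) = (\<Sum>\<mu>\<in>F. y \<mu>)"
    by (rule sum.mono_neutral_cong_right) (use g F(1) in auto)
  moreover have "(\<Sum>\<mu>\<in>F \<union> ?G. g \<mu>) = (\<Sum>\<mu>\<in>?G. g \<mu>)"
    by (rule sum.mono_neutral_right) (use g F(1) in auto)
  ultimately have s: "(\<Sum>\<mu>\<in>F \<union> ?G. ?f \<mu> - g \<mu>) = 0" using F(4) g by (simp add: sum_subtractf)
  have d: "?f \<mu> - g \<mu> \<in> ws \<mu>" if "\<mu> \<in> F \<union> ?G" for \<mu>
  proof (rule cvs.subspace_diff[OF subspace_ws])
    show "?f \<mu> \<in> ws \<mu>" using F(3) cvs.subspace_0[OF subspace_ws] by auto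
    have "uea_degree h \<mu> = ws \<mu>" using that FG by (intro uea_degree_ws) blast
    then show "g \<mu> \<in> ws \<mu>" using g by blast
  qed
  have *: "\<forall>\<mu>\<in>F \<union> ?G. ?f \<mu> - g \<mu> = 0"
    by (rule common_eigenvectors_zero[of _ h "\<lambda>H z. uea_inj H * z - z * uea_inj H" _ "\<lambda>\<mu>. \<mu>", OF _ clinear_ad _ _ s])
      (use F(1) g d FG h_dual_distinct in \<open>auto simp: ws_def subset_iff\<close>)
  show "g = ?f"
  proof
    fix \<mu>
    show "g \<mu> = ?f \<mu>"
    proof (cases "\<mu> \<in> F \<union> ?G")
      case True
      from bspec[OF * this] show ?thesis by simp
    qed auto
  qed
qed

lemma homogeneous_decomposition:
  "\<exists>F y. finite F \<and> F \<subseteq> h_dual h \<and> (\<forall>\<mu>\<in>F. y \<mu> \<in> ws \<mu>) \<and> x = (\<Sum>\<mu>\<in>F. y \<mu>)"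
proof -
  have "x \<in> cvs.span (\<Union>\<mu>\<in>h_dual h. gdeg (insert 0 (roots h)) \<mu>)"
    by (rule U_gdeg_span[OF insert_roots_h_dual]) (simp add: root_nilpotent_UNIV U_UNIV)
  from span_UN_subspace[OF subspace_gdeg this] obtain F y where
    F: "finite F" "F \<subseteq> h_dual h" "\<forall>\<mu>\<in>F. y \<mu> \<in> gdeg (insert 0 (roots h)) \<mu>" "x = (\<Sum>\<mu>\<in>F. y \<mu>)"
    by blast
  from F(3) have "\<forall>\<mu>\<in>F. y \<mu> \<in> ws \<mu>" by (meson gdeg_ws subsetD)
  with F show ?thesis by blast
qed

lemma uea_component_ws: "x \<in> ws \<nu> \<Longrightarrow> \<nu> \<in> h_dual h \<Longrightarrow> uea_component h x \<mu> = (if \<mu> = \<nu> then x else 0)"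
  using uea_component_eqI[of "{\<nu>}" "\<lambda>_. x" x] by simp

lemma clinear_uea_component: "clinear (\<lambda>x. uea_component h x \<mu>)"
proof (rule clinearI)
  fix x y :: "'g uea" and c
  obtain F a where F: "finite F" "F \<subseteq> h_dual h" "\<forall>\<mu>\<in>F. a \<mu> \<in> ws \<mu>" "x = (\<Sum>\<mu>\<in>F. a \<mu>)"
    using homogeneous_decomposition[of x] by (elim exE conjE)
  obtain G b where G: "finite G" "G \<subseteq> h_dual h" "\<forall>\<mu>\<in>G. b \<mu> \<in> ws \<mu>" "y = (\<Sum>\<mu>\<in>G. b \<mu>)"
    using homogeneous_decomposition[of y] by (elim exE conjE)
  let ?a = "\<lambda>\<mu>. if \<mu> \<in> F then a \<mu> else 0" and ?b = "\<lambda>\<mu>. if \<mu> \<in> G then b \<mu> else 0"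
  have x: "uea_component h x = ?a" and y: "uea_component h y = ?b"
    using F G by (auto intro!: uea_component_eqI)
  have "x = (\<Sum>\<mu>\<in>F \<union> G. ?a \<mu>)" "y = (\<Sum>\<mu>\<in>F \<union> G. ?b \<mu>)"
    using F(1,4) G(1,4) by (auto intro!: sum.mono_neutral_cong_left)
  then have "x + y = (\<Sum>\<mu>\<in>F \<union> G. ?a \<mu> + ?b \<mu>)" by (simp add: sum.distrib)
  moreover have "?a \<mu> + ?b \<mu> \<in> ws \<mu>" for \<mu>
    using F(3) G(3) cvs.subspace_0[OF subspace_ws] by (intro cvs.subspace_add[OF subspace_ws]) auto
  ultimately have "uea_component h (x + y) = (\<lambda>\<mu>. if \<mu> \<in> F \<union> G then ?a \<mu> + ?b \<mu> else 0)"
    using F(1,2) G(1,2) by (intro uea_component_eqI) auto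
  then show "uea_component h (x + y) \<mu> = uea_component h x \<mu> + uea_component h y \<mu>"
    unfolding x y by auto
  have "c *\<^sub>C x = (\<Sum>\<mu>\<in>F. c *\<^sub>C a \<mu>)" by (simp add: F(4) cvs.scale_sum_right)
  then have "uea_component h (c *\<^sub>C x) = (\<lambda>\<mu>. if \<mu> \<in> F then c *\<^sub>C a \<mu> else 0)"
    using F(1-3) cvs.subspace_scale[OF subspace_ws] by (intro uea_component_eqI) auto
  then show "uea_component h (c *\<^sub>C x) \<mu> = c *\<^sub>C uea_component h x \<mu>"
    unfolding x by auto
qed

lemma tensor_component:
  "clinear (tensor_component h \<mu> \<nu>)"
  "tensor_component h \<mu> \<nu> (a \<otimes>\<^sub>C b) = uea_component h a \<mu> \<otimes>\<^sub>C uea_component h b \<nu>"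
proof -
  let ?P = "\<lambda>T. clinear T \<and> (\<forall>a b. T (a \<otimes>\<^sub>C b) = uea_component h a \<mu> \<otimes>\<^sub>C uea_component h b \<nu>)"
  have "\<exists>!T. ?P T"
  proof (rule ex_ex1I)
    show "\<exists>T. ?P T"
      by (rule tensor_universal[OF clinear_compose[OF clinear_tensor_left clinear_uea_component]
            clinear_compose[OF clinear_tensor_right clinear_uea_component]])
    show "S = T" if "?P S" "?P T" for S T
      using that by (intro tensor_linear_eqI) auto
  qed
  from theI'[OF this] have "?P (tensor_component h \<mu> \<nu>)" unfolding tensor_component_def .
  then show "clinear (tensor_component h \<mu> \<nu>)"
    "tensor_component h \<mu> \<nu> (a \<otimes>\<^sub>C b) = uea_component h a \<mu> \<otimes>\<^sub>C uea_component h b \<nu>" by auto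
qed

lemma tensor_component_ws:
  assumes "a \<in> ws \<mu>'" "b \<in> ws \<nu>'" "\<mu>' \<in> h_dual h" "\<nu>' \<in> h_dual h"
  shows "tensor_component h \<mu> \<nu> (a \<otimes>\<^sub>C b) = (if \<mu> = \<mu>' \<and> \<nu> = \<nu>' then a \<otimes>\<^sub>C b else 0)"
  using assms clinear_zero[OF clinear_tensor_left] clinear_zero[OF clinear_tensor_right]
  by (auto simp: tensor_component(2) uea_component_ws)

lemma gdeg_U: "gdeg R \<mu> \<subseteq> U (root_nilpotent h R)"
  unfolding gdeg_def
proof (rule cvs.span_minimal[OF _ subspace_U], safe)
  fix xs \<beta>s assume "list_all2 (\<lambda>x \<beta>. \<beta> \<in> R \<and> x \<in> rs \<beta>) xs \<beta>s"
  then have "set xs \<subseteq> root_nilpotent h R"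
    by (induction rule: list_all2_induct) (auto intro: root_nilpotent_base)
  then show "uword xs \<in> U (root_nilpotent h R)" by (rule U_words)
qed

lemma U_homogeneous_decomposition:
  assumes "R \<subseteq> h_dual h" "z \<in> U (root_nilpotent h R)"
  shows "\<exists>F y. finite F \<and> F \<subseteq> h_dual h \<and> (\<forall>\<mu>\<in>F. y \<mu> \<in> U (root_nilpotent h R) \<and> y \<mu> \<in> ws \<mu>) \<and> z = (\<Sum>\<mu>\<in>F. y \<mu>)"
proof -
  from span_UN_subspace[OF subspace_gdeg U_gdeg_span[OF assms]] obtain F y where
    F: "finite F" "F \<subseteq> h_dual h" "\<forall>\<mu>\<in>F. y \<mu> \<in> gdeg R \<mu>" "z = (\<Sum>\<mu>\<in>F. y \<mu>)"
    by blast
  from F(3) have "\<forall>\<mu>\<in>F. y \<mu> \<in> U (root_nilpotent h R) \<and> y \<mu> \<in> ws \<mu>" by (meson gdeg_ws gdeg_U subsetD)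
  with F show ?thesis by blast
qed

lemma antipode_ws: "z \<in> ws \<mu> \<Longrightarrow> antipode z \<in> ws \<mu>"
proof -
  assume z: "z \<in> ws \<mu>"
  have "uea_inj H * antipode z - antipode z * uea_inj H = \<mu> H *\<^sub>C antipode z" if "H \<in> h" for H
  proof -
    have "antipode (uea_inj H * z - z * uea_inj H) = antipode (\<mu> H *\<^sub>C z)"
      using z that by (simp add: ws_def)
    then show ?thesis
      by (simp add: clinear_diff[OF clinear_antipode] clinear_scale[OF clinear_antipode] antipode_mult antipode_inj)
  qed
  then show ?thesis by (simp add: ws_def)
qed

end

section \<open>The Casimir element\<close>

locale shapovalov_data = triangular h lam Pos
  for h :: "'g::complex_lie_algebra set" and lam Pos +
  fixes k :: nat and al :: "nat \<Rightarrow> 'g \<Rightarrow> complex" and X Y :: "nat \<Rightarrow> 'g"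
  assumes bij: "bij_betw al {1..k} Pos"
    and X: "i \<in> {1..k} \<Longrightarrow> X i \<in> rs (al i)" and Y: "i \<in> {1..k} \<Longrightarrow> Y i \<in> rs (- al i)"
    and XY: "i \<in> {1..k} \<Longrightarrow> killing (X i) (Y i) = 1"
    and p_nonzero: "\<mu> \<in> nat_cone hp \<Longrightarrow> \<mu> \<noteq> 0 \<Longrightarrow> p_coeff Pos lam \<mu> \<noteq> 0"
begin

lemma al_Pos: "i \<in> {1..k} \<Longrightarrow> al i \<in> Pos"
  using bij bij_betwE by blast

lemma al_h_dual: "i \<in> {1..k} \<Longrightarrow> al i \<in> h_dual h"
  using al_Pos Pos_h_dual by blast

lemma al_root: "i \<in> {1..k} \<Longrightarrow> al i \<in> roots h"
  using al_Pos Pos_roots by blast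

lemma killing_YX: "i \<in> {1..k} \<Longrightarrow> killing (Y i) (X i) = 1"
  using XY killing_commute by metis

section \<open>Dual bases for the Killing form\<close>

definition "hco b x = coord (pr x) b"
text \<open>The basis of h dual to \<open>wbasis \<inter> h\<close>, obtained by representing the
  coordinate functionals through the Killing form.\<close>

definition "Hd b = sharp (hco b)"

lemma hco_h_dual: "hco b \<in> h_dual h"
proof (rule h_dualI)
  have "hco b = (\<lambda>x. coord (pr x) b)" by (simp add: fun_eq_iff hco_def)
  then show "clinear (hco b)" using clinear_compose[OF coord_linear clinear_pr] by simp
qed (simp add: hco_def pr_h pr_in_h)

lemma Hd_h: "Hd b \<in> h"
  unfolding Hd_def by (rule sharp_in_h[OF hco_h_dual])

lemma killing_Hd: "killing (Hd b) x = hco b x"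
  unfolding Hd_def by (rule killing_sharp[OF clinear_h_dual[OF hco_h_dual]])

lemma h_expand: "H \<in> h \<Longrightarrow> (\<Sum>b\<in>wbasis \<inter> h. hco b H *\<^sub>C b) = H"
  using pr_h[of H] unfolding hco_def by (simp add: pr_def[symmetric])

lemma finite_wh: "finite (wbasis \<inter> h)"
  using wb_finite by blast

lemma killing_h_Pos:
  "H \<in> h \<Longrightarrow> i \<in> {1..k} \<Longrightarrow> killing H (X i) = 0"
  "H \<in> h \<Longrightarrow> i \<in> {1..k} \<Longrightarrow> killing H (Y i) = 0"
proof -
  assume a: "H \<in> h" "i \<in> {1..k}"
  note r = al_root[OF a(2)] roots_minus[OF al_root[OF a(2)]]
  show "killing H (X i) = 0"
    by (rule killing_h_root_space(1)[OF a(1) roots_h_dual[OF r(1)] roots_nonzero[OF r(1)] X[OF a(2)]])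
  show "killing H (Y i) = 0"
    by (rule killing_h_root_space(1)[OF a(1) roots_h_dual[OF r(2)] roots_nonzero[OF r(2)] Y[OF a(2)]])
qed

lemma sum_Pos: "(\<Sum>i\<in>{1..k}. g (al i)) = (\<Sum>\<alpha>\<in>Pos. g \<alpha>)"
  by (rule sum.reindex_bij_betw[OF bij])

text \<open>Exactly one of \<gamma> and - \<gamma> is positive, so by orthogonality a single term
  survives, and it is z because root spaces are one-dimensional.\<close>

lemma root_vector_expand:
  assumes "\<gamma> \<in> roots h" "z \<in> rs \<gamma>"
  shows "(\<Sum>i\<in>{1..k}. killing z (Y i) *\<^sub>C X i) + (\<Sum>i\<in>{1..k}. killing z (X i) *\<^sub>C Y i) = z"
proof -
  have g: "\<gamma> \<in> h_dual h" using assms(1) roots_h_dual by blast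
  have inj: "al i = al j \<longleftrightarrow> i = j" if "i \<in> {1..k}" "j \<in> {1..k}" for i j
    using inj_on_eq_iff[OF bij_betw_imp_inj_on[OF bij] that] .
  have zY: "killing z (Y i) = 0" if "i \<in> {1..k}" "al i \<noteq> \<gamma>" for i
  proof (rule killing_orth[OF g _ _ assms(2) Y[OF that(1)]])
    show "\<gamma> + - al i \<noteq> 0" using that(2) by auto
  qed (use al_h_dual that in simp)
  have zX: "killing z (X i) = 0" if "i \<in> {1..k}" "al i \<noteq> - \<gamma>" for i
  proof (rule killing_orth[OF g _ _ assms(2) X[OF that(1)]])
    show "\<gamma> + al i \<noteq> 0" using that(2) by (simp add: add_eq_0_iff)
  qed (use al_h_dual that in simp)
  have "\<gamma> \<in> Pos \<or> - \<gamma> \<in> Pos" using assms(1) roots_Pos in_uminus_image by auto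
  then show ?thesis
  proof
    assume "\<gamma> \<in> Pos"
    then obtain j where j: "j \<in> {1..k}" "\<gamma> = al j" using bij by (auto simp: bij_betw_def)
    have "(\<Sum>i\<in>{1..k}. killing z (Y i) *\<^sub>C X i) = (\<Sum>i\<in>{1..k}. if i = j then killing z (Y j) *\<^sub>C X j else 0)"
      using zY j inj by (intro sum.cong) auto
    also have "\<dots> = z"
      using root_space_dim_1[OF assms(1) _ _ XY[OF j(1)] assms(2)] X[OF j(1)] Y[OF j(1)] j by simp
    finally have 1: "(\<Sum>i\<in>{1..k}. killing z (Y i) *\<^sub>C X i) = z" .
    have "killing z (X i) = 0" if "i \<in> {1..k}" for i
      using zX[OF that] al_Pos[OF that] Pos_minus[OF \<open>\<gamma> \<in> Pos\<close>] by metis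
    then show ?thesis using 1 by simp
  next
    assume "- \<gamma> \<in> Pos"
    then obtain j where j: "j \<in> {1..k}" "\<gamma> = - al j"
      using bij by (metis bij_betw_imp_surj_on imageE minus_minus)
    have "(\<Sum>i\<in>{1..k}. killing z (X i) *\<^sub>C Y i) = (\<Sum>i\<in>{1..k}. if i = j then killing z (X j) *\<^sub>C Y j else 0)"
      using zX j inj by (intro sum.cong) auto
    also have "\<dots> = z"
      using root_space_dim_1[OF assms(1) _ _ killing_YX[OF j(1)] assms(2)] X[OF j(1)] Y[OF j(1)] j by simp
    finally have 1: "(\<Sum>i\<in>{1..k}. killing z (X i) *\<^sub>C Y i) = z" .
    have "killing z (Y i) = 0" if "i \<in> {1..k}" for i
      using zY[OF that] al_Pos[OF that] Pos_minus[OF al_Pos[OF that]] \<open>- \<gamma> \<in> Pos\<close> by metis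
    then show ?thesis using 1 by simp
  qed
qed

text \<open>The index set of the dual bases \<open>ce\<close> and \<open>cd\<close>: every X i is
  paired with Y i, every Y i with X i, and a basis of h with its dual.\<close>

definition "cI = ({1..k} <+> {1..k}) <+> (wbasis \<inter> h)"
definition "ce = case_sum (case_sum X Y) (\<lambda>b. b)"
definition "cd = case_sum (case_sum Y X) Hd"

lemma sum_cI: "(\<Sum>t\<in>cI. g t) =
    (\<Sum>i\<in>{1..k}. g (Inl (Inl i))) + (\<Sum>i\<in>{1..k}. g (Inl (Inr i))) + (\<Sum>b\<in>wbasis \<inter> h. g (Inr b))"
  by (simp add: cI_def sum.Plus finite_wh comp_def)

lemma dual_bases: "(\<Sum>t\<in>cI. killing z (cd t) *\<^sub>C ce t) = z" "(\<Sum>t\<in>cI. killing z (ce t) *\<^sub>C cd t) = z"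
proof -
  have lin: "cvs.subspace {z. (\<Sum>t\<in>cI. killing z (a t) *\<^sub>C b t) = z}" for a b :: "_ \<Rightarrow> 'g"
  proof (rule subspace_clinear_eq)
    show "clinear (\<lambda>z. \<Sum>t\<in>cI. killing z (a t) *\<^sub>C b t)"
      by (rule clinearI) (simp_all only: killing_simps cvs.scale_left_distrib sum.distrib
          cscale_cscale cvs.scale_sum_right)
  qed (rule clinearI, rule refl, rule refl)
  have *: "(\<Sum>t\<in>cI. killing z (cd t) *\<^sub>C ce t) = z \<and> (\<Sum>t\<in>cI. killing z (ce t) *\<^sub>C cd t) = z"
    if "\<gamma> = 0 \<or> \<gamma> \<in> roots h" "z \<in> rs \<gamma>" for \<gamma> z
  proof (cases "\<gamma> = 0")
    case True
    then have z: "z \<in> h" using that mem_h by simp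
    have "(\<Sum>b\<in>wbasis \<inter> h. killing z b *\<^sub>C Hd b) = z"
    proof (rule h_eqI[OF _ z])
      show "(\<Sum>b\<in>wbasis \<inter> h. killing z b *\<^sub>C Hd b) \<in> h"
        using Hd_h by (intro cvs.subspace_sum[OF subspace_h] cvs.subspace_scale[OF subspace_h])
      fix H assume "H \<in> h"
      have "killing (\<Sum>b\<in>wbasis \<inter> h. killing z b *\<^sub>C Hd b) H = (\<Sum>b\<in>wbasis \<inter> h. killing z b * hco b H)"
        by (simp add: clinear_sum[OF clinear_killing_left] killing_simps killing_Hd)
      also have "\<dots> = killing z (\<Sum>b\<in>wbasis \<inter> h. hco b H *\<^sub>C b)"
        by (simp add: clinear_sum[OF clinear_killing] killing_simps mult.commute)
      finally show "killing (\<Sum>b\<in>wbasis \<inter> h. killing z b *\<^sub>C Hd b) H = killing z H"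
        using h_expand[OF \<open>H \<in> h\<close>] by simp
    qed
    moreover have "(\<Sum>b\<in>wbasis \<inter> h. killing z (Hd b) *\<^sub>C b) = z"
      using h_expand[OF z] by (simp add: killing_commute[of z] killing_Hd)
    ultimately show ?thesis using killing_h_Pos[OF z] by (simp add: sum_cI ce_def cd_def)
  next
    case False
    with that have g: "\<gamma> \<in> roots h" by blast
    have "killing z H = 0" if "H \<in> h" for H
      using killing_h_root_space(2)[OF that roots_h_dual[OF g] False] \<open>z \<in> rs \<gamma>\<close> by blast
    then show ?thesis
      using root_vector_expand[OF g that(2)] Hd_h by (simp add: sum_cI ce_def cd_def add.commute)
  qed
  show "(\<Sum>t\<in>cI. killing z (cd t) *\<^sub>C ce t) = z" "(\<Sum>t\<in>cI. killing z (ce t) *\<^sub>C cd t) = z"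
    by (rule root_space_induct[where x = z], rule lin, use * in blast)+
qed

section \<open>Centrality of the Casimir element and its action on the module\<close>

definition "Cas = (\<Sum>t\<in>cI. uea_inj (ce t) * uea_inj (cd t))"

text \<open>By invariance of the Killing form the matrices of \<open>lie x\<close> in the two dual
  bases are negative transposes of each other, so the two parts of the commutator cancel.\<close>

lemma Cas_commute_inj: "uea_inj x * Cas = Cas * uea_inj x"
proof -
  have "uea_inj x * Cas - Cas * uea_inj x =
      (\<Sum>t\<in>cI. uea_inj (lie x (ce t)) * uea_inj (cd t) + uea_inj (ce t) * uea_inj (lie x (cd t)))"
    by (simp add: Cas_def sum_distrib_left sum_distrib_right sum_subtractf[symmetric] uea_inj_lie algebra_simps)
  also have "\<dots> = (\<Sum>t\<in>cI. uea_inj (lie x (ce t)) * uea_inj (cd t)) + (\<Sum>t\<in>cI. uea_inj (ce t) * uea_inj (lie x (cd t)))"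
    by (rule sum.distrib)
  also have "(\<Sum>t\<in>cI. uea_inj (lie x (ce t)) * uea_inj (cd t)) =
      (\<Sum>t\<in>cI. \<Sum>s\<in>cI. killing (lie x (ce t)) (cd s) *\<^sub>C (uea_inj (ce s) * uea_inj (cd t)))"
  proof (rule sum.cong[OF refl])
    fix t
    show "uea_inj (lie x (ce t)) * uea_inj (cd t) =
        (\<Sum>s\<in>cI. killing (lie x (ce t)) (cd s) *\<^sub>C (uea_inj (ce s) * uea_inj (cd t)))"
      using arg_cong[OF dual_bases(1)[of "lie x (ce t)"], of "\<lambda>z. uea_inj z * uea_inj (cd t)"]
      by (simp add: clinear_sum[OF clinear_uea_inj] uea_inj_scale sum_distrib_right cscale_mult_left)
  qed
  also have "\<dots> = (\<Sum>s\<in>cI. \<Sum>t\<in>cI. killing (lie x (ce t)) (cd s) *\<^sub>C (uea_inj (ce s) * uea_inj (cd t)))"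
    by (rule sum.swap)
  also have "(\<Sum>s\<in>cI. uea_inj (ce s) * uea_inj (lie x (cd s))) =
      (\<Sum>s\<in>cI. \<Sum>t\<in>cI. - (killing (lie x (ce t)) (cd s) *\<^sub>C (uea_inj (ce s) * uea_inj (cd t))))"
  proof (rule sum.cong[OF refl])
    fix s
    have "killing (lie x (cd s)) (ce t) = - killing (lie x (ce t)) (cd s)" for t
      using killing_commute[of "cd s" "lie x (ce t)"]
      by (simp add: killing_invariant lie_antisym[of x "cd s"] killing_simps)
    then show "uea_inj (ce s) * uea_inj (lie x (cd s)) =
        (\<Sum>t\<in>cI. - (killing (lie x (ce t)) (cd s) *\<^sub>C (uea_inj (ce s) * uea_inj (cd t))))"
      using arg_cong[OF dual_bases(2)[of "lie x (cd s)"], of "\<lambda>z. uea_inj (ce s) * uea_inj z"]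
      by (simp add: clinear_sum[OF clinear_uea_inj] clinear_minus[OF clinear_uea_inj] uea_inj_scale
          sum_distrib_left cscale_mult_right)
  qed
  finally have "uea_inj x * Cas - Cas * uea_inj x = 0"
    by (simp add: sum_negf)
  then show ?thesis by simp
qed

lemma Cas_commute: "z * Cas = Cas * z"
proof (induction z rule: uea_induct)
  case subspace
  show ?case by (rule subspace_clinear_eq[OF clinear_mult_right clinear_mult_left])
next
  case (left x z)
  have "uea_inj x * z * Cas = uea_inj x * Cas * z" using left by (simp add: mult.assoc)
  then show ?case by (simp add: Cas_commute_inj mult.assoc)
qed simp

lemma f_ws: "z \<in> ws \<nu> \<Longrightarrow> vm.f z \<in> ws \<nu>"
proof -
  assume z: "z \<in> ws \<nu>"
  have "uea_inj H * vm.f z - vm.f z * uea_inj H = \<nu> H *\<^sub>C vm.f z" if H: "H \<in> h" for H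
  proof -
    have gl: "H \<in> gl" "H \<in> bp" using H h_subset_gl gl_subset_bp by auto
    have "\<nu> H *\<^sub>C vm.f z = vm.f (uea_inj H * z) - vm.f (z * uea_inj H)"
      using z H by (simp add: ws_def flip: clinear_diff[OF vm.clinear_f] clinear_scale[OF vm.clinear_f])
    also have "vm.f (uea_inj H * z) = vm.f (uea_inj H * vm.f z)" by (simp add: vm.f_mult_f)
    finally show ?thesis
      by (simp add: f_gl_left[OF vm.f_in_U gl(1)] vm.f_mult_B[OF gl(2)] chi_gl[OF gl(1)])
  qed
  then show ?thesis by (simp add: ws_def)
qed

text \<open>\<open>ws\<close> refers to the adjoint action; the action in the module is shifted by
  lam.\<close>

lemma f_H: "v \<in> U nm \<Longrightarrow> v \<in> ws \<nu> \<Longrightarrow> H \<in> h \<Longrightarrow> vm.f (uea_inj H * v) = (\<nu> + lam) H *\<^sub>C v"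
  using f_gl_left[of v H] h_subset_gl by (auto simp: ws_def cscale_add_left)

text \<open>Every \<open>X i\<close> kills the highest weight vector, also if it lies in the
  stabilizer, because lam vanishes on root vectors.\<close>

lemma f_X_right: "i \<in> {1..k} \<Longrightarrow> vm.f (z * uea_inj (X i)) = 0"
proof -
  assume i: "i \<in> {1..k}"
  have "X i \<in> bp \<and> chi (X i) = 0"
  proof (cases "al i \<in> orth")
    case True
    then have "X i \<in> gl" unfolding gl_eq using X[OF i] by (intro root_nilpotent_base) auto
    then show ?thesis
      using lam_root_space[OF al_h_dual[OF i] roots_nonzero[OF al_root[OF i]] X[OF i]] chi_gl gl_subset_bp by auto
  next
    case False
    then have "al i \<in> hp" using al_root[OF i] al_Pos[OF i] by (simp add: roots_hat_def)
    then have "X i \<in> np" unfolding np_eq using X[OF i] by (intro root_nilpotent_base)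
    then show ?thesis using chi_np np_subset_bp by auto
  qed
  then show ?thesis by (simp add: vm.f_mult_B)
qed

lemma rho_h_dual: "rho Pos \<in> h_dual h"
proof -
  have "rho Pos = (\<lambda>x. 1 / 2 * (\<Sum>\<alpha>\<in>Pos. \<alpha>) x)"
  proof -
    have "(\<Sum>\<alpha>\<in>S. \<alpha>) x = (\<Sum>\<alpha>\<in>S. \<alpha> x)" for S :: "('g \<Rightarrow> complex) set" and x
      by (induction S rule: infinite_finite_induct) auto
    then show ?thesis by (simp add: rho_def)
  qed
  then show ?thesis
    using h_dual_cmult[OF h_dual_sum[of Pos "\<lambda>\<alpha>. \<alpha>"], of "1/2"] Pos_h_dual by simp
qed

lemma sum_sharp: "(\<Sum>i\<in>{1..k}. \<kappa> (sharp (al i))) = 2 * dform (rho Pos) \<kappa>" if "\<kappa> \<in> h_dual h"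
proof -
  have "(\<Sum>i\<in>{1..k}. \<kappa> (sharp (al i))) = (\<Sum>i\<in>{1..k}. al i (sharp \<kappa>))"
    using that al_h_dual clinear_h_dual
    by (intro sum.cong) (auto simp: dform_commute simp flip: dform_eq)
  also have "\<dots> = (\<Sum>\<alpha>\<in>Pos. \<alpha> (sharp \<kappa>))" using sum_Pos[of "\<lambda>\<alpha>. \<alpha> (sharp \<kappa>)"] .
  also have "\<dots> = 2 * rho Pos (sharp \<kappa>)" by (simp add: rho_def)
  finally show ?thesis using dform_eq[OF clinear_h_dual[OF rho_h_dual]] by simp
qed

lemma sum_Hd: "(\<Sum>b\<in>wbasis \<inter> h. \<kappa> b * \<kappa> (Hd b)) = dform \<kappa> \<kappa>" if k: "\<kappa> \<in> h_dual h"
proof -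
  have lin: "clinear \<kappa>" using k clinear_h_dual by blast
  have "\<kappa> (Hd b) = hco b (sharp \<kappa>)" for b
    using killing_sharp[OF lin, of "Hd b"] killing_Hd[of b "sharp \<kappa>"] by (simp add: killing_commute)
  then have "(\<Sum>b\<in>wbasis \<inter> h. \<kappa> b * \<kappa> (Hd b)) = \<kappa> (\<Sum>b\<in>wbasis \<inter> h. hco b (sharp \<kappa>) *\<^sub>C b)"
    by (simp add: clinear_sum[OF lin] clinear_scale[OF lin] mult.commute)
  then show ?thesis using h_expand[OF sharp_in_h[OF k]] dform_eq[OF lin] by simp
qed

text \<open>Reordering X Y into Y X costs \<open>sharp (al i)\<close>, and these terms add up to 2
  \<rho>; the part of the Casimir element from h contributes the norm of the weight \<nu> +
  lam.\<close>

lemma f_Cas: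
  assumes v: "v \<in> U nm" "v \<in> ws \<nu>" and n: "\<nu> \<in> h_dual h"
  shows "vm.f (Cas * v) = (dform (\<nu> + lam) (\<nu> + lam) + 2 * dform (rho Pos) (\<nu> + lam)) *\<^sub>C v
    + 2 *\<^sub>C (\<Sum>i\<in>{1..k}. vm.f (uea_inj (Y i) * uea_inj (X i) * v))"
proof -
  let ?k = "\<nu> + lam" and ?YX = "\<Sum>i\<in>{1..k}. vm.f (uea_inj (Y i) * uea_inj (X i) * v)"
  have k: "?k \<in> h_dual h" using n lam h_dual_add by blast
  have xy: "vm.f (uea_inj (X i) * uea_inj (Y i) * v) =
      vm.f (uea_inj (Y i) * uea_inj (X i) * v) + ?k (sharp (al i)) *\<^sub>C v" if "i \<in> {1..k}" for i
  proof -
    have "lie (X i) (Y i) = sharp (al i)"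
      using lie_root_vectors[OF al_h_dual X Y] XY that by (simp add: cscale_one)
    then have "uea_inj (X i) * uea_inj (Y i) = uea_inj (Y i) * uea_inj (X i) + uea_inj (sharp (al i))"
      using uea_inj_lie[of "X i" "Y i"] by simp
    then show ?thesis
      using f_H[OF v sharp_in_h[OF al_h_dual[OF that]]] by (simp add: distrib_right clinear_add[OF vm.clinear_f])
  qed
  have hh: "vm.f (uea_inj b * uea_inj (Hd b) * v) = (?k b * ?k (Hd b)) *\<^sub>C v" if "b \<in> wbasis \<inter> h" for b
  proof -
    have "vm.f (uea_inj b * uea_inj (Hd b) * v) = vm.f (uea_inj b * vm.f (uea_inj (Hd b) * v))"
      by (simp add: vm.f_mult_f mult.assoc)
    then show ?thesis
      using f_H[OF v, of b] f_H[OF v Hd_h, of b] that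
      by (simp add: cscale_mult_right clinear_scale[OF vm.clinear_f] cscale_cscale mult.commute)
  qed
  have "vm.f (Cas * v) = (\<Sum>i\<in>{1..k}. vm.f (uea_inj (X i) * uea_inj (Y i) * v)) + ?YX
      + (\<Sum>b\<in>wbasis \<inter> h. vm.f (uea_inj b * uea_inj (Hd b) * v))"
    by (simp add: Cas_def sum_cI ce_def cd_def distrib_right sum_distrib_right clinear_add[OF vm.clinear_f]
        clinear_sum[OF vm.clinear_f])
  also have "\<dots> = (?YX + (\<Sum>i\<in>{1..k}. ?k (sharp (al i))) *\<^sub>C v) + ?YX
      + (\<Sum>b\<in>wbasis \<inter> h. ?k b * ?k (Hd b)) *\<^sub>C v"
    using xy hh by (simp add: sum.distrib cvs.scale_sum_left del: plus_fun_apply)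
  also have "\<dots> = (?YX + (2 * dform (rho Pos) ?k) *\<^sub>C v) + ?YX + dform ?k ?k *\<^sub>C v"
    unfolding sum_sharp[OF k] sum_Hd[OF k] ..
  also have "\<dots> = (dform ?k ?k + 2 * dform (rho Pos) ?k) *\<^sub>C v + 2 *\<^sub>C ?YX"
    using cscale_add_left[of 1 1 ?YX] by (simp add: cscale_add_left cscale_one algebra_simps)
  finally show ?thesis .
qed

lemma casimir_recursion:
  assumes v: "v \<in> U nm" "v \<in> ws (- \<mu>)" and m: "\<mu> \<in> h_dual h"
  shows "(\<Sum>i\<in>{1..k}. vm.f (uea_inj (Y i) * uea_inj (X i) * v)) = - p_coeff Pos lam \<mu> *\<^sub>C v"
    (is "?YX = _")
proof -
  have lins: "clinear lam" "clinear \<mu>" "clinear (- \<mu>)" "clinear (rho Pos)"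
    using lam m rho_h_dual clinear_h_dual by auto
  \<comment> \<open>On the highest weight vector the Y X terms vanish.\<close>
  have one: "vm.f (Cas * 1) = (dform lam lam + 2 * dform (rho Pos) lam) *\<^sub>C 1"
    using f_Cas[OF U_one ws_one h_dual_0] f_X_right by simp
  have "vm.f (Cas * v) = vm.f (v * Cas)" by (simp add: Cas_commute)
  also have "\<dots> = (dform lam lam + 2 * dform (rho Pos) lam) *\<^sub>C v"
    using one by (simp add: vm.f_mult_U v cscale_mult_right)
  finally have "(dform lam lam + 2 * dform (rho Pos) lam) *\<^sub>C v =
      (dform (- \<mu> + lam) (- \<mu> + lam) + 2 * dform (rho Pos) (- \<mu> + lam)) *\<^sub>C v + 2 *\<^sub>C ?YX"
    using f_Cas[OF v] m by simp
  then have "2 *\<^sub>C ?YX = ((dform lam lam + 2 * dform (rho Pos) lam) -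
      (dform (- \<mu> + lam) (- \<mu> + lam) + 2 * dform (rho Pos) (- \<mu> + lam))) *\<^sub>C v"
    by (simp add: cvs.scale_left_diff_distrib)
  \<comment> \<open>The eigenvalues at lam and lam - \<mu> differ by - 2 times
    \<open>p_coeff\<close>; the factor 2 also stands before the Y X terms and cancels.\<close>
  also have "(dform lam lam + 2 * dform (rho Pos) lam) -
      (dform (- \<mu> + lam) (- \<mu> + lam) + 2 * dform (rho Pos) (- \<mu> + lam)) = 2 * - p_coeff Pos lam \<mu>"
    using lins dform_commute[of \<mu> lam]
    by (simp add: p_coeff_def dform_add_left dform_add_right dform_minus_left dform_minus_right del: add_uminus_conv_diff uminus_add_conv_diff)
  finally have "(1/2) *\<^sub>C (2 *\<^sub>C ?YX) = (1/2) *\<^sub>C ((2 * - p_coeff Pos lam \<mu>) *\<^sub>C v)" by simp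
  then show ?thesis by (simp add: cscale_cscale cscale_one)
qed

end

section \<open>Expansion along words\<close>

context shapovalov_data
begin

abbreviation "words \<equiv> {w. set w \<subseteq> {1..k}}"
abbreviation "wtw \<equiv> word_weight al"
abbreviation "Wt \<equiv> W_tilde h lam Pos k al"
definition "Wmu \<mu> = {w \<in> Wt. wtw w = \<mu>}"
definition "cw w = inverse (p_word Pos lam al w (wtw w))"

lemma wtw_simps [simp]: "wtw [] = 0" "wtw (i # w) = al i + wtw w"
  by (simp_all add: word_weight_def)

lemma wtw_h_dual: "w \<in> words \<Longrightarrow> wtw w \<in> h_dual h"
proof (induction w)
  case (Cons i w)
  then have "i \<in> {1..k}" "wtw w \<in> h_dual h" by auto
  then show ?case unfolding wtw_simps by (intro h_dual_add al_h_dual)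
qed (simp only: wtw_simps h_dual_0)

lemma map_al_Pos: "w \<in> words \<Longrightarrow> set (map al w) \<subseteq> Pos"
  using al_Pos by auto

lemma wtw_nonzero: "w \<in> words \<Longrightarrow> w \<noteq> [] \<Longrightarrow> wtw w \<noteq> 0"
  using Pos_sum_nonzero[OF map_al_Pos] unfolding word_weight_def by blast

lemma word_of_roots: "set \<beta>s \<subseteq> Pos \<Longrightarrow> \<exists>w\<in>words. map al w = \<beta>s"
proof (induction \<beta>s)
  case (Cons b \<beta>s)
  then obtain w where "w \<in> words" "map al w = \<beta>s" by auto
  moreover obtain i where "i \<in> {1..k}" "al i = b"
    using Cons.prems bij by (auto simp: bij_betw_def)
  ultimately show ?case by (intro bexI[of _ "i # w"]) auto
qed auto

text \<open>This bounds the length of the words of a given weight, the induction measure of the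
  expansion, and makes all sums over words finite.\<close>

lemma finite_words: "finite {w \<in> words. wtw w = \<mu>}"
proof (rule finite_imageD)
  have "map al ` {w \<in> words. wtw w = \<mu>} \<subseteq> {l. set l \<subseteq> Pos \<and> sum_list l = \<mu>}"
    using map_al_Pos unfolding word_weight_def by blast
  then show "finite (map al ` {w \<in> words. wtw w = \<mu>})"
    using finite_lists_with_sum[OF finite_Pos Pos_sum_nonzero] finite_subset by blast
  show "inj_on (map al) {w \<in> words. wtw w = \<mu>}"
  proof (rule inj_on_subset)
    show "inj_on (map al) (lists {1..k})"
      by (rule inj_on_map_lists[OF bij_betw_imp_inj_on[OF bij]])
  qed auto
qed

lemma Wt_words: "Wt \<subseteq> words"
  by (auto simp: W_tilde_def)

lemma finite_Wmu: "finite (Wmu \<mu>)"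
  by (rule finite_subset[OF _ finite_words[of \<mu>]]) (use Wt_words in \<open>auto simp: Wmu_def\<close>)

lemma Wt_Nil: "[] \<in> Wt"
  by (simp add: W_tilde_def)

text \<open>The condition for j = 1 concerns the whole word, since \<open>drop 0\<close> removes
  nothing; the others are the conditions for w shifted by one.\<close>

lemma Wt_Cons: "i # w \<in> Wt \<longleftrightarrow> i \<in> {1..k} \<and> w \<in> Wt \<and> al i + wtw w \<in> nat_cone hp"
proof -
  have "(\<forall>j\<in>{1..length (i # w)}. wtw (drop (j - 1) (i # w)) \<in> nat_cone hp) \<longleftrightarrow>
      wtw (i # w) \<in> nat_cone hp \<and> (\<forall>j\<in>{1..length w}. wtw (drop (j - 1) w) \<in> nat_cone hp)"
    (is "?l \<longleftrightarrow> ?r")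
  proof
    assume l: ?l
    have "wtw (drop (j - 1) w) \<in> nat_cone hp" if "j \<in> {1..length w}" for j
      using bspec[OF l, of "Suc j"] that by (cases j) auto
    then show ?r using bspec[OF l, of 1] by simp
  next
    assume r: ?r
    show ?l
    proof
      fix j assume j: "j \<in> {1..length (i # w)}"
      then obtain m where m: "j = Suc m" by (cases j) auto
      show "wtw (drop (j - 1) (i # w)) \<in> nat_cone hp"
      proof (cases m)
        case (Suc n)
        then have "m \<in> {1..length w}" using j m by auto
        then show ?thesis using r m Suc by fastforce
      qed (use r m in simp)
    qed
  qed
  then show ?thesis unfolding W_tilde_def by auto
qed

text \<open>The new factor belongs to the empty prefix and hence to the full weight; the other
  factors are those of w.\<close>

lemma cw_Cons: "cw (i # w) = inverse (p_coeff Pos lam (al i + wtw w)) * cw w"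
proof -
  have "p_word Pos lam al (i # w) (al i + wtw w) =
      p_coeff Pos lam (al i + wtw w) * p_word Pos lam al w (wtw w)"
    unfolding p_word_def length_Cons
    by (subst prod.lessThan_Suc_shift) (simp add: algebra_simps)
  then show ?thesis by (simp add: cw_def)
qed

lemma cw_Nil: "cw [] = 1"
  by (simp add: cw_def p_word_def)

lemma finite_hp: "finite hp" and finite_hm: "finite hm"
  using finite_Pos by auto

text \<open>A nonzero v involves a word in roots of \<open>hm\<close> with weight - \<mu>. Along the
  recursion, vectors whose weight leaves the cone are therefore 0, and exactly the words of
  \<open>W_tilde\<close> remain.\<close>

lemma U_nm_weight:
  assumes "v \<in> U nm" "v \<in> ws (- \<mu>)" "\<mu> \<in> h_dual h" "v \<noteq> 0"
  shows "\<mu> \<in> nat_cone hp"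
proof -
  have "v \<in> gdeg hm (- \<mu>)"
    using U_ws_gdeg[of hm v "- \<mu>"] assms hat_h_dual by (auto simp: nm_root)
  then obtain \<beta>s where b: "set \<beta>s \<subseteq> hm" "sum_list \<beta>s = - \<mu>"
    using gdeg_nonzero assms(4) by blast
  have "sum_list (map uminus \<beta>s) = - sum_list \<beta>s" by (induction \<beta>s) auto
  then have "sum_list (map uminus \<beta>s) = \<mu>" using b by simp
  moreover have "set (map uminus \<beta>s) \<subseteq> hp" using b(1) by (auto simp: hat_minus)
  ultimately show ?thesis unfolding nat_cone_lists[OF finite_hp] by blast
qed

text \<open>The start of the recursion: a nonempty word in negative roots cannot have weight
  0.\<close>

lemma U_nm_weight_0:
  assumes "v \<in> U nm" "v \<in> ws 0"
  shows "\<exists>c. v = c *\<^sub>C 1"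
proof -
  have v: "v \<in> gdeg hm 0"
    using U_ws_gdeg[of hm v 0] assms hat_h_dual h_dual_0 by (auto simp: nm_root)
  have "xs = []" if "list_all2 (\<lambda>x \<beta>. \<beta> \<in> hm \<and> x \<in> rs \<beta>) xs \<beta>s" "sum_list \<beta>s = 0" for xs \<beta>s
  proof -
    have "set \<beta>s \<subseteq> uminus ` Pos"
      using that(1) by (induction rule: list_all2_induct) (simp, simp only: list.set insert_subset, blast)
    moreover have "l = []" if "set l \<subseteq> uminus ` Pos" "sum_list l = 0" for l
      using triangular.Pos_sum_nonzero[OF triangular_minus_Pos] that by blast
    ultimately have "\<beta>s = []" using that(2) by blast
    then show ?thesis using that(1) by simp
  qed
  then have "gdeg hm 0 \<subseteq> cvs.span {1}"
    unfolding gdeg_def by (intro cvs.span_mono) (use uword_simps(1) in blast)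
  then show ?thesis using v unfolding cvs.span_singleton by auto
qed

lemma nat_cone_word: "\<mu> \<in> nat_cone hp \<Longrightarrow> \<exists>w\<in>words. wtw w = \<mu>"
proof -
  assume "\<mu> \<in> nat_cone hp"
  then obtain l where "set l \<subseteq> hp" "sum_list l = \<mu>" unfolding nat_cone_lists[OF finite_hp] by blast
  then show ?thesis using word_of_roots[of l] by (auto simp: word_weight_def)
qed

lemma word_product_simps [simp]: "word_product Z [] = 1" "word_product Z (i # w) = uea_inj (Z i) * word_product Z w"
  by (simp_all add: word_product_def)

lemma word_product_X_ws: "w \<in> words \<Longrightarrow> word_product X w \<in> ws (wtw w)"
  by (induction w) (use ws_one in \<open>auto intro!: ws_mult ws_inj X\<close>)

lemma word_product_Y_ws: "w \<in> words \<Longrightarrow> word_product Y w \<in> ws (- wtw w)"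
proof (induction w)
  case Nil
  show ?case unfolding wtw_simps word_product_simps minus_zero by (rule ws_one)
next
  case (Cons i w)
  have "- wtw (i # w) = - al i + - wtw w" unfolding wtw_simps by (rule minus_add_distrib)
  moreover have "i \<in> {1..k}" "w \<in> words" using Cons.prems by auto
  ultimately show ?case
    unfolding word_product_simps by (simp only:) (intro ws_mult ws_inj Y Cons.IH)
qed

abbreviation "expansion v \<mu> \<equiv>
  \<Sum>w\<in>Wmu \<mu>. (cw w * phi (antipode (word_product X w) * v)) *\<^sub>C vm.f (word_product Y w)"

lemma Wmu_0: "Wmu 0 = {[]}"
  using Wt_Nil wtw_nonzero Wt_words by (auto simp: Wmu_def)

text \<open>As \<mu> lies in the cone, the condition on the whole word holds automatically, so words
  of weight \<mu> correspond to a first letter together with a word of the remaining weight.\<close>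

lemma sum_Wmu:
  assumes "\<mu> \<in> nat_cone hp" "\<mu> \<noteq> 0"
  shows "(\<Sum>w\<in>Wmu \<mu>. g w) = (\<Sum>i\<in>{1..k}. \<Sum>w\<in>Wmu (\<mu> - al i). g (i # w))"
proof -
  let ?S = "SIGMA i:{1..k}. Wmu (\<mu> - al i)"
  have "Wmu \<mu> = (\<lambda>(i, w). i # w) ` ?S"
  proof (intro equalityI subsetI)
    fix w assume w: "w \<in> Wmu \<mu>"
    then obtain i w' where e: "w = i # w'" using assms(2) by (cases w) (auto simp: Wmu_def)
    then have "(i, w') \<in> ?S" using w by (auto simp: Wmu_def Wt_Cons)
    then show "w \<in> (\<lambda>(i, w). i # w) ` ?S" using e by force
  next
    fix w assume "w \<in> (\<lambda>(i, w). i # w) ` ?S"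
    then show "w \<in> Wmu \<mu>" using assms(1) by (auto simp: Wmu_def Wt_Cons)
  qed
  moreover have "inj_on (\<lambda>(i, w). i # w) ?S" by (auto simp: inj_on_def)
  ultimately have "(\<Sum>w\<in>Wmu \<mu>. g w) = (\<Sum>(i, w)\<in>?S. g (i # w))"
    by (simp add: sum.reindex case_prod_unfold comp_def)
  then show ?thesis by (simp add: sum.Sigma finite_Wmu)
qed

lemma word_expansion:
  assumes "v \<in> U nm" "v \<in> ws (- \<mu>)" "\<mu> \<in> h_dual h"
  shows "v = expansion v \<mu>"
proof -
  \<comment> \<open>The induction is on a bound n for the lengths of all words of weight \<mu>;
    passing to \<open>\<mu> - al i\<close> lowers the bound by one.\<close>
  have "v = expansion v \<mu>"
    if "v \<in> U nm" "v \<in> ws (- \<mu>)" "\<mu> \<in> h_dual h" "\<And>w. w \<in> words \<Longrightarrow> wtw w = \<mu> \<Longrightarrow> length w \<le> n" for n v \<mu>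
    using that
  proof (induction n arbitrary: v \<mu>)
    case (0 v \<mu>)
    show ?case
    proof (cases "v = 0")
      case True
      then show ?thesis by (simp add: clinear_zero[OF clinear_phi])
    next
      case False
      then obtain w where "w \<in> words" "wtw w = \<mu>"
        using U_nm_weight[OF 0(1-3)] nat_cone_word by blast
      \<comment> \<open>The bound 0 leaves only the empty word.\<close>
      then have "\<mu> = 0" using 0(4)[of w] by simp
      then obtain c where "v = c *\<^sub>C 1" using U_nm_weight_0 0(1,2) unfolding \<open>\<mu> = 0\<close> minus_zero by blast
      then show ?thesis
        unfolding \<open>\<mu> = 0\<close> Wmu_0 by (simp add: cw_Nil clinear_scale[OF clinear_phi] phi_one vm.f_U[OF U_one])
    qed
  next
    case (Suc n v \<mu>)
    show ?case
    proof (cases "v = 0")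
      case True
      then show ?thesis by (simp add: clinear_zero[OF clinear_phi])
    next
      case False
      note m = U_nm_weight[OF Suc.prems(1-3) False]
      show ?thesis
      proof (cases "\<mu> = 0")
        case True
        then obtain c where "v = c *\<^sub>C 1" using U_nm_weight_0 Suc.prems(1,2) unfolding True minus_zero by blast
        then show ?thesis
          unfolding True Wmu_0 by (simp add: cw_Nil clinear_scale[OF clinear_phi] phi_one vm.f_U[OF U_one])
      next
        case mu: False
        let ?p = "p_coeff Pos lam \<mu>" and ?E = "\<lambda>i. vm.f (uea_inj (X i) * v)"
        have p: "?p \<noteq> 0" using p_nonzero[OF m mu] .
        have E: "?E i = expansion (?E i) (\<mu> - al i)" if i: "i \<in> {1..k}" for i
        proof (rule Suc.IH)
          show "?E i \<in> U nm" by (rule vm.f_in_U)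
          have e: "al i + - \<mu> = - (\<mu> - al i)" by simp
          show "?E i \<in> ws (- (\<mu> - al i))"
            using f_ws[OF ws_mult[OF ws_inj[OF X[OF i]] Suc.prems(2)]] unfolding e .
          show "\<mu> - al i \<in> h_dual h" by (rule h_dual_diff[OF Suc.prems(3) al_h_dual[OF i]])
          fix w assume "w \<in> words" "wtw w = \<mu> - al i"
          then show "length w \<le> n" using Suc.prems(4)[of "i # w"] i by simp
        qed
        have FE: "vm.f (uea_inj (Y i) * uea_inj (X i) * v) =
            (\<Sum>w\<in>Wmu (\<mu> - al i). - ?p *\<^sub>C ((cw (i # w) * phi (antipode (word_product X (i # w)) * v)) *\<^sub>C
              vm.f (word_product Y (i # w))))" if i: "i \<in> {1..k}" for i
        proof -
          have "vm.f (uea_inj (Y i) * uea_inj (X i) * v) = vm.f (uea_inj (Y i) * expansion (?E i) (\<mu> - al i))"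
            unfolding E[OF i, symmetric] by (simp add: vm.f_mult_f mult.assoc)
          also have "\<dots> = (\<Sum>w\<in>Wmu (\<mu> - al i). (cw w * phi (antipode (word_product X w) * ?E i)) *\<^sub>C
              vm.f (word_product Y (i # w)))"
            by (simp add: sum_distrib_left cscale_mult_right clinear_sum[OF vm.clinear_f]
                clinear_scale[OF vm.clinear_f] vm.f_mult_f)
          also have "\<dots> = (\<Sum>w\<in>Wmu (\<mu> - al i). - ?p *\<^sub>C ((cw (i # w) *
              phi (antipode (word_product X (i # w)) * v)) *\<^sub>C vm.f (word_product Y (i # w))))"
          proof (rule sum.cong[OF refl])
            fix w assume "w \<in> Wmu (\<mu> - al i)"
            then have c: "cw (i # w) = inverse ?p * cw w" by (simp add: cw_Cons Wmu_def)
            \<comment> \<open>The sign of the antipode on the letter \<open>X i\<close> cancels the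
              minus sign of the Casimir identity.\<close>
            have ph: "phi (antipode (word_product X (i # w)) * v) = - phi (antipode (word_product X w) * ?E i)"
              by (simp add: antipode_mult antipode_inj phi_mult_f mult.assoc clinear_minus[OF clinear_phi])
            show "(cw w * phi (antipode (word_product X w) * ?E i)) *\<^sub>C vm.f (word_product Y (i # w)) =
              - ?p *\<^sub>C ((cw (i # w) * phi (antipode (word_product X (i # w)) * v)) *\<^sub>C vm.f (word_product Y (i # w)))"
              unfolding c ph cscale_cscale using p by (simp add: field_simps)
          qed
          finally show ?thesis .
        qed
        have "- ?p *\<^sub>C v = (\<Sum>i\<in>{1..k}. vm.f (uea_inj (Y i) * uea_inj (X i) * v))"
          by (rule casimir_recursion[OF Suc.prems(1-3), symmetric])
        also have "\<dots> = (\<Sum>i\<in>{1..k}. \<Sum>w\<in>Wmu (\<mu> - al i). - ?p *\<^sub>C ((cw (i # w) *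
            phi (antipode (word_product X (i # w)) * v)) *\<^sub>C vm.f (word_product Y (i # w))))"
          by (rule sum.cong[OF refl FE])
        also have "\<dots> = - ?p *\<^sub>C expansion v \<mu>"
          unfolding sum_Wmu[OF m mu] cvs.scale_sum_right ..
        finally show ?thesis using p by simp
      qed
    qed
  qed
  moreover have "length w \<le> Max (length ` {w \<in> words. wtw w = \<mu>})" if "w \<in> words" "wtw w = \<mu>" for w
    using that finite_words[of \<mu>] by (intro Max_ge) auto
  ultimately show ?thesis using assms by blast
qed

subsection \<open>Exchanging the two nilpotent subalgebras\<close>

text \<open>The vectors \<mu>, \<rho> and lam all change sign, which leaves each bilinear term
  unchanged.\<close>

lemma p_coeff_swap: "\<mu> \<in> h_dual h \<Longrightarrow> p_coeff (uminus ` Pos) (- lam) (- \<mu>) = p_coeff Pos lam \<mu>"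
proof -
  assume m: "\<mu> \<in> h_dual h"
  have "rho (uminus ` Pos) = - rho Pos"
    by (auto simp: rho_def fun_eq_iff sum.reindex sum_negf)
  then show ?thesis
    using m lam rho_h_dual clinear_h_dual by (simp add: p_coeff_def dform_minus_left dform_minus_right)
qed

lemma nat_cone_swap: "\<mu> \<in> nat_cone hm \<longleftrightarrow> - \<mu> \<in> nat_cone hp"
proof -
  have s: "sum_list (map uminus l) = - sum_list l" for l :: "('g \<Rightarrow> complex) list"
    by (induction l) auto
  have 1: "set (map uminus l) \<subseteq> hm" if "set l \<subseteq> hp" for l
    using that by (auto simp: hat_minus)
  have 2: "set (map uminus l) \<subseteq> hp" if "set l \<subseteq> hm" for l
    using that by (auto simp: hat_minus)
  show ?thesis
    unfolding nat_cone_lists[OF finite_hp] nat_cone_lists[OF finite_hm]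
  proof
    assume "\<mu> \<in> {sum_list l |l. set l \<subseteq> hm}"
    then obtain l where "\<mu> = sum_list l" "set l \<subseteq> hm" by blast
    then have "- \<mu> = sum_list (map uminus l)" "set (map uminus l) \<subseteq> hp" using s 2 by auto
    then show "- \<mu> \<in> {sum_list l |l. set l \<subseteq> hp}" by blast
  next
    assume "- \<mu> \<in> {sum_list l |l. set l \<subseteq> hp}"
    then obtain l where "- \<mu> = sum_list l" "set l \<subseteq> hp" by blast
    then have "\<mu> = sum_list (map uminus l)" "set (map uminus l) \<subseteq> hm"
      unfolding s using 1[of l] by (metis minus_minus, blast)
    then show "\<mu> \<in> {sum_list l |l. set l \<subseteq> hm}" by blast
  qed
qed

lemma hp_swap: "roots_hat h (- lam) \<inter> uminus ` Pos = hm"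
  by (simp add: hat_orth_minus_lam)

lemma nat_cone_h_dual: "\<mu> \<in> nat_cone hp \<Longrightarrow> \<mu> \<in> h_dual h"
  unfolding nat_cone_lists[OF finite_hp] using h_dual_sum_list Pos_h_dual by blast

text \<open>With X and Y exchanged as well, all assumptions persist, so the expansion on U(n+) is
  the one on U(n-) for these data.\<close>

lemma swapped: "shapovalov_data h (- lam) (uminus ` Pos) k (\<lambda>i. - al i) Y X"
proof -
  interpret a: triangular h "- lam" "uminus ` Pos"
    by (rule triangular.triangular_minus_lam[OF triangular_minus_Pos])
  show ?thesis
  proof
    show "bij_betw (\<lambda>i. - al i) {1..k} (uminus ` Pos)"
    proof -
      have "bij_betw uminus Pos (uminus ` Pos)" by (rule inj_on_imp_bij_betw) (simp add: inj_on_def)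
      from bij_betw_trans[OF bij this] show ?thesis by (simp add: comp_def)
    qed
    show "p_coeff (uminus ` Pos) (- lam) \<mu> \<noteq> 0"
      if "\<mu> \<in> nat_cone (roots_hat h (- lam) \<inter> uminus ` Pos)" "\<mu> \<noteq> 0" for \<mu>
    proof -
      have "- \<mu> \<in> nat_cone hp" using that(1) by (simp add: hp_swap nat_cone_swap)
      then show ?thesis
        using p_nonzero[of "- \<mu>"] p_coeff_swap[OF nat_cone_h_dual, of "- \<mu>"] that(2) by simp
    qed
  qed (use X Y killing_YX in auto)
qed

end

section \<open>Dual bases and the canonical element\<close>

context shapovalov_data
begin

text \<open>h acts by lam on both sides of \<open>phi\<close>, so \<open>phi\<close> can be nonzero
  only on weight 0.\<close>

lemma phi_ws: "z \<in> ws \<kappa> \<Longrightarrow> \<kappa> \<in> h_dual h \<Longrightarrow> phi z \<noteq> 0 \<Longrightarrow> \<kappa> = 0"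
proof (rule h_dual_eqI[OF _ h_dual_0])
  fix H assume z: "z \<in> ws \<kappa>" "phi z \<noteq> 0" and H: "H \<in> h"
  then have "H \<in> gl" using h_subset_gl by blast
  then have "phi (uea_inj H * z - z * uea_inj H) = 0"
    by (simp add: clinear_diff[OF clinear_phi] phi_gl_left phi_gl_right)
  then show "\<kappa> H = 0 H" using z H by (simp add: ws_def clinear_scale[OF clinear_phi])
qed

abbreviation "sh \<equiv> shapovalov h lam Pos"
definition "pp w = pi_plus h lam Pos (word_product X w)"
definition "pm w = pi_minus h lam Pos (word_product Y w)"

lemma sh_linear: "clinear (\<lambda>u. sh u v)" "clinear (sh u)"
proof -
  have "clinear (\<lambda>u. phi (antipode u * v))" "clinear (\<lambda>v. phi (antipode u * v))"
    using clinear_compose[OF clinear_phi clinear_compose[OF clinear_mult_right clinear_antipode]]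
      clinear_compose[OF clinear_phi clinear_mult_left] by auto
  moreover have "sh u = (\<lambda>v. phi (antipode u * v))" by (rule ext) (rule shapovalov_eq)
  ultimately show "clinear (\<lambda>u. sh u v)" "clinear (sh u)" by (simp_all add: shapovalov_eq)
qed

lemma nm_swap: "n_minus h (- lam) (uminus ` Pos) = np" and np_swap: "n_plus h (- lam) (uminus ` Pos) = nm"
  by (simp_all add: np_minus_lam nm_minus_lam nm_eq) (simp add: n_plus_def n_minus_def uminus_uminus_image)

lemma pm_in: "w \<in> words \<Longrightarrow> pm w \<in> U nm \<and> pm w \<in> ws (- wtw w)"
  unfolding pm_def pi_minus_eq by (rule conjI[OF vm.f_in_U f_ws[OF word_product_Y_ws]])

lemma wtw_swap: "word_weight (\<lambda>i. - al i) w = - wtw w"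
proof (induction w)
  case (Cons i w)
  have "word_weight (\<lambda>i. - al i) (i # w) = - al i + word_weight (\<lambda>i. - al i) w"
    by (simp only: word_weight_def list.map sum_list.Cons)
  then show ?case by (simp only: Cons wtw_simps minus_add_distrib)
qed (simp add: word_weight_def)

lemma Wt_swap: "W_tilde h (- lam) (uminus ` Pos) k (\<lambda>i. - al i) = Wt"
  unfolding W_tilde_def wtw_swap hp_swap nat_cone_swap minus_minus ..

lemma p_word_swap:
  assumes "w \<in> words"
  shows "p_word (uminus ` Pos) (- lam) (\<lambda>i. - al i) w (- wtw w) = p_word Pos lam al w (wtw w)"
  unfolding p_word_def
proof (rule prod.cong[OF refl])
  fix i
  have t: "take i w \<in> words" using assms set_take_subset by fastforce
  have e: "- wtw w - word_weight (\<lambda>i. - al i) (take i w) = - (wtw w - wtw (take i w))"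
    unfolding wtw_swap by simp
  show "p_coeff (uminus ` Pos) (- lam) (- wtw w - word_weight (\<lambda>i. - al i) (take i w)) =
      p_coeff Pos lam (wtw w - wtw (take i w))"
    unfolding e by (rule p_coeff_swap[OF h_dual_diff[OF wtw_h_dual[OF assms] wtw_h_dual[OF t]]])
qed

text \<open>The three statements share the interpretation \<open>fl\<close> of the locale for the
  exchanged data.\<close>

lemma
  shows pp_in: "w \<in> words \<Longrightarrow> pp w \<in> U np \<and> pp w \<in> ws (wtw w)"
    and expand_minus: "v \<in> U nm \<Longrightarrow> v \<in> ws (- \<mu>) \<Longrightarrow> \<mu> \<in> h_dual h \<Longrightarrow>
      v = (\<Sum>w\<in>Wmu \<mu>. (cw w * sh (pp w) v) *\<^sub>C pm w)"
    and expand_plus: "u \<in> U np \<Longrightarrow> u \<in> ws \<mu> \<Longrightarrow> \<mu> \<in> h_dual h \<Longrightarrow>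
      u = (\<Sum>w\<in>Wmu \<mu>. (cw w * sh u (pm w)) *\<^sub>C pp w)"
proof -
  interpret fl: shapovalov_data h "- lam" "uminus ` Pos" k "\<lambda>i. - al i" Y X by (rule swapped)
  have pp: "pp w = fl.vm.f (word_product X w)" for w
    by (simp add: pp_def pi_plus_eq fl.pi_minus_eq)
  have fU: "fl.vm.f z \<in> U np" for z
    by (rule subst[OF arg_cong[OF nm_swap, of U], of "\<lambda>A. fl.vm.f z \<in> A"]) (rule fl.vm.f_in_U)
  show "pp w \<in> U np \<and> pp w \<in> ws (wtw w)" if "w \<in> words"
    unfolding pp using fU fl.f_ws[OF word_product_X_ws[OF that]] by (rule conjI)
  \<comment> \<open>The antipode reverses products, so left conditions on one functional become
    right conditions on the other; on the stabilizer its sign cancels that of -lam.\<close>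
  have "phi = (\<lambda>z. fl.phi (antipode z))"
  proof (rule phi_unique[symmetric])
    show "clinear (\<lambda>z. fl.phi (antipode z))" by (rule clinear_compose[OF fl.clinear_phi clinear_antipode])
    show "fl.phi (antipode 1) = 1" by (simp add: fl.phi_one)
    show "fl.phi (antipode (uea_inj a * z)) = 0" if "a \<in> nm" for a z
      using fl.phi_np_right[of a] that
      by (simp add: antipode_mult antipode_inj np_swap clinear_minus[OF fl.clinear_phi])
    show "fl.phi (antipode (z * uea_inj x)) = lam x * fl.phi (antipode z)" if "x \<in> gl" for x z
      using fl.phi_gl_left[of x] that
      by (simp add: antipode_mult antipode_inj gl_minus_lam clinear_minus[OF fl.clinear_phi])
    show "fl.phi (antipode (z * uea_inj x)) = 0" if "x \<in> np" for x z
      using fl.phi_nm_left[of x] that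
      by (simp add: antipode_mult antipode_inj nm_swap clinear_minus[OF fl.clinear_phi])
  qed
  then have phi: "phi z = fl.phi (antipode z)" for z by metis
  \<comment> \<open>After passing to \<open>fl.phi\<close>, the word in the X becomes a right factor
    and may be replaced by its projection.\<close>
  have *: "phi (antipode (word_product X w) * v) = sh (pp w) v" for w v
    unfolding shapovalov_eq phi pp by (simp add: antipode_mult fl.phi_mult_f)
  show "v = (\<Sum>w\<in>Wmu \<mu>. (cw w * sh (pp w) v) *\<^sub>C pm w)"
    if "v \<in> U nm" "v \<in> ws (- \<mu>)" "\<mu> \<in> h_dual h"
    using word_expansion[OF that] unfolding * pm_def pi_minus_eq .
  have **: "fl.phi (antipode (word_product Y w) * u) = sh u (pm w)" for w u
    unfolding shapovalov_eq pm_def pi_minus_eq phi_mult_f unfolding phi by (simp add: antipode_mult)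
  have W: "fl.Wmu (- \<mu>) = Wmu \<mu>"
    unfolding fl.Wmu_def Wmu_def Wt_swap wtw_swap by (metis minus_minus)
  have c: "fl.cw w = cw w" if "w \<in> Wmu \<mu>" for w
    using p_word_swap[of w] that Wt_words unfolding fl.cw_def cw_def wtw_swap Wmu_def by auto
  show "u = (\<Sum>w\<in>Wmu \<mu>. (cw w * sh u (pm w)) *\<^sub>C pp w)"
    if u: "u \<in> U np" "u \<in> ws \<mu>" and m: "\<mu> \<in> h_dual h"
  proof -
    have "u \<in> U fl.nm" "u \<in> ws (- (- \<mu>))" "- \<mu> \<in> h_dual h" using u m by (simp_all add: nm_swap)
    from fl.word_expansion[OF this] have "u = (\<Sum>w\<in>Wmu \<mu>. (fl.cw w * sh u (pm w)) *\<^sub>C pp w)"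
      unfolding ** W pp .
    then show ?thesis using c by (simp cong: sum.cong)
  qed
qed

section \<open>Orthogonality of degrees and non-degeneracy\<close>

lemma sh_ws:
  assumes "u \<in> ws \<mu>" "v \<in> ws \<nu>" "\<mu> \<in> h_dual h" "\<nu> \<in> h_dual h" "sh u v \<noteq> 0"
  shows "\<nu> = - \<mu>"
proof -
  have "\<mu> + \<nu> = 0"
    using phi_ws[OF ws_mult[OF antipode_ws[OF assms(1)] assms(2)] h_dual_add[OF assms(3,4)]] assms(5)
    by (simp add: shapovalov_eq)
  then show ?thesis by (simp add: add_eq_0_iff)
qed

lemma Wmu_words: "w \<in> Wmu \<mu> \<Longrightarrow> w \<in> words \<and> wtw w = \<mu>"
  using Wt_words by (auto simp: Wmu_def)

lemma hp_h_dual: "hp \<subseteq> h_dual h" and hm_h_dual: "hm \<subseteq> h_dual h"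
  using hat_h_dual by blast+

lemma U_np_decomposition: "z \<in> U np \<Longrightarrow>
    \<exists>F y. finite F \<and> F \<subseteq> h_dual h \<and> (\<forall>\<mu>\<in>F. y \<mu> \<in> U np \<and> y \<mu> \<in> ws \<mu>) \<and> z = (\<Sum>\<mu>\<in>F. y \<mu>)"
  unfolding np_eq by (rule U_homogeneous_decomposition[OF hp_h_dual])

lemma U_nm_decomposition: "z \<in> U nm \<Longrightarrow>
    \<exists>F y. finite F \<and> F \<subseteq> h_dual h \<and> (\<forall>\<mu>\<in>F. y \<mu> \<in> U nm \<and> y \<mu> \<in> ws \<mu>) \<and> z = (\<Sum>\<mu>\<in>F. y \<mu>)"
  unfolding nm_root by (rule U_homogeneous_decomposition[OF hm_h_dual])

text \<open>Each homogeneous component of a vector in the kernel of the pairing is itself orthogonal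
  to every \<open>pm w\<close>, respectively \<open>pp w\<close>, of opposite degree, because the
  other components do not contribute. The word expansion of this component then has only zero
  coefficients.\<close>

lemma nondegenerate: "nondegenerate_pairing (U np) (U nm) sh"
  unfolding nondegenerate_pairing_def
proof (intro conjI ballI impI)
  fix u assume u: "u \<in> U np" "\<forall>v\<in>U nm. sh u v = 0"
  obtain F y where F: "finite F" "F \<subseteq> h_dual h" "\<forall>\<mu>\<in>F. y \<mu> \<in> U np \<and> y \<mu> \<in> ws \<mu>" "u = (\<Sum>\<mu>\<in>F. y \<mu>)"
    using U_np_decomposition[OF u(1)] by (elim exE conjE)
  have "y \<mu> = 0" if m: "\<mu> \<in> F" for \<mu>
  proof -
    have md: "\<mu> \<in> h_dual h" using F(2) m by blast
    have "sh (y \<mu>) (pm w) = 0" if w: "w \<in> Wmu \<mu>" for w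
    proof -
      have pm: "pm w \<in> U nm" "pm w \<in> ws (- \<mu>)" using pm_in[of w] Wmu_words[OF w] by auto
      have z: "sh (y \<nu>) (pm w) = 0" if "\<nu> \<in> F" "\<nu> \<noteq> \<mu>" for \<nu>
        using sh_ws[of "y \<nu>" \<nu> "pm w" "- \<mu>"] F(2,3) that pm(2) md by fastforce
      have "sh u (pm w) = (\<Sum>\<nu>\<in>F. sh (y \<nu>) (pm w))"
        by (simp only: F(4) clinear_sum[OF sh_linear(1)])
      also have "\<dots> = (\<Sum>\<nu>\<in>F. if \<nu> = \<mu> then sh (y \<mu>) (pm w) else 0)"
        by (rule sum.cong[OF refl]) (use z in auto)
      finally show ?thesis using F(1) m u(2) pm(1) by simp
    qed
    then show ?thesis using expand_plus[of "y \<mu>" \<mu>] F(3) m md by simp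
  qed
  then show "u = 0" by (simp add: F(4))
next
  fix v assume v: "v \<in> U nm" "\<forall>u\<in>U np. sh u v = 0"
  obtain F y where F: "finite F" "F \<subseteq> h_dual h" "\<forall>\<mu>\<in>F. y \<mu> \<in> U nm \<and> y \<mu> \<in> ws \<mu>" "v = (\<Sum>\<mu>\<in>F. y \<mu>)"
    using U_nm_decomposition[OF v(1)] by (elim exE conjE)
  have "y \<mu> = 0" if m: "\<mu> \<in> F" for \<mu>
  proof -
    have md: "\<mu> \<in> h_dual h" using F(2) m by blast
    have "sh (pp w) (y \<mu>) = 0" if w: "w \<in> Wmu (- \<mu>)" for w
    proof -
      have pp: "pp w \<in> U np" "pp w \<in> ws (- \<mu>)" using pp_in[of w] Wmu_words[OF w] by auto
      have z: "sh (pp w) (y \<nu>) = 0" if "\<nu> \<in> F" "\<nu> \<noteq> \<mu>" for \<nu>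
        using sh_ws[of "pp w" "- \<mu>" "y \<nu>" \<nu>] F(2,3) that pp(2) md by fastforce
      have "sh (pp w) v = (\<Sum>\<nu>\<in>F. sh (pp w) (y \<nu>))"
        by (simp only: F(4) clinear_sum[OF sh_linear(2)])
      also have "\<dots> = (\<Sum>\<nu>\<in>F. if \<nu> = \<mu> then sh (pp w) (y \<mu>) else 0)"
        by (rule sum.cong[OF refl]) (use z in auto)
      finally show ?thesis using F(1) m v(2) pp(1) by simp
    qed
    then show ?thesis using expand_minus[of "y \<mu>" "- \<mu>"] F(3) m md by simp
  qed
  then show "v = 0" by (simp add: F(4))
qed

text \<open>Only u is required to be a basis; that v is one as well follows in
  \<open>dual_basis_v\<close>.\<close>

definition "dual_family I u v \<longleftrightarrow> inj_on u I \<and> cvs.independent (u ` I) \<and> cvs.span (u ` I) = U np \<and>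
  (\<forall>i\<in>I. \<exists>\<mu>\<in>h_dual h. u i \<in> ws \<mu> \<and> v i \<in> U nm \<and> v i \<in> ws (- \<mu>)) \<and>
  (\<forall>i\<in>I. \<forall>j\<in>I. sh (u i) (v j) = (if i = j then 1 else 0))"

text \<open>The bidegree (\<mu>, \<nu>) of the asserted formula, a finite sum. Both the sum over
  dual bases and the sum over words are compared with it.\<close>

definition "canon \<mu> \<nu> = (if \<nu> = - \<mu> then \<Sum>w\<in>Wmu \<mu>. cw w *\<^sub>C (pp w \<otimes>\<^sub>C pm w) else 0)"

context
  fixes I :: "'i set" and u v
  assumes dual: "dual_family I u v"
begin

definition "dg i = (SOME \<mu>. \<mu> \<in> h_dual h \<and> u i \<in> ws \<mu> \<and> v i \<in> U nm \<and> v i \<in> ws (- \<mu>))"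

lemma dg: "i \<in> I \<Longrightarrow> dg i \<in> h_dual h \<and> u i \<in> ws (dg i) \<and> v i \<in> U nm \<and> v i \<in> ws (- dg i)"
  unfolding dg_def
  by (rule someI_ex[of "\<lambda>\<mu>. \<mu> \<in> h_dual h \<and> u i \<in> ws \<mu> \<and> v i \<in> U nm \<and> v i \<in> ws (- \<mu>)"])
    (use dual in \<open>auto simp: dual_family_def\<close>)

lemma u_in: "i \<in> I \<Longrightarrow> u i \<in> U np"
  using dual cvs.span_base unfolding dual_family_def by blast

lemma sh_dual: "i \<in> I \<Longrightarrow> j \<in> I \<Longrightarrow> sh (u i) (v j) = (if i = j then 1 else 0)"
  using dual unfolding dual_family_def by blast

definition "Imu \<mu> = {i \<in> I. dg i = \<mu>}"

text \<open>The \<open>u i\<close> of degree \<mu> are independent and lie in the span of the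
  finitely many \<open>pp w\<close> with w of weight \<mu>.\<close>

lemma finite_Imu: "finite (Imu \<mu>)"
proof -
  have "u i \<in> cvs.span (pp ` Wmu \<mu>)" if "i \<in> Imu \<mu>" for i
  proof -
    have "i \<in> I" "dg i = \<mu>" using that by (auto simp: Imu_def)
    then have "u i = (\<Sum>w\<in>Wmu \<mu>. (cw w * sh (u i) (pm w)) *\<^sub>C pp w)"
      using expand_plus[of "u i" \<mu>] dg[of i] u_in by auto
    also have "\<dots> \<in> cvs.span (pp ` Wmu \<mu>)"
      by (intro cvs.span_sum cvs.span_scale cvs.span_base imageI)
    finally show ?thesis .
  qed
  then have "u ` Imu \<mu> \<subseteq> cvs.span (pp ` Wmu \<mu>)" by blast
  moreover have "cvs.independent (u ` Imu \<mu>)"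
    using dual unfolding dual_family_def
    by (elim conjE) (rule cvs.independent_mono, assumption, auto simp: Imu_def)
  ultimately have "finite (u ` Imu \<mu>)"
    using cvs.independent_span_bound[of "pp ` Wmu \<mu>"] finite_Wmu by blast
  moreover have "inj_on u (Imu \<mu>)"
    using dual unfolding dual_family_def by (elim conjE) (rule inj_on_subset, assumption, auto simp: Imu_def)
  ultimately show ?thesis using finite_imageD by blast
qed

text \<open>Pairing with \<open>v j\<close> extracts the j-th coefficient, which is 0 unless the
  degree of \<open>u j\<close> is \<mu>.\<close>

lemma expand_u:
  assumes "x \<in> U np" "x \<in> ws \<mu>" "\<mu> \<in> h_dual h"
  shows "x = (\<Sum>i\<in>Imu \<mu>. sh x (v i) *\<^sub>C u i)"
proof -
  have "u ` I \<subseteq> (\<Union>i\<in>I. cvs.span {u i})" by (auto intro: cvs.span_base)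
  from cvs.span_mono[OF this] have "x \<in> cvs.span (\<Union>i\<in>I. cvs.span {u i})"
    using assms(1) dual unfolding dual_family_def by blast
  from span_UN_subspace[OF cvs.subspace_span this]
  obtain J y where J: "finite J" "J \<subseteq> I" "\<forall>i\<in>J. y i \<in> cvs.span {u i}" "x = (\<Sum>i\<in>J. y i)" by blast
  then have "\<forall>i\<in>J. \<exists>c. y i = c *\<^sub>C u i" unfolding cvs.span_singleton by blast
  then obtain c where c: "\<And>i. i \<in> J \<Longrightarrow> y i = c i *\<^sub>C u i" by metis
  have x: "x = (\<Sum>i\<in>J. c i *\<^sub>C u i)" using J(4) c by simp
  have sx: "sh x (v j) = (if j \<in> J then c j else 0)" if "j \<in> I" for j
  proof -
    have "sh x (v j) = (\<Sum>i\<in>J. c i * sh (u i) (v j))"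
      by (simp add: x clinear_sum[OF sh_linear(1)] clinear_scale[OF sh_linear(1)])
    also have "\<dots> = (\<Sum>i\<in>J. if i = j then c j else 0)"
      using sh_dual that J(2) by (intro sum.cong) auto
    finally show ?thesis using J(1) by simp
  qed
  have z: "sh x (v j) = 0" if "j \<in> I" "dg j \<noteq> \<mu>" for j
  proof (rule ccontr)
    assume nz: "sh x (v j) \<noteq> 0"
    have "- dg j = - \<mu>"
      by (rule sh_ws[OF assms(2), of "v j"]) (use dg[OF that(1)] assms(3) nz in simp_all)
    then show False using that(2) by simp
  qed
  have "(\<Sum>i\<in>J. sh x (v i) *\<^sub>C u i) = (\<Sum>i\<in>J. c i *\<^sub>C u i)"
    by (rule sum.cong[OF refl]) (use sx J(2) in auto)
  from trans[OF x this[symmetric]] have "x = (\<Sum>i\<in>J. sh x (v i) *\<^sub>C u i)" .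
  also have "\<dots> = (\<Sum>i\<in>J \<union> Imu \<mu>. sh x (v i) *\<^sub>C u i)"
    using J(1,2) finite_Imu sx by (intro sum.mono_neutral_left) (auto simp: Imu_def)
  also have "\<dots> = (\<Sum>i\<in>Imu \<mu>. sh x (v i) *\<^sub>C u i)"
    using J(1,2) finite_Imu z by (intro sum.mono_neutral_right) (auto simp: Imu_def)
  finally show ?thesis .
qed

text \<open>Spanning by the \<open>v i\<close> is not assumed. It results from expanding z along
  words, each \<open>pp w\<close> in the basis u, and recollecting the word expansions of the
  \<open>v i\<close>.\<close>

lemma expand_v:
  assumes "z \<in> U nm" "z \<in> ws (- \<mu>)" "\<mu> \<in> h_dual h"
  shows "z = (\<Sum>i\<in>Imu \<mu>. sh (u i) z *\<^sub>C v i)"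
proof -
  have s: "sh (pp w) z = (\<Sum>i\<in>Imu \<mu>. sh (pp w) (v i) * sh (u i) z)" if "w \<in> Wmu \<mu>" for w
  proof -
    have "pp w = (\<Sum>i\<in>Imu \<mu>. sh (pp w) (v i) *\<^sub>C u i)"
      using expand_u pp_in[of w] Wmu_words[OF that] assms(3) by blast
    then have "sh (pp w) z = sh (\<Sum>i\<in>Imu \<mu>. sh (pp w) (v i) *\<^sub>C u i) z" by simp
    then show ?thesis by (simp add: clinear_sum[OF sh_linear(1)] clinear_scale[OF sh_linear(1)])
  qed
  have vi: "v i = (\<Sum>w\<in>Wmu \<mu>. (cw w * sh (pp w) (v i)) *\<^sub>C pm w)" if "i \<in> Imu \<mu>" for i
  proof -
    have "i \<in> I" "dg i = \<mu>" using that by (auto simp: Imu_def)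
    then show ?thesis using expand_minus[of "v i" \<mu>] dg[of i] by auto
  qed
  have "z = (\<Sum>w\<in>Wmu \<mu>. (cw w * sh (pp w) z) *\<^sub>C pm w)" by (rule expand_minus[OF assms])
  also have "\<dots> = (\<Sum>w\<in>Wmu \<mu>. \<Sum>i\<in>Imu \<mu>. sh (u i) z *\<^sub>C ((cw w * sh (pp w) (v i)) *\<^sub>C pm w))"
    by (rule sum.cong[OF refl])
      (simp add: s sum_distrib_left cvs.scale_sum_left cscale_cscale mult.assoc mult.left_commute mult.commute)
  also have "\<dots> = (\<Sum>i\<in>Imu \<mu>. \<Sum>w\<in>Wmu \<mu>. sh (u i) z *\<^sub>C ((cw w * sh (pp w) (v i)) *\<^sub>C pm w))"
    by (rule sum.swap)
  also have "\<dots> = (\<Sum>i\<in>Imu \<mu>. sh (u i) z *\<^sub>C v i)"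
  proof (rule sum.cong[OF refl])
    fix i assume "i \<in> Imu \<mu>"
    from arg_cong[OF vi[OF this], of "\<lambda>t. sh (u i) z *\<^sub>C t"]
    show "(\<Sum>w\<in>Wmu \<mu>. sh (u i) z *\<^sub>C ((cw w * sh (pp w) (v i)) *\<^sub>C pm w)) = sh (u i) z *\<^sub>C v i"
      unfolding cvs.scale_sum_right by (rule sym)
  qed
  finally show ?thesis .
qed

lemma dual_basis_v: "inj_on v I" "cvs.independent (v ` I)" "cvs.span (v ` I) = U nm"
proof -
  show inj: "inj_on v I"
    by (rule inj_onI) (metis sh_dual zero_neq_one)
  show "cvs.independent (v ` I)"
    unfolding cvs.independent_explicit_module
  proof (intro allI impI)
    fix t c b assume t: "finite t" "t \<subseteq> v ` I" "(\<Sum>b\<in>t. c b *\<^sub>C b) = 0" "b \<in> t"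
    then obtain i where i: "i \<in> I" "b = v i" by blast
    have "sh (u i) b' = (if b' = b then 1 else 0)" if b': "b' \<in> t" for b'
    proof -
      obtain j where j: "j \<in> I" "b' = v j" using t(2) b' by blast
      then show ?thesis using sh_dual[OF i(1) j(1)] i inj_on_eq_iff[OF inj j(1) i(1)] by auto
    qed
    then have "sh (u i) (\<Sum>b\<in>t. c b *\<^sub>C b) = (\<Sum>b'\<in>t. if b' = b then c b else 0)"
      by (auto simp: clinear_sum[OF sh_linear(2)] clinear_scale[OF sh_linear(2)] intro!: sum.cong)
    then show "c b = 0" using t by (simp add: clinear_zero[OF sh_linear(2)])
  qed
  show "cvs.span (v ` I) = U nm"
  proof
    show "cvs.span (v ` I) \<subseteq> U nm" using dg by (intro cvs.span_minimal subspace_U) auto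
    show "U nm \<subseteq> cvs.span (v ` I)"
    proof
      fix z assume z: "z \<in> U nm"
      obtain F y where F: "finite F" "F \<subseteq> h_dual h" "\<forall>\<mu>\<in>F. y \<mu> \<in> U nm \<and> y \<mu> \<in> ws \<mu>" "z = (\<Sum>\<mu>\<in>F. y \<mu>)"
        using U_nm_decomposition[OF z] by (elim exE conjE)
      have "y \<mu> \<in> cvs.span (v ` I)" if "\<mu> \<in> F" for \<mu>
      proof -
        have "y \<mu> = (\<Sum>i\<in>Imu (- \<mu>). sh (u i) (y \<mu>) *\<^sub>C v i)"
          using expand_v[of "y \<mu>" "- \<mu>"] F(2,3) that by auto
        also have "\<dots> \<in> cvs.span (v ` I)"
          by (intro cvs.span_sum cvs.span_scale cvs.span_base) (auto simp: Imu_def)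
        finally show ?thesis .
      qed
      then show "z \<in> cvs.span (v ` I)" unfolding F(4) by (rule cvs.span_sum)
    qed
  qed
qed

text \<open>Expand each \<open>v i\<close> along words, exchange the sums and recollect the
  \<open>u i\<close> into \<open>pp w\<close>; the result no longer refers to the dual
  bases.\<close>

lemma canonical_sum: "has_completed_sum h (\<lambda>i. u i \<otimes>\<^sub>C v i) I canon"
  unfolding has_completed_sum_def
proof (intro allI)
  fix \<mu> \<nu>
  let ?T = "\<lambda>i. tensor_component h \<mu> \<nu> (u i \<otimes>\<^sub>C v i)" and ?N = "{i \<in> I. tensor_component h \<mu> \<nu> (u i \<otimes>\<^sub>C v i) \<noteq> 0}"
  have T: "?T i = (if \<mu> = dg i \<and> \<nu> = - dg i then u i \<otimes>\<^sub>C v i else 0)" if "i \<in> I" for i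
    using tensor_component_ws dg[OF that] by simp
  have N: "?N \<subseteq> Imu \<mu>" using T by (auto simp: Imu_def split: if_splits)
  then have fin: "finite ?N" using finite_Imu finite_subset by blast
  moreover have "canon \<mu> \<nu> = (\<Sum>i\<in>?N. ?T i)"
  proof (cases "\<nu> = - \<mu> \<and> \<mu> \<in> h_dual h")
    case True
    have "(\<Sum>i\<in>?N. ?T i) = (\<Sum>i\<in>Imu \<mu>. ?T i)"
      using N finite_Imu by (intro sum.mono_neutral_left) (auto simp: Imu_def)
    also have "\<dots> = (\<Sum>i\<in>Imu \<mu>. u i \<otimes>\<^sub>C v i)"
      using T True by (intro sum.cong) (auto simp: Imu_def)
    also have "\<dots> = (\<Sum>i\<in>Imu \<mu>. \<Sum>w\<in>Wmu \<mu>. (cw w * sh (pp w) (v i)) *\<^sub>C (u i \<otimes>\<^sub>C pm w))"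
    proof (rule sum.cong[OF refl])
      fix i assume "i \<in> Imu \<mu>"
      then have "i \<in> I" "dg i = \<mu>" by (auto simp: Imu_def)
      then have "v i = (\<Sum>w\<in>Wmu \<mu>. (cw w * sh (pp w) (v i)) *\<^sub>C pm w)"
        using expand_minus[of "v i" \<mu>] dg[of i] by auto
      then have "u i \<otimes>\<^sub>C v i = u i \<otimes>\<^sub>C (\<Sum>w\<in>Wmu \<mu>. (cw w * sh (pp w) (v i)) *\<^sub>C pm w)" by simp
      then show "u i \<otimes>\<^sub>C v i = (\<Sum>w\<in>Wmu \<mu>. (cw w * sh (pp w) (v i)) *\<^sub>C (u i \<otimes>\<^sub>C pm w))"
        by (simp add: clinear_sum[OF clinear_tensor_right] tensor_scale_right)
    qed
    also have "\<dots> = (\<Sum>w\<in>Wmu \<mu>. \<Sum>i\<in>Imu \<mu>. (cw w * sh (pp w) (v i)) *\<^sub>C (u i \<otimes>\<^sub>C pm w))"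
      by (rule sum.swap)
    also have "\<dots> = (\<Sum>w\<in>Wmu \<mu>. cw w *\<^sub>C (pp w \<otimes>\<^sub>C pm w))"
    proof (rule sum.cong[OF refl])
      fix w assume "w \<in> Wmu \<mu>"
      then have "pp w = (\<Sum>i\<in>Imu \<mu>. sh (pp w) (v i) *\<^sub>C u i)"
        using expand_u pp_in[of w] Wmu_words[of w] True by blast
      then have "pp w \<otimes>\<^sub>C pm w = (\<Sum>i\<in>Imu \<mu>. sh (pp w) (v i) *\<^sub>C u i) \<otimes>\<^sub>C pm w" by simp
      then show "(\<Sum>i\<in>Imu \<mu>. (cw w * sh (pp w) (v i)) *\<^sub>C (u i \<otimes>\<^sub>C pm w)) = cw w *\<^sub>C (pp w \<otimes>\<^sub>C pm w)"
        by (simp add: clinear_sum[OF clinear_tensor_left] tensor_scale_left cvs.scale_sum_right cscale_cscale)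
    qed
    finally show ?thesis using True by (simp add: canon_def)
  next
    case False
    have "?N = {}" using False T dg by (auto split: if_splits)
    moreover have "canon \<mu> \<nu> = 0"
    proof (cases "\<nu> = - \<mu>")
      case True
      then have "\<mu> \<notin> h_dual h" using False by blast
      then have "Wmu \<mu> = {}" using Wmu_words wtw_h_dual by blast
      then show ?thesis by (simp add: canon_def)
    qed (simp add: canon_def)
    ultimately show ?thesis by simp
  qed
  ultimately show "finite ?N \<and> canon \<mu> \<nu> = (\<Sum>i\<in>?N. ?T i)" by blast
qed

end

section \<open>Existence and uniqueness of the canonical element\<close>

lemma dual_family_exists: "\<exists>B v. dual_family (B :: 'g uea set) (\<lambda>b. b) v"
proof -
  let ?H = "{z \<in> U np. \<exists>\<mu>\<in>h_dual h. z \<in> ws \<mu>}"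
  obtain B where B: "B \<subseteq> ?H" "cvs.independent B" "?H \<subseteq> cvs.span B"
    using cvs.maximal_independent_subset by blast
  have span: "cvs.span B = U np"
  proof
    show "cvs.span B \<subseteq> U np" using B(1) by (intro cvs.span_minimal subspace_U) auto
    show "U np \<subseteq> cvs.span B"
    proof
      fix z assume z: "z \<in> U np"
      obtain F y where F: "finite F" "F \<subseteq> h_dual h" "\<forall>\<mu>\<in>F. y \<mu> \<in> U np \<and> y \<mu> \<in> ws \<mu>" "z = (\<Sum>\<mu>\<in>F. y \<mu>)"
        using U_np_decomposition[OF z] by (elim exE conjE)
      then have "y \<mu> \<in> cvs.span B" if "\<mu> \<in> F" for \<mu> using that B(3) by blast
      then show "z \<in> cvs.span B" unfolding F(4) by (rule cvs.span_sum)
    qed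
  qed
  have "\<forall>b\<in>B. \<exists>\<mu>. \<mu> \<in> h_dual h \<and> b \<in> ws \<mu>" using B(1) by blast
  then obtain d where d: "\<And>b. b \<in> B \<Longrightarrow> d b \<in> h_dual h \<and> b \<in> ws (d b)" by metis
  let ?r = "cvs.representation B"
  \<comment> \<open>Reading the b-coordinate off the expansion of a basis element a as the sum of
    \<open>(cw w * sh a (pm w)) *\<^sub>C pp w\<close> must give 1 or 0; this dictates the
    coefficients of \<open>pm w\<close>.\<close>
  define v where "v b = (\<Sum>w\<in>Wmu (d b). (cw w * ?r (pp w) b) *\<^sub>C pm w)" for b
  have pmd: "pm w \<in> U nm" "pm w \<in> ws (- d b)" if "w \<in> Wmu (d b)" for w b
    using pm_in[OF conjunct1[OF Wmu_words[OF that]]] unfolding conjunct2[OF Wmu_words[OF that]] by blast+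
  have v: "v b \<in> U nm \<and> v b \<in> ws (- d b)" for b
    unfolding v_def using pmd
    by (auto intro!: cvs.subspace_sum[OF subspace_U] cvs.subspace_scale[OF subspace_U]
        cvs.subspace_sum[OF subspace_ws] cvs.subspace_scale[OF subspace_ws])
  have "sh a (v b) = (if a = b then 1 else 0)" if ab: "a \<in> B" "b \<in> B" for a b
  proof (cases "d a = d b")
    case True
    have aU: "a \<in> U np" using ab B(1) by blast
    have pU: "(cw w * sh a (pm w)) *\<^sub>C pp w \<in> cvs.span B" if "w \<in> Wmu (d b)" for w
      using pp_in[of w] Wmu_words[OF that] span cvs.span_scale by blast
    have "sh a (v b) = (\<Sum>w\<in>Wmu (d b). cw w * sh a (pm w) * ?r (pp w) b)"
      by (simp add: v_def clinear_sum[OF sh_linear(2)] clinear_scale[OF sh_linear(2)] mult.commute mult.left_commute)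
    also have "\<dots> = (\<Sum>w\<in>Wmu (d b). ?r ((cw w * sh a (pm w)) *\<^sub>C pp w) b)"
      by (rule sum.cong[OF refl])
        (use pp_in Wmu_words span in \<open>auto simp: cvs.representation_scale[OF B(2)]\<close>)
    also have "\<dots> = ?r (\<Sum>w\<in>Wmu (d b). (cw w * sh a (pm w)) *\<^sub>C pp w) b"
      by (rule fun_cong[OF cvs.representation_sum[OF B(2) pU], symmetric])
    also have "(\<Sum>w\<in>Wmu (d b). (cw w * sh a (pm w)) *\<^sub>C pp w) = a"
      using expand_plus[OF aU, of "d b"] d[OF ab(1)] True by simp
    also have "?r a b = (if a = b then 1 else 0)"
      by (simp add: cvs.representation_basis[OF B(2) ab(1)])
    finally show ?thesis .
  next
    case False
    have "sh a (v b) = 0"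
    proof (rule ccontr)
      assume "sh a (v b) \<noteq> 0"
      then have "- d b = - d a" using sh_ws d[OF ab(1)] d[OF ab(2)] v[of b] h_dual_minus by blast
      then show False using False by simp
    qed
    then show ?thesis using False by auto
  qed
  moreover have "\<forall>b\<in>B. \<exists>\<mu>\<in>h_dual h. b \<in> ws \<mu> \<and> v b \<in> U nm \<and> v b \<in> ws (- \<mu>)"
    using d v by blast
  ultimately have "dual_family B (\<lambda>b. b) v"
    unfolding dual_family_def using B(2) span by simp
  then show ?thesis by blast
qed

text \<open>Dual homogeneous bases need not come with matching degrees by definition, but
  \<open>u i\<close> and \<open>v i\<close> pair to 1, which forces their degrees to be opposite. So
  they form a dual family, whose sum is \<open>canon\<close>.\<close>

lemma canonical_unique: "is_canonical_element h lam Pos F \<Longrightarrow> F = canon"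
proof -
  assume "is_canonical_element h lam Pos F"
  then obtain I :: "'g uea set" and u v where I: "homogeneous_basis h (U np) I u" "homogeneous_basis h (U nm) I v"
    "\<forall>i\<in>I. \<forall>j\<in>I. sh (u i) (v j) = (if i = j then 1 else 0)"
    "has_completed_sum h (\<lambda>i. u i \<otimes>\<^sub>C v i) I F"
    unfolding is_canonical_element_def by blast
  have "\<exists>\<mu>\<in>h_dual h. u i \<in> ws \<mu> \<and> v i \<in> U nm \<and> v i \<in> ws (- \<mu>)" if i: "i \<in> I" for i
  proof -
    have nz: "u i \<noteq> 0" "v i \<noteq> 0"
      using I(1,2) i cvs.dependent_zero unfolding homogeneous_basis_def by (metis imageI)+
    obtain \<mu> \<nu> where mn: "u i \<in> uea_degree h \<mu>" "v i \<in> uea_degree h \<nu>"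
      using I(1,2) i unfolding homogeneous_basis_def homogeneous_def by blast
    then have d: "\<mu> \<in> h_dual h" "\<nu> \<in> h_dual h" using uea_degree_h_dual nz by blast+
    then have w: "u i \<in> ws \<mu>" "v i \<in> ws \<nu>" using mn uea_degree_ws by auto
    have "sh (u i) (v i) \<noteq> 0" using I(3) i by simp
    then have "\<nu> = - \<mu>" using sh_ws w d by blast
    moreover have "v i \<in> U nm" using I(2) i cvs.span_base unfolding homogeneous_basis_def by blast
    ultimately show ?thesis using w d by blast
  qed
  then have "dual_family I u v"
    using I(1,3) unfolding dual_family_def homogeneous_basis_def by blast
  from canonical_sum[OF this] I(4) show "F = canon"
    unfolding has_completed_sum_def by (intro ext) metis
qed

lemma canonical_exists: "is_canonical_element h lam Pos canon"
proof -
  obtain B :: "'g uea set" and v where B: "dual_family B (\<lambda>b. b) v" using dual_family_exists by blast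
  have hom: "homogeneous h z" if "z \<in> ws \<mu>" "\<mu> \<in> h_dual h" for z \<mu>
    using that uea_degree_ws unfolding homogeneous_def by blast
  have "homogeneous_basis h (U np) B (\<lambda>b. b)"
    using B hom unfolding homogeneous_basis_def dual_family_def by blast
  moreover have "homogeneous_basis h (U nm) B v"
    using dual_basis_v[OF B] dg[OF B] hom h_dual_minus unfolding homogeneous_basis_def by blast
  moreover have "\<forall>i\<in>B. \<forall>j\<in>B. sh i (v j) = (if i = j then 1 else 0)"
    using B unfolding dual_family_def by blast
  ultimately show ?thesis
    using canonical_sum[OF B] unfolding is_canonical_element_def by blast
qed

lemma canonical_element_eq: "canonical_element h lam Pos = canon"
  unfolding canonical_element_def using canonical_exists canonical_unique by (rule the_equality)

lemma canon_in_completed: "canon \<in> completed_tensor_product h (U np) (U nm)"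
  unfolding completed_tensor_product_def
proof (intro CollectI allI)
  fix \<mu> \<nu>
  let ?S = "{a \<otimes>\<^sub>C b | a b. a \<in> U np \<inter> uea_degree h \<mu> \<and> b \<in> U nm \<inter> uea_degree h \<nu>}"
  show "canon \<mu> \<nu> \<in> cvs.span ?S"
  proof (cases "\<nu> = - \<mu>")
    case True
    have "pp w \<otimes>\<^sub>C pm w \<in> ?S" if "w \<in> Wmu \<mu>" for w
    proof -
      have w: "w \<in> words" "wtw w = \<mu>" using Wmu_words[OF that] by auto
      then have "\<mu> \<in> h_dual h" using wtw_h_dual by blast
      then have "uea_degree h \<mu> = ws \<mu>" "uea_degree h \<nu> = ws (- \<mu>)"
        using True uea_degree_ws h_dual_minus by blast+
      then show ?thesis using pp_in[OF w(1)] pm_in[OF w(1)] w(2) by auto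
    qed
    then have "(\<Sum>w\<in>Wmu \<mu>. cw w *\<^sub>C (pp w \<otimes>\<^sub>C pm w)) \<in> cvs.span ?S"
      by (intro cvs.span_sum cvs.span_scale) (rule cvs.span_base)
    then show ?thesis using True by (simp only: canon_def simp_thms if_True)
  qed (simp add: canon_def cvs.span_zero)
qed

text \<open>A word contributes to a single bidegree, that of its weight and the negative, so
  summability amounts to the finiteness of \<open>Wmu\<close>.\<close>

lemma word_sum: "has_completed_sum h (\<lambda>w. cw w *\<^sub>C (pp w \<otimes>\<^sub>C pm w)) Wt canon"
  unfolding has_completed_sum_def
proof (intro allI)
  fix \<mu> \<nu>
  let ?t = "\<lambda>w. cw w *\<^sub>C (pp w \<otimes>\<^sub>C pm w)"
  let ?T = "\<lambda>w. tensor_component h \<mu> \<nu> (?t w)" and ?N = "{w \<in> Wt. tensor_component h \<mu> \<nu> (cw w *\<^sub>C (pp w \<otimes>\<^sub>C pm w)) \<noteq> 0}"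
  have T: "?T w = (if \<mu> = wtw w \<and> \<nu> = - wtw w then ?t w else 0)" if "w \<in> Wt" for w
  proof -
    have w: "w \<in> words" using that Wt_words by blast
    then show ?thesis
      using tensor_component_ws[of "pp w" "wtw w" "pm w" "- wtw w"] pp_in pm_in wtw_h_dual[OF w]
      by (simp add: clinear_scale[OF tensor_component(1)])
  qed
  have N: "?N \<subseteq> Wmu \<mu>" using T by (auto simp: Wmu_def split: if_splits)
  then have "finite ?N" using finite_Wmu finite_subset by blast
  moreover have "canon \<mu> \<nu> = (\<Sum>w\<in>?N. ?T w)"
  proof -
    have "(\<Sum>w\<in>?N. ?T w) = (\<Sum>w\<in>Wmu \<mu>. ?T w)"
      using N finite_Wmu by (intro sum.mono_neutral_left) (auto simp: Wmu_def)
    also have "\<dots> = (\<Sum>w\<in>Wmu \<mu>. if \<nu> = - \<mu> then ?t w else 0)"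
      using T by (intro sum.cong) (auto simp: Wmu_def)
    also have "\<dots> = canon \<mu> \<nu>" by (simp add: canon_def)
    finally show ?thesis ..
  qed
  ultimately show "finite ?N \<and> canon \<mu> \<nu> = (\<Sum>w\<in>?N. ?T w)" by blast
qed

end

theorem theoremI:
  fixes lam :: "'g::complex_lie_algebra \<Rightarrow> complex"
    and h :: "'g set"
    and Pos :: "('g \<Rightarrow> complex) set"
    and k :: nat
    and al :: "nat \<Rightarrow> 'g \<Rightarrow> complex"
    and X Y :: "nat \<Rightarrow> 'g"
  assumes "semisimple_lie_algebra TYPE('g)"
    and "semisimple_functional lam"
    and "cartan_subalgebra h"
    and "sharp lam \<in> h"
    and "invariant_ordering h lam Pos"
    and "bij_betw al {1..k} Pos"
    and "\<forall>i\<in>{1..k}. X i \<in> root_space h (al i) \<and> Y i \<in> root_space h (- al i) \<and> killing (X i) (Y i) = 1"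
    and "lam \<in> Lambda_tilde h Pos"
  shows "nondegenerate_pairing (U (n_plus h lam Pos)) (U (n_minus h lam Pos)) (shapovalov h lam Pos) \<and>
    (\<exists>!F. is_canonical_element h lam Pos F) \<and>
    canonical_element h lam Pos \<in>
      completed_tensor_product h (U (n_plus h lam Pos)) (U (n_minus h lam Pos)) \<and>
    has_completed_sum h
      (\<lambda>w. inverse (p_word Pos lam al w (word_weight al w)) *\<^sub>C
         (pi_plus h lam Pos (word_product X w) \<otimes>\<^sub>C pi_minus h lam Pos (word_product Y w)))
      (W_tilde h lam Pos k al)
      (canonical_element h lam Pos)"
proof -
  interpret cartan_semisimple h by unfold_locales (rule assms)+
  have L: "lam \<in> h_dual h" "\<And>\<mu>. \<mu> \<in> nat_cone (roots_hat h lam \<inter> Pos) \<Longrightarrow> \<mu> \<noteq> 0 \<Longrightarrow> p_coeff Pos lam \<mu> \<noteq> 0"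
    using assms(8) by (auto simp: Lambda_tilde_def)
  interpret shapovalov_data h lam Pos k al X Y
    by unfold_locales (use L assms(5-7) in auto)
  have "\<exists>!F. is_canonical_element h lam Pos F"
    using canonical_exists canonical_unique by blast
  then show ?thesis
    using nondegenerate canon_in_completed word_sum
    unfolding canonical_element_eq cw_def pp_def pm_def by blast
qed

end
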